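(* Let $M$ be a differentiable manifold and $\nabla$ a linear connection on $M$. Along every path $\gamma:J\to M$ ($J\subset\mathbb R$ an interval) there exist bases in which the components of $\nabla$ vanish on $\gamma(J)$. These bases are obtained along $\gamma$ from one another by linear transformations $E_{i'}=A^i_{\ i'}E_i$ whose coefficients are such that the action of the vectors of these bases on them vanishes on $\gamma(J)$, i.e. $E_k(A^i_{\ i'})|_{\gamma(s)}=0$ for all $s\in J$ and all $i,i',k$.
   Context: In a local $C^1$ basis $\{E_i\}$ the (continuous) components $\Gamma^i_{\ jk}$ of $\nabla$ are defined by $\nabla_X E_j=\Gamma^i_{\ jk}X^kE_i$ for $X=X^kE_k$ (summation convention). No symmetry (torsion-freeness) is assumed. Paths are $C^1$ with nowhere vanishing tangent vector; a path (or a part of it, i.e. its restriction to a subinterval) is without self-intersections if it is a $C^1$ embedding, so that it can be made a coordinate line. Basis along $\gamma$: if $\gamma$ is without self-intersections and $\gamma(J)$ lies in one coordinate neighborhood, it is a $C^1$ basis of vector fields on a neighborhood of $\gamma(J)$. In general it is not required to be continuous: it is glued from $C^1$ bases $\{E^{(a)}_i\}$ on open coordinate neighborhoods $N_a\supset\gamma(J_a)$, where the subintervals $J_a$ cover $J$ and each $\gamma|_{J_a}$ is without self-intersections. At each $x\in\gamma(J)$ the basis is taken to be one chosen $\{E^{(a)}_i\}$ with $x\in\gamma(J_a)$, and components and derivatives at $x$ are computed in that basis. *)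

theory Defs
  imports "HOL-Analysis.Analysis"
begin

(* C^1 and C^2 maps on open subsets of normed spaces. *)

definition C1_on :: "('a::real_normed_vector \<Rightarrow> 'b::real_normed_vector) \<Rightarrow> 'a set \<Rightarrow> bool" where
  "C1_on f S \<longleftrightarrow>
     (\<exists>f'. (\<forall>x\<in>S. (f has_derivative blinfun_apply (f' x)) (at x)) \<and> continuous_on S f')"

definition C2_on :: "('a::real_normed_vector \<Rightarrow> 'b::real_normed_vector) \<Rightarrow> 'a set \<Rightarrow> bool" where
  "C2_on f S \<longleftrightarrow>
     (\<exists>f'. (\<forall>x\<in>S. (f has_derivative blinfun_apply (f' x)) (at x)) \<and> C1_on f' S)"

(* A chart is a pair of its domain and its coordinate map; outside the domain the map is arbitrary. *)

type_synonym ('m, 'n) chart = "'m set \<times> ('m \<Rightarrow> real ^ 'n)"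

(* Class C^2 is the least smoothness for which C^1 vector fields make sense.  The atlas need not
   be maximal, so every atlas of class C^k with 2 \<le> k \<le> \<infinity> is an instance. *)

definition manifold :: "'m::t2_space set \<Rightarrow> ('m, 'n::finite) chart set \<Rightarrow> bool" where
  "manifold M \<A> \<longleftrightarrow>
     M = (\<Union>(U, \<phi>)\<in>\<A>. U) \<and>
     (\<forall>(U, \<phi>)\<in>\<A>. open U \<and> open (\<phi> ` U) \<and> homeomorphism U (\<phi> ` U) \<phi> (inv_into U \<phi>)) \<and>
     (\<forall>(U, \<phi>)\<in>\<A>. \<forall>(V, \<psi>)\<in>\<A>. C2_on (\<psi> \<circ> inv_into U \<phi>) (\<phi> ` (U \<inter> V)))"

(* A tangent vector is the family of its components in the charts.  The type below only provides
   the ambient vector space; the tangent space at a point is the subspace of those families that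
   obey the transformation law there. *)

typedef ('m, 'n) tvec = "UNIV :: (('m, 'n::finite) chart \<Rightarrow> real ^ 'n) set"
  morphisms comp Tvec ..

setup_lifting type_definition_tvec

instantiation tvec :: (type, finite) real_vector
begin

lift_definition zero_tvec :: "('a, 'b) tvec" is "\<lambda>c. 0" .
lift_definition plus_tvec :: "('a, 'b) tvec \<Rightarrow> ('a, 'b) tvec \<Rightarrow> ('a, 'b) tvec"
  is "\<lambda>v w c. v c + w c" .
lift_definition minus_tvec :: "('a, 'b) tvec \<Rightarrow> ('a, 'b) tvec \<Rightarrow> ('a, 'b) tvec"
  is "\<lambda>v w c. v c - w c" .
lift_definition uminus_tvec :: "('a, 'b) tvec \<Rightarrow> ('a, 'b) tvec" is "\<lambda>v c. - v c" .
lift_definition scaleR_tvec :: "real \<Rightarrow> ('a, 'b) tvec \<Rightarrow> ('a, 'b) tvec" is "\<lambda>r v c. r *\<^sub>R v c" .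

instance
  by standard (transfer; simp add: fun_eq_iff algebra_simps)+

end

definition tangent_space :: "('m, 'n::finite) chart set \<Rightarrow> 'm \<Rightarrow> ('m, 'n) tvec set" where
  "tangent_space \<A> p =
     {v. (\<forall>(U, \<phi>)\<in>\<A>. \<forall>(V, \<psi>)\<in>\<A>. p \<in> U \<inter> V \<longrightarrow>
            comp v (V, \<psi>) = frechet_derivative (\<psi> \<circ> inv_into U \<phi>) (at (\<phi> p)) (comp v (U, \<phi>))) \<and>
         (\<forall>U \<phi>. \<not> ((U, \<phi>) \<in> \<A> \<and> p \<in> U) \<longrightarrow> comp v (U, \<phi>) = 0)}"

(* Functions and vector fields on an open set N are total functions of which only the values on N
   matter. *)

definition C1_function :: "('m, 'n::finite) chart set \<Rightarrow> 'm set \<Rightarrow> ('m \<Rightarrow> real) \<Rightarrow> bool" where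
  "C1_function \<A> N f \<longleftrightarrow> (\<forall>(U, \<phi>)\<in>\<A>. C1_on (f \<circ> inv_into U \<phi>) (\<phi> ` (U \<inter> N)))"

definition continuous_field ::
    "('m::topological_space, 'n::finite) chart set \<Rightarrow> 'm set \<Rightarrow> ('m \<Rightarrow> ('m, 'n) tvec) \<Rightarrow> bool" where
  "continuous_field \<A> N X \<longleftrightarrow>
     (\<forall>p\<in>N. X p \<in> tangent_space \<A> p) \<and>
     (\<forall>(U, \<phi>)\<in>\<A>. continuous_on (U \<inter> N) (\<lambda>p. comp (X p) (U, \<phi>)))"

definition C1_field ::
    "('m, 'n::finite) chart set \<Rightarrow> 'm set \<Rightarrow> ('m \<Rightarrow> ('m, 'n) tvec) \<Rightarrow> bool" where
  "C1_field \<A> N X \<longleftrightarrow>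
     (\<forall>p\<in>N. X p \<in> tangent_space \<A> p) \<and>
     (\<forall>(U, \<phi>)\<in>\<A>. C1_on (\<lambda>x. comp (X (inv_into U \<phi> x)) (U, \<phi>)) (\<phi> ` (U \<inter> N)))"

(* The action v(f) of a tangent vector at p on a function of class C^1 near p.  By the chain rule
   and the transformation law it does not depend on the chart chosen. *)

definition act :: "('m, 'n::finite) chart set \<Rightarrow> 'm \<Rightarrow> ('m, 'n) tvec \<Rightarrow> ('m \<Rightarrow> real) \<Rightarrow> real" where
  "act \<A> p v f =
     (let c = (SOME c. c \<in> \<A> \<and> p \<in> fst c)
      in frechet_derivative (f \<circ> inv_into (fst c) (snd c)) (at (snd c p)) (comp v c))"

(* A linear connection, given as Koszul's operator nabla X Y on fields over all open sets N: it is
   defined for continuous X and for Y of class C^1, with a continuous value, so that its components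
   in C^1 bases are continuous.  The clause with X = X' and Y = Y' on N says that nabla commutes
   with restriction to open subsets. *)

definition linear_connection ::
    "'m::t2_space set \<Rightarrow> ('m, 'n::finite) chart set
      \<Rightarrow> (('m \<Rightarrow> ('m, 'n) tvec) \<Rightarrow> ('m \<Rightarrow> ('m, 'n) tvec) \<Rightarrow> 'm \<Rightarrow> ('m, 'n) tvec) \<Rightarrow> bool" where
  "linear_connection M \<A> nabla \<longleftrightarrow>
     (\<forall>N X X' Y Y'. open N \<and> N \<subseteq> M \<and> continuous_field \<A> N X \<and> continuous_field \<A> N X' \<and>
        C1_field \<A> N Y \<and> C1_field \<A> N Y' \<longrightarrow>
          continuous_field \<A> N (nabla X Y) \<and>
          (\<forall>f. continuous_on N f \<longrightarrow>
             (\<forall>p\<in>N. nabla (\<lambda>q. f q *\<^sub>R X q + X' q) Y p = f p *\<^sub>R nabla X Y p + nabla X' Y p)) \<and>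
          (\<forall>p\<in>N. nabla X (\<lambda>q. Y q + Y' q) p = nabla X Y p + nabla X Y' p) \<and>
          (\<forall>f. C1_function \<A> N f \<longrightarrow>
             (\<forall>p\<in>N. nabla X (\<lambda>q. f q *\<^sub>R Y q) p = act \<A> p (X p) f *\<^sub>R Y p + f p *\<^sub>R nabla X Y p)) \<and>
          ((\<forall>p\<in>N. X p = X' p \<and> Y p = Y' p) \<longrightarrow> (\<forall>p\<in>N. nabla X Y p = nabla X' Y' p)))"

definition C1_basis ::
    "('m, 'n::finite) chart set \<Rightarrow> 'm set \<Rightarrow> ('n \<Rightarrow> 'm \<Rightarrow> ('m, 'n) tvec) \<Rightarrow> bool" where
  "C1_basis \<A> N E \<longleftrightarrow>
     (\<forall>i. C1_field \<A> N (E i)) \<and>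
     (\<forall>p\<in>N. inj (\<lambda>i. E i p) \<and> independent (range (\<lambda>i. E i p)) \<and>
             span (range (\<lambda>i. E i p)) = tangent_space \<A> p)"

(* \<Gamma> i j k stands for the component with upper index i and lower indices j, k, the last one being
   that of the direction of differentiation. *)

definition components ::
    "(('m::topological_space \<Rightarrow> ('m, 'n::finite) tvec) \<Rightarrow> ('m \<Rightarrow> ('m, 'n) tvec) \<Rightarrow> 'm \<Rightarrow> ('m, 'n) tvec)
      \<Rightarrow> 'm set \<Rightarrow> ('n \<Rightarrow> 'm \<Rightarrow> ('m, 'n) tvec) \<Rightarrow> ('n \<Rightarrow> 'n \<Rightarrow> 'n \<Rightarrow> 'm \<Rightarrow> real) \<Rightarrow> bool" where
  "components nabla N E \<Gamma> \<longleftrightarrow>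
     (\<forall>\<xi> :: 'n \<Rightarrow> 'm \<Rightarrow> real. (\<forall>k. continuous_on N (\<xi> k)) \<longrightarrow>
        (\<forall>j. \<forall>p\<in>N. nabla (\<lambda>q. \<Sum>k\<in>UNIV. \<xi> k q *\<^sub>R E k q) (E j) p =
                   (\<Sum>i\<in>UNIV. (\<Sum>k\<in>UNIV. \<Gamma> i j k p * \<xi> k p) *\<^sub>R E i p)))"

definition components_vanish_at ::
    "(('m::topological_space \<Rightarrow> ('m, 'n::finite) tvec) \<Rightarrow> ('m \<Rightarrow> ('m, 'n) tvec) \<Rightarrow> 'm \<Rightarrow> ('m, 'n) tvec)
      \<Rightarrow> 'm set \<Rightarrow> ('n \<Rightarrow> 'm \<Rightarrow> ('m, 'n) tvec) \<Rightarrow> 'm \<Rightarrow> bool" where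
  "components_vanish_at nabla N E p \<longleftrightarrow>
     (\<exists>\<Gamma>. components nabla N E \<Gamma> \<and> (\<forall>i j k. \<Gamma> i j k p = 0))"

definition C1_path ::
    "'m::t2_space set \<Rightarrow> ('m, 'n::finite) chart set \<Rightarrow> real set \<Rightarrow> (real \<Rightarrow> 'm) \<Rightarrow> bool" where
  "C1_path M \<A> J \<gamma> \<longleftrightarrow>
     is_interval J \<and> (\<exists>a\<in>J. \<exists>b\<in>J. a < b) \<and> \<gamma> ` J \<subseteq> M \<and> continuous_on J \<gamma> \<and>
     (\<forall>(U, \<phi>)\<in>\<A>. \<exists>d. continuous_on (J \<inter> \<gamma> -` U) d \<and>
        (\<forall>s\<in>J \<inter> \<gamma> -` U. ((\<phi> \<circ> \<gamma>) has_vector_derivative d s) (at s within J) \<and> d s \<noteq> 0))"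

(* For an immersed curve, being an embedding means being a homeomorphism onto its image. *)

definition without_self_intersections ::
    "'m::t2_space set \<Rightarrow> ('m, 'n::finite) chart set \<Rightarrow> real set \<Rightarrow> (real \<Rightarrow> 'm) \<Rightarrow> bool" where
  "without_self_intersections M \<A> J \<gamma> \<longleftrightarrow>
     C1_path M \<A> J \<gamma> \<and> (\<exists>g. homeomorphism J (\<gamma> ` J) \<gamma> g)"

definition coordinate_nbhd :: "('m::topological_space, 'n::finite) chart set \<Rightarrow> 'm set \<Rightarrow> bool" where
  "coordinate_nbhd \<A> N \<longleftrightarrow> open N \<and> (\<exists>(U, \<phi>)\<in>\<A>. N \<subseteq> U)"

(* A basis along \<gamma> : J \<rightarrow> M is a pair (P, \<sigma>): P is the set of the triples (J_a, N_a, E_a) that are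
   glued, and \<sigma> x is the triple chosen at the point x of \<gamma> ` J. *)

type_synonym ('m, 'n) patch = "real set \<times> 'm set \<times> ('n \<Rightarrow> 'm \<Rightarrow> ('m, 'n) tvec)"

definition basis_along ::
    "'m::t2_space set \<Rightarrow> ('m, 'n::finite) chart set \<Rightarrow> real set \<Rightarrow> (real \<Rightarrow> 'm)
      \<Rightarrow> ('m, 'n) patch set \<Rightarrow> ('m \<Rightarrow> ('m, 'n) patch) \<Rightarrow> bool" where
  "basis_along M \<A> J \<gamma> P \<sigma> \<longleftrightarrow>
     (if without_self_intersections M \<A> J \<gamma> \<and> (\<exists>U. coordinate_nbhd \<A> U \<and> \<gamma> ` J \<subseteq> U)
      then \<exists>N E. P = {(J, N, E)} \<and> open N \<and> N \<subseteq> M \<and> \<gamma> ` J \<subseteq> N \<and> C1_basis \<A> N E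
      else (\<Union>(K, N, E)\<in>P. K) = J \<and>
           (\<forall>(K, N, E)\<in>P. without_self_intersections M \<A> K \<gamma> \<and>
              coordinate_nbhd \<A> N \<and> \<gamma> ` K \<subseteq> N \<and> C1_basis \<A> N E)) \<and>
     (\<forall>x\<in>\<gamma> ` J. \<sigma> x \<in> P \<and> x \<in> \<gamma> ` fst (\<sigma> x))"

definition components_vanish_along ::
    "(('m::topological_space \<Rightarrow> ('m, 'n::finite) tvec) \<Rightarrow> ('m \<Rightarrow> ('m, 'n) tvec) \<Rightarrow> 'm \<Rightarrow> ('m, 'n) tvec)
      \<Rightarrow> real set \<Rightarrow> (real \<Rightarrow> 'm) \<Rightarrow> ('m \<Rightarrow> ('m, 'n) patch) \<Rightarrow> bool" where
  "components_vanish_along nabla J \<gamma> \<sigma> \<longleftrightarrow>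
     (\<forall>x\<in>\<gamma> ` J. case \<sigma> x of (K, N, E) \<Rightarrow> components_vanish_at nabla N E x)"

(* E' i' = A i i' E i on N, with coefficients of class C^1; A is unique on N when E is a basis. *)

definition transformation ::
    "('m, 'n::finite) chart set \<Rightarrow> 'm set \<Rightarrow> ('n \<Rightarrow> 'm \<Rightarrow> ('m, 'n) tvec)
      \<Rightarrow> ('n \<Rightarrow> 'm \<Rightarrow> ('m, 'n) tvec) \<Rightarrow> ('n \<Rightarrow> 'n \<Rightarrow> 'm \<Rightarrow> real) \<Rightarrow> bool" where
  "transformation \<A> N E E' A \<longleftrightarrow>
     (\<forall>i i'. C1_function \<A> N (A i i')) \<and>
     (\<forall>p\<in>N. \<forall>i'. E' i' p = (\<Sum>i\<in>UNIV. A i i' p *\<^sub>R E i p))"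

end

theory Submission
  imports Defs
begin

text \<open>
  Two facts carry the theorem. The first is the law of change for the components of a connection: if
  \<open>E' j = (\<Sum>i. A i j E i)\<close>, then the derivative of \<open>E' j\<close> in the direction \<open>E' k\<close> is
  \<open>\<Sum>i. (E' k)(A i j) E i\<close> plus a combination, with coefficients from \<open>A\<close>, of the derivatives of
  the \<open>E i\<close> in the directions \<open>E l\<close> (\<open>nabla_transformation\<close>). At a point where the components in
  \<open>E\<close> vanish only the first sum is left. Hence those in \<open>E'\<close> vanish there as well exactly when
  all \<open>(E' k)(A i j)\<close> do, which is the same as all \<open>(E k)(A i j)\<close>
  (\<open>vanishing_transformation_iff\<close>). Such coefficients \<open>A\<close> of class \<open>C\<^sup>1\<close> exist for any
  two bases, by Cramer's rule (\<open>transformation_exists\<close>).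

  The second fact is existence along an arc \<open>c\<close> without self-intersections in a chart. Applied to the
  coordinate basis, the law of change asks for an invertible matrix function \<open>A\<close> of class
  \<open>C\<^sup>1\<close> near the arc with \<open>\<partial>A/\<partial>x\<^sup>k = - \<Gamma>\<^sub>k A\<close> on the arc. In the direction of the
  arc this is a linear differential equation, whose fundamental solution \<open>Y\<close> exists on all of the
  parameter interval (\<open>matrix_ode_on_interval\<close>) and gives the values of \<open>A\<close> on the arc. What is
  left is to find a \<open>C\<^sup>1\<close> map whose value and total derivative are prescribed on the arc, both
  continuous and compatible in the direction of the arc
  (\<open>embedded_curve_jet_extension\<close>, a case of Whitney's extension theorem). As the
  \<open>\<Gamma>\<^sub>k\<close> are only continuous, a map affine in the displacement from the arc need not be of class
  \<open>C\<^sup>1\<close>. Near a point of the arc, differences of antiderivatives of the prescribed partial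
  derivatives repair this (\<open>arc_jet_extension\<close>), and the local solutions are glued with weights
  (\<open>C1_jet_gluing\<close>).

  An arbitrary path is an immersion, so each of its points lies on a compact arc without
  self-intersections inside one chart (\<open>C1_path_local_arc\<close>), and one basis is taken for each such arc.
\<close>

section \<open>Maps of class C1\<close>

lemma C1_onI:
  assumes "\<And>x. x \<in> S \<Longrightarrow> (f has_derivative blinfun_apply (f' x)) (at x)" and "continuous_on S f'"
  shows "C1_on f S"
  using assms unfolding C1_on_def by blast

lemma C1_onE:
  assumes "C1_on f S"
  obtains f' where "\<And>x. x \<in> S \<Longrightarrow> (f has_derivative blinfun_apply (f' x)) (at x)"
    and "continuous_on S f'"
  using assms unfolding C1_on_def by blast

lemma C1_on_subset: "C1_on f S \<Longrightarrow> T \<subseteq> S \<Longrightarrow> C1_on f T"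
  unfolding C1_on_def by (meson continuous_on_subset subsetD)

lemma C1_on_imp_continuous_on: "C1_on f S \<Longrightarrow> continuous_on S f"
  unfolding C1_on_def
  by (meson continuous_at_imp_continuous_on has_derivative_continuous)

lemma C1_on_differentiable: "C1_on f S \<Longrightarrow> x \<in> S \<Longrightarrow> f differentiable at x"
  unfolding C1_on_def differentiable_def by blast

lemma C1_on_cong:
  assumes "open S" and "\<And>x. x \<in> S \<Longrightarrow> f x = g x" and "C1_on f S"
  shows "C1_on g S"
proof -
  obtain f' where f': "\<And>x. x \<in> S \<Longrightarrow> (f has_derivative blinfun_apply (f' x)) (at x)"
    and cont: "continuous_on S f'"
    using assms(3) by (rule C1_onE) blast
  show ?thesis
  proof (rule C1_onI[OF _ cont])
    fix x assume "x \<in> S"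
    then show "(g has_derivative blinfun_apply (f' x)) (at x)"
      using has_derivative_transform_within_open[OF f' assms(1)] assms(2) by blast
  qed
qed

lemma C1_on_const: "C1_on (\<lambda>x. a) S"
  by (rule C1_onI[where f' = "\<lambda>x. 0"]) (auto simp: zero_blinfun.rep_eq)

lemma C1_on_bounded_linear:
  assumes "bounded_linear T" and "C1_on f S"
  shows "C1_on (\<lambda>x. T (f x)) S"
proof -
  obtain f' where f': "\<And>x. x \<in> S \<Longrightarrow> (f has_derivative blinfun_apply (f' x)) (at x)"
    and cont: "continuous_on S f'"
    using assms(2) by (rule C1_onE) blast
  show ?thesis
  proof (rule C1_onI[where f' = "\<lambda>x. Blinfun T o\<^sub>L f' x"])
    fix x assume "x \<in> S"
    then show "((\<lambda>x. T (f x)) has_derivative blinfun_apply (Blinfun T o\<^sub>L f' x)) (at x)"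
      using bounded_linear.has_derivative[OF assms(1) f', of x]
      by (simp add: bounded_linear_Blinfun_apply[OF assms(1)] blinfun_compose.rep_eq o_def)
  qed (intro continuous_intros cont)
qed

lemma C1_on_ident: "C1_on (\<lambda>x. x) S"
  by (rule C1_onI[where f' = "\<lambda>x. id_blinfun"]) auto

lemma C1_on_linear: "bounded_linear T \<Longrightarrow> C1_on T S"
  using C1_on_bounded_linear[OF _ C1_on_ident] .

lemma C1_on_add:
  assumes "C1_on f S" and "C1_on g S"
  shows "C1_on (\<lambda>x. f x + g x) S"
proof -
  obtain f' g' where "\<And>x. x \<in> S \<Longrightarrow> (f has_derivative blinfun_apply (f' x)) (at x)"
    "\<And>x. x \<in> S \<Longrightarrow> (g has_derivative blinfun_apply (g' x)) (at x)"
    and "continuous_on S f'" "continuous_on S g'"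
    using assms by (metis C1_onE)
  then show ?thesis
    by (intro C1_onI[where f' = "\<lambda>x. f' x + g' x"])
      (auto intro!: continuous_intros derivative_eq_intros simp: blinfun.add_left)
qed

lemma C1_on_bilinear:
  assumes "bounded_bilinear B" and "C1_on f S" and "C1_on g S"
  shows "C1_on (\<lambda>x. B (f x) (g x)) S"
proof -
  interpret bounded_bilinear B by fact
  obtain f' g' where f': "\<And>x. x \<in> S \<Longrightarrow> (f has_derivative blinfun_apply (f' x)) (at x)"
    and g': "\<And>x. x \<in> S \<Longrightarrow> (g has_derivative blinfun_apply (g' x)) (at x)"
    and cont': "continuous_on S f'" "continuous_on S g'"
    using assms by (metis C1_onE)
  define D where "D = (\<lambda>x. (prod_right (f x) o\<^sub>L g' x) + (prod_left (g x) o\<^sub>L f' x))"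
  have D: "blinfun_apply (D x) = (\<lambda>h. B (f x) (g' x h) + B (f' x h) (g x))" for x
    by (rule ext) (simp add: D_def blinfun.add_left prod_right.rep_eq prod_left.rep_eq)
  show ?thesis
  proof (rule C1_onI)
    fix x assume "x \<in> S"
    then show "((\<lambda>x. B (f x) (g x)) has_derivative blinfun_apply (D x)) (at x)"
      unfolding D by (intro FDERIV f' g')
    next
    show "continuous_on S D"
      unfolding D_def
      by (intro continuous_intros cont'
          bounded_linear.continuous_on[OF bounded_linear_prod_right]
          bounded_linear.continuous_on[OF bounded_linear_prod_left]
          C1_on_imp_continuous_on assms)
  qed
qed

lemmas C1_on_scaleR = C1_on_bilinear[OF bounded_bilinear_scaleR]
lemmas C1_on_mult = C1_on_bilinear[OF bounded_bilinear_mult]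
lemmas C1_on_blinfun_apply = C1_on_bilinear[OF bounded_bilinear_blinfun_apply]

lemma C1_on_minus: "C1_on f S \<Longrightarrow> C1_on (\<lambda>x. - f x) S"
  using C1_on_bounded_linear[OF bounded_linear_minus[OF bounded_linear_ident]] .

lemma C1_on_diff: "C1_on f S \<Longrightarrow> C1_on g S \<Longrightarrow> C1_on (\<lambda>x. f x - g x) S"
  using C1_on_add[OF _ C1_on_minus, of f S g] by simp

lemma C1_on_sum: "(\<And>i. i \<in> I \<Longrightarrow> C1_on (f i) S) \<Longrightarrow> C1_on (\<lambda>x. \<Sum>i\<in>I. f i x) S"
  by (induction I rule: infinite_finite_induct) (auto intro: C1_on_const C1_on_add)

lemma C1_on_prod:
  fixes f :: "'i \<Rightarrow> 'a::real_normed_vector \<Rightarrow> real"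
  shows "(\<And>i. i \<in> I \<Longrightarrow> C1_on (f i) S) \<Longrightarrow> C1_on (\<lambda>x. \<Prod>i\<in>I. f i x) S"
  by (induction I rule: infinite_finite_induct) (auto intro: C1_on_const C1_on_mult)

lemma C1_on_compose:
  assumes "C1_on g T" and "C1_on f S" and "f ` S \<subseteq> T"
  shows "C1_on (\<lambda>x. g (f x)) S"
proof -
  obtain f' g' where f': "\<And>x. x \<in> S \<Longrightarrow> (f has_derivative blinfun_apply (f' x)) (at x)"
    and g': "\<And>x. x \<in> T \<Longrightarrow> (g has_derivative blinfun_apply (g' x)) (at x)"
    and cont': "continuous_on S f'" "continuous_on T g'"
    using assms by (metis C1_onE)
  show ?thesis
  proof (rule C1_onI[where f' = "\<lambda>x. g' (f x) o\<^sub>L f' x"])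
    fix x assume x: "x \<in> S"
    then show "((\<lambda>x. g (f x)) has_derivative blinfun_apply (g' (f x) o\<^sub>L f' x)) (at x)"
      using diff_chain_at[OF f'[OF x] g'[of "f x"]] assms(3)
      by (auto simp: o_def blinfun_compose.rep_eq)
  next
    have "continuous_on S (\<lambda>x. g' (f x))"
      using continuous_on_compose2[OF cont'(2) C1_on_imp_continuous_on[OF assms(2)]] assms(3) by blast
    then show "continuous_on S (\<lambda>x. g' (f x) o\<^sub>L f' x)"
      by (intro continuous_intros cont')
  qed
qed

lemma C1_on_real_line:
  fixes f :: "real \<Rightarrow> 'b::real_normed_vector"
  assumes "\<And>x. x \<in> S \<Longrightarrow> (f has_vector_derivative g x) (at x)" and "continuous_on S g"
  shows "C1_on f S"
proof (rule C1_onI)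
  show "(f has_derivative blinfun_apply (blinfun_scaleR_left (g x))) (at x)" if "x \<in> S" for x
    using assms(1)[OF that] by (simp add: has_vector_derivative_def)
  show "continuous_on S (\<lambda>x. blinfun_scaleR_left (g x))"
    by (intro bounded_linear.continuous_on[OF bounded_linear_blinfun_scaleR_left] assms(2))
qed

lemma C1_on_inverse:
  fixes f :: "'a::real_normed_vector \<Rightarrow> real"
  assumes "C1_on f S" and "\<And>x. x \<in> S \<Longrightarrow> f x \<noteq> 0"
  shows "C1_on (\<lambda>x. inverse (f x)) S"
proof (rule C1_on_compose[OF _ assms(1)])
  show "C1_on inverse (- {0::real})"
  proof (rule C1_on_real_line)
    fix x :: real assume "x \<in> - {0}"
    then show "(inverse has_vector_derivative - (inverse x * inverse x)) (at x)"
      using DERIV_inverse[of x UNIV]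
      by (simp add: has_real_derivative_iff_has_vector_derivative power2_eq_square)
  qed (auto intro!: continuous_intros)
qed (use assms(2) in auto)

lemma C1_on_divide:
  fixes f g :: "'a::real_normed_vector \<Rightarrow> real"
  assumes "C1_on f S" and "C1_on g S" and "\<And>x. x \<in> S \<Longrightarrow> g x \<noteq> 0"
  shows "C1_on (\<lambda>x. f x / g x) S"
  using C1_on_mult[OF assms(1) C1_on_inverse[OF assms(2,3)]] by (simp add: divide_inverse)

text \<open>The determinant is a polynomial in the entries. Through Cramer's rule this makes the
  coefficients of a change of basis differentiable.\<close>

lemma C1_on_det:
  fixes a :: "'a::real_normed_vector \<Rightarrow> real ^ 'n ^ 'n"
  assumes "\<And>i j. C1_on (\<lambda>x. a x $ i $ j) S"
  shows "C1_on (\<lambda>x. det (a x)) S"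
  unfolding det_def by (intro C1_on_sum C1_on_mult C1_on_prod C1_on_const assms)

lemma C2_on_imp_C1_on: "C2_on f S \<Longrightarrow> C1_on f S"
  unfolding C2_on_def using C1_on_imp_continuous_on C1_onI by blast

section \<open>Linear differential equations on an interval\<close>

text \<open>The terms \<open>T n\<close> of the Picard iteration for \<open>y' = P y\<close>, \<open>y a = v\<close>. The factorial
  comes from integrating the estimate for \<open>T n\<close>, and it is what makes their sum converge on the whole
  interval and not just for short times.\<close>

lemma picard_terms:
  fixes P :: "real \<Rightarrow> 'e::banach \<Rightarrow>\<^sub>L 'e" and v :: 'e and a b K :: real
  defines "T \<equiv> \<lambda>n::nat. rec_nat (\<lambda>s. v) (\<lambda>_ f s. integral {a..s} (\<lambda>r. P r (f r))) n"
  assumes P: "continuous_on {a..b} P" and K: "\<forall>s\<in>{a..b}. norm (P s) \<le> K" and "0 \<le> K"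
  shows "continuous_on {a..b} (T n)"
    and "\<And>s. s \<in> {a..b} \<Longrightarrow> norm (T n s) \<le> norm v * (K * (s - a)) ^ n / fact n"
    and "\<And>s. s \<in> {a..b} \<Longrightarrow> (T (Suc n) has_vector_derivative P s (T n s)) (at s within {a..b})"
    and "T (Suc n) a = 0"
proof -
  have T0: "T 0 = (\<lambda>s. v)" and TSuc: "T (Suc n) = (\<lambda>s. integral {a..s} (\<lambda>r. P r (T n r)))" for n
    by (simp_all add: T_def)
  have der: "(T (Suc n) has_vector_derivative P s (T n s)) (at s within {a..b})"
    if "continuous_on {a..b} (T n)" "s \<in> {a..b}" for n s
    unfolding TSuc using that
    by (intro integral_has_vector_derivative continuous_intros P) auto
  have contSuc: "continuous_on {a..b} (T (Suc n))" if "continuous_on {a..b} (T n)" for n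
    using der[OF that] by (meson continuous_on_eq_continuous_within has_vector_derivative_continuous)
  have cont: "continuous_on {a..b} (T n)" for n
    by (induction n) (auto simp: T0 intro: contSuc)
  have zero: "T (Suc n) a = 0" for n
    by (simp add: TSuc)
  have "\<forall>s\<in>{a..b}. norm (T n s) \<le> norm v * (K * (s - a)) ^ n / fact n" for n
  proof (induction n)
    case 0
    show ?case by (simp add: T0)
  next
    case (Suc n)
    show ?case
    proof
      fix s assume s: "s \<in> {a..b}"
      let ?\<phi> = "\<lambda>s. norm v * (K * (s - a)) ^ Suc n / fact (Suc n)"
      let ?\<phi>' = "\<lambda>s. norm v * K * (K * (s - a)) ^ n / fact n"
      show "norm (T (Suc n) s) \<le> ?\<phi> s"
      proof (cases "s = a")
        case True
        then show ?thesis by (simp add: zero)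
      next
        case False
        have "norm (T (Suc n) s - T (Suc n) a) \<le> ?\<phi> s - ?\<phi> a"
        proof (rule differentiable_bound_general)
          show "a < s" using False s by auto
          show "continuous_on {a..s} (T (Suc n))"
            using continuous_on_subset[OF cont] s by auto
          show "continuous_on {a..s} ?\<phi>"
            by (intro continuous_intros) auto
          fix x assume x: "a < x" "x < s"
          have "x \<in> {a..b}" "{a<..<s} \<subseteq> {a..b}" using x s by auto
          from has_vector_derivative_within_subset[OF der[OF cont this(1)] this(2)]
          have "(T (Suc n) has_vector_derivative P x (T n x)) (at x within {a<..<s})" .
          then show "(T (Suc n) has_vector_derivative P x (T n x)) (at x)"
            using at_within_open[of x "{a<..<s}"] x by simp
          have "(?\<phi> has_real_derivative
              norm v * (real (Suc n) * (K * (x - a)) ^ n * K) / fact (Suc n)) (at x)"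
            by (auto intro!: derivative_eq_intros simp del: fact_Suc power_Suc)
          moreover have "norm v * (real (Suc n) * (K * (x - a)) ^ n * K) / fact (Suc n) = ?\<phi>' x"
            by (simp add: divide_simps)
          ultimately show "(?\<phi> has_vector_derivative ?\<phi>' x) (at x)"
            by (simp only: has_real_derivative_iff_has_vector_derivative)
          have "norm (P x (T n x)) \<le> norm (P x) * norm (T n x)"
            by (rule norm_blinfun)
          also have "\<dots> \<le> K * (norm v * (K * (x - a)) ^ n / fact n)"
            using K Suc.IH x s \<open>0 \<le> K\<close> by (intro mult_mono) auto
          finally show "norm (P x (T n x)) \<le> ?\<phi>' x"
            by (simp add: mult_ac)
        qed
        then show ?thesis by (simp add: zero)
      qed
    qed
  qed
  then show "\<And>s. s \<in> {a..b} \<Longrightarrow> norm (T n s) \<le> norm v * (K * (s - a)) ^ n / fact n" by blast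
  show "continuous_on {a..b} (T n)" by (rule cont)
  show "\<And>s. s \<in> {a..b} \<Longrightarrow> (T (Suc n) has_vector_derivative P s (T n s)) (at s within {a..b})"
    by (rule der[OF cont])
  show "T (Suc n) a = 0" by (rule zero)
qed

text \<open>The series \<open>\<Sum>n. T n\<close> may be differentiated term by term because the derivative of
  \<open>T (Suc n)\<close> is \<open>P\<close> applied to \<open>T n\<close>: the differentiated series is \<open>P\<close> applied to the
  original one, which converges uniformly.\<close>

lemma linear_ode_solution:
  fixes P :: "real \<Rightarrow> 'e::banach \<Rightarrow>\<^sub>L 'e" and v :: 'e
  assumes "a \<le> b" and P: "continuous_on {a..b} P"
  obtains y where "y a = v"
    and "\<And>s. s \<in> {a..b} \<Longrightarrow> (y has_vector_derivative P s (y s)) (at s within {a..b})"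
proof -
  obtain K where K: "\<forall>s\<in>{a..b}. norm (P s) \<le> K"
    using compact_imp_bounded[OF compact_continuous_image[OF P compact_Icc]]
    by (force simp: bounded_iff)
  have "0 \<le> K" using bspec[OF K, of a] \<open>a \<le> b\<close> by (auto intro: order_trans[OF norm_ge_zero])
  define T where "T n = rec_nat (\<lambda>s. v) (\<lambda>_ f s. integral {a..s} (\<lambda>r. P r (f r))) n" for n :: nat
  note T = picard_terms[OF P K \<open>0 \<le> K\<close>, where v = v, folded T_def]
  define M where "M n = norm v * (K * (b - a)) ^ n / fact n" for n
  have M: "norm (T n s) \<le> M n" if "s \<in> {a..b}" for n s
  proof -
    have "(K * (s - a)) ^ n \<le> (K * (b - a)) ^ n"
      using that \<open>0 \<le> K\<close> by (intro power_mono mult_left_mono) auto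
    then show ?thesis
      using T(2)[OF that, of n] unfolding M_def
      by (meson divide_right_mono fact_ge_zero mult_left_mono norm_ge_zero order_trans)
  qed
  have sumM: "summable M"
    unfolding M_def using summable_mult[OF summable_exp[of "K * (b - a)"], of "norm v"]
    by (simp add: divide_inverse mult_ac)
  define y where "y s = (\<Sum>n. T n s)" for s
  have summ: "summable (\<lambda>n. T n s)" if "s \<in> {a..b}" for s
    using M[OF that] sumM by (blast intro: summable_comparison_test')
  let ?D = "\<lambda>n s. case n of 0 \<Rightarrow> 0 | Suc m \<Rightarrow> P s (T m s)"
  have lim: "uniform_limit {a..b} (\<lambda>n s. \<Sum>i<n. T i s) y sequentially"
    unfolding y_def using M sumM by (intro Weierstrass_m_test) auto
  have "\<exists>g. \<forall>s\<in>{a..b}. (\<lambda>n. T n s) sums g s \<and>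
      (g has_derivative (\<lambda>h. h *\<^sub>R P s (y s))) (at s within {a..b})"
  proof (rule has_derivative_series)
    show "convex {a..b}" by simp
    show "(T n has_derivative (\<lambda>h. h *\<^sub>R ?D n s)) (at s within {a..b})" if "s \<in> {a..b}" for n s
    proof (cases n)
      case 0
      then show ?thesis by (simp add: T_def)
    next
      case (Suc m)
      then show ?thesis using T(3)[OF that, of m] by (simp add: has_vector_derivative_def)
    qed
    fix e :: real assume "e > 0"
    then have "\<forall>\<^sub>F n in sequentially. \<forall>s\<in>{a..b}. dist (\<Sum>i<n. T i s) (y s) < e / (K + 1)"
      using uniform_limitD[OF lim, of "e / (K + 1)"] \<open>0 \<le> K\<close> by simp
    \<comment> \<open>The differentiated partial sum up to \<open>n\<close> is \<open>P\<close> applied to the partial sum up to \<open>n - 1\<close>.\<close>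
    then have "\<forall>\<^sub>F n in sequentially. \<forall>s\<in>{a..b}. dist (\<Sum>i<n - 1. T i s) (y s) < e / (K + 1)"
      by (rule eventually_compose_filterlim) (rule filterlim_minus_const_nat_at_top)
    then show "\<forall>\<^sub>F n in sequentially. \<forall>s\<in>{a..b}. \<forall>h.
        norm ((\<Sum>i<n. h *\<^sub>R ?D i s) - h *\<^sub>R P s (y s)) \<le> e * norm h"
      using eventually_gt_at_top[of 0]
    proof eventually_elim
      case (elim n)
      show ?case
      proof (intro ballI allI)
        fix s h assume s: "s \<in> {a..b}"
        obtain m where m: "n = Suc m" using elim(2) gr0_implies_Suc by blast
        have "(\<Sum>i<n. h *\<^sub>R ?D i s) - h *\<^sub>R P s (y s) = h *\<^sub>R P s ((\<Sum>i<m. T i s) - y s)"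
          unfolding m sum.lessThan_Suc_shift
          by (simp add: blinfun.diff_right blinfun.sum_right scaleR_diff_right scaleR_sum_right)
        also have "norm \<dots> \<le> \<bar>h\<bar> * (K * (e / (K + 1)))"
        proof -
          have "norm (P s ((\<Sum>i<m. T i s) - y s)) \<le> norm (P s) * norm ((\<Sum>i<m. T i s) - y s)"
            by (rule norm_blinfun)
          also have "\<dots> \<le> K * (e / (K + 1))"
            using elim(1) s bspec[OF K s] \<open>0 \<le> K\<close>
            by (intro mult_mono) (auto simp: m dist_norm intro: less_imp_le)
          finally show ?thesis unfolding norm_scaleR by (rule mult_left_mono) simp
        qed
        also have "\<dots> \<le> \<bar>h\<bar> * e"
          using \<open>0 \<le> K\<close> \<open>e > 0\<close> by (intro mult_left_mono) (auto simp: field_simps)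
        finally show "norm ((\<Sum>i<n. h *\<^sub>R ?D i s) - h *\<^sub>R P s (y s)) \<le> e * norm h"
          by (simp add: mult.commute)
      qed
    qed
  next
    show "a \<in> {a..b}" using \<open>a \<le> b\<close> by simp
    show "(\<lambda>n. T n a) sums y a" unfolding y_def using summ[of a] \<open>a \<le> b\<close> by (simp add: summable_sums)
  qed
  then obtain g where g: "\<And>s. s \<in> {a..b} \<Longrightarrow> (\<lambda>n. T n s) sums g s"
    and g': "\<And>s. s \<in> {a..b} \<Longrightarrow> (g has_derivative (\<lambda>h. h *\<^sub>R P s (y s))) (at s within {a..b})"
    by blast
  have gy: "g s = y s" if "s \<in> {a..b}" for s
    using g[OF that] by (simp add: y_def sums_iff)
  have "T n a = (if n = 0 then v else 0)" for n
    by (cases n) (auto simp: T(4), simp add: T_def)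
  then have "g a = v"
    using g[of a] \<open>a \<le> b\<close> sums_If_finite_set[of "{0::nat}" "\<lambda>_. v"] by (auto simp: sums_iff)
  moreover have "(g has_vector_derivative P s (g s)) (at s within {a..b})" if "s \<in> {a..b}" for s
    using g'[OF that] gy[OF that] by (simp add: has_vector_derivative_def)
  ultimately show thesis by (rule that)
qed

lemma bounded_bilinear_matrix_mult:
  "bounded_bilinear ((**) :: real ^ 'm ^ 'n \<Rightarrow> real ^ 'k ^ 'm \<Rightarrow> real ^ 'k ^ 'n)"
  unfolding bilinear_conv_bounded_bilinear[symmetric] bilinear_def
  by (auto intro!: linearI simp: vec_eq_iff matrix_matrix_mult_def algebra_simps sum.distrib
      sum_distrib_left)

text \<open>The product rule cancels the contributions of \<open>P\<close>. This one observation gives both the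
  invertibility of fundamental solutions and the uniqueness of solutions.\<close>

lemma adjoint_product_constant:
  fixes P Y Z :: "real \<Rightarrow> real ^ 'n ^ 'n"
  assumes "\<And>s. s \<in> {a..b} \<Longrightarrow> (Y has_vector_derivative P s ** Y s) (at s within {a..b})"
    and "\<And>s. s \<in> {a..b} \<Longrightarrow> (Z has_vector_derivative - (Z s ** P s)) (at s within {a..b})"
    and "s \<in> {a..b}" and "t \<in> {a..b}"
  shows "Z s ** Y s = Z t ** Y t"
proof -
  interpret mm: bounded_bilinear "(**) :: real ^ 'n ^ 'n \<Rightarrow> real ^ 'n ^ 'n \<Rightarrow> real ^ 'n ^ 'n"
    by (rule bounded_bilinear_matrix_mult)
  have "((\<lambda>s. Z s ** Y s) has_derivative (\<lambda>h. 0)) (at s within {a..b})" if s: "s \<in> {a..b}" for s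
    using mm.has_vector_derivative[OF assms(2)[OF s] assms(1)[OF s]]
    by (simp add: has_vector_derivative_def matrix_mul_assoc mm.minus_left)
  then have "\<exists>c. \<forall>x\<in>{a..b}. Z x ** Y x = c"
    by (intro has_derivative_zero_constant) auto
  then show ?thesis using assms(3,4) by metis
qed

lemma matrix_ode_solution:
  fixes P :: "real \<Rightarrow> real ^ 'n ^ 'n"
  assumes "a \<le> b" and P: "continuous_on {a..b} P"
  shows "\<exists>Y Z :: real \<Rightarrow> real ^ 'n ^ 'n. \<forall>s\<in>{a..b}.
    (Y has_vector_derivative P s ** Y s) (at s within {a..b}) \<and>
    (Z has_vector_derivative - (Z s ** P s)) (at s within {a..b}) \<and> Z s ** Y s = mat 1"
proof -
  interpret mm: bounded_bilinear "(**) :: real ^ 'n ^ 'n \<Rightarrow> real ^ 'n ^ 'n \<Rightarrow> real ^ 'n ^ 'n"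
    by (rule bounded_bilinear_matrix_mult)
  have "continuous_on {a..b} (\<lambda>s. mm.prod_right (P s))"
    by (intro bounded_linear.continuous_on[OF mm.bounded_linear_prod_right] P)
  from linear_ode_solution[OF \<open>a \<le> b\<close> this, of "mat 1"]
  obtain Y where Y: "Y a = mat 1"
    "\<And>s. s \<in> {a..b} \<Longrightarrow> (Y has_vector_derivative P s ** Y s) (at s within {a..b})"
    by (auto simp: mm.prod_right.rep_eq)
  have "continuous_on {a..b} (\<lambda>s. mm.prod_left (- P s))"
    by (intro bounded_linear.continuous_on[OF mm.bounded_linear_prod_left] P continuous_intros)
  from linear_ode_solution[OF \<open>a \<le> b\<close> this, of "mat 1"]
  obtain Z where Z: "Z a = mat 1"
    "\<And>s. s \<in> {a..b} \<Longrightarrow> (Z has_vector_derivative - (Z s ** P s)) (at s within {a..b})"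
    by (auto simp: mm.prod_left.rep_eq mm.minus_right)
  have "Z s ** Y s = mat 1" if "s \<in> {a..b}" for s
    using adjoint_product_constant[OF Y(2) Z(2) that, of a] \<open>a \<le> b\<close> Y(1) Z(1)
    by (simp add: matrix_mul_lid)
  with Y(2) Z(2) show ?thesis by blast
qed

text \<open>At an endpoint of \<open>J\<close> a neighbourhood in \<open>J\<close> is one-sided, so \<open>s\<close> need not be interior
  to \<open>{a..b}\<close>; the open set \<open>U\<close> records that \<open>{a..b}\<close> is nevertheless a neighbourhood.\<close>

lemma interval_compact_nbhd:
  fixes J :: "real set"
  assumes "is_interval J" and "s \<in> J" and "0 < e"
  obtains a b U where "s \<in> {a..b}" and "{a..b} \<subseteq> J" and "{a..b} \<subseteq> cball s e"
    and "open U" and "s \<in> U" and "J \<inter> U \<subseteq> {a..b}"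
    and "(\<exists>p\<in>J. \<exists>q\<in>J. p < q) \<Longrightarrow> a < b"
proof -
  have "\<exists>a\<in>J. a \<le> s \<and> s - e \<le> a \<and> (a < s \<or> (\<forall>y\<in>J. s \<le> y))"
  proof (cases "\<exists>p\<in>J. p < s")
    case True
    then obtain p where "p \<in> J" "p < s" by blast
    then have "max p (s - e) \<in> J"
      using assms mem_is_interval_1_I[of J p s "max p (s - e)"] by auto
    then show ?thesis using \<open>p < s\<close> \<open>0 < e\<close> by (intro bexI[of _ "max p (s - e)"]) auto
  next
    case False
    then show ?thesis using assms by (intro bexI[of _ s]) (auto simp: not_less)
  qed
  then obtain a where a: "a \<in> J" "a \<le> s" "s - e \<le> a" "a < s \<or> (\<forall>y\<in>J. s \<le> y)" by blast
  have "\<exists>b\<in>J. s \<le> b \<and> b \<le> s + e \<and> (s < b \<or> (\<forall>y\<in>J. y \<le> s))"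
  proof (cases "\<exists>p\<in>J. s < p")
    case True
    then obtain p where "p \<in> J" "s < p" by blast
    then have "min p (s + e) \<in> J"
      using assms mem_is_interval_1_I[of J s p "min p (s + e)"] by auto
    then show ?thesis using \<open>s < p\<close> \<open>0 < e\<close> by (intro bexI[of _ "min p (s + e)"]) auto
  next
    case False
    then show ?thesis using assms by (intro bexI[of _ s]) (auto simp: not_less)
  qed
  then obtain b where b: "b \<in> J" "s \<le> b" "b \<le> s + e" "s < b \<or> (\<forall>y\<in>J. y \<le> s)" by blast
  let ?U = "{(if a < s then a else s - 1)<..<(if s < b then b else s + 1)}"
  show thesis
  proof (rule that)
    show "{a..b} \<subseteq> J" using a b assms(1) by (auto intro: mem_is_interval_1_I[of J a b])
    show "open ?U" by simp
    show "J \<inter> ?U \<subseteq> {a..b}" using a b by force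
    show "a < b" if "\<exists>p\<in>J. \<exists>q\<in>J. p < q" using a b that by force
  qed (use a b in \<open>auto simp: dist_real_def\<close>)
qed

text \<open>The interval \<open>J\<close> may be open or half-open with coefficients unbounded towards its ends. So
  the solutions with value \<open>mat 1\<close> at \<open>\<sigma>\<close> are taken on all compact subintervals around
  \<open>\<sigma>\<close>; they agree where they overlap, and together they define a solution on \<open>J\<close>.\<close>

lemma matrix_ode_on_interval:
  fixes P :: "real \<Rightarrow> real ^ 'n ^ 'n"
  assumes J: "is_interval J" and P: "continuous_on J P" and s0: "\<sigma> \<in> J"
  shows "\<exists>Y :: real \<Rightarrow> real ^ 'n ^ 'n. \<forall>s\<in>J.
    (Y has_vector_derivative P s ** Y s) (at s within J) \<and> invertible (Y s)"
proof -
  interpret mm: bounded_bilinear "(**) :: real ^ 'n ^ 'n \<Rightarrow> real ^ 'n ^ 'n \<Rightarrow> real ^ 'n ^ 'n"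
    by (rule bounded_bilinear_matrix_mult)
  define sol where "sol a b Y \<longleftrightarrow> a \<in> J \<and> b \<in> J \<and> a \<le> \<sigma> \<and> \<sigma> \<le> b \<and> Y \<sigma> = mat 1 \<and>
    (\<forall>s\<in>{a..b}. (Y has_vector_derivative P s ** Y s) (at s within {a..b}) \<and> invertible (Y s))"
    for a b and Y :: "real \<Rightarrow> real ^ 'n ^ 'n"
  have sub: "{a..b} \<subseteq> J" if "a \<in> J" "b \<in> J" for a b
    using that J by (auto intro: mem_is_interval_1_I[of J a b])
  have ex: "\<exists>Y. sol a b Y" if ab: "a \<in> J" "b \<in> J" "a \<le> \<sigma>" "\<sigma> \<le> b" for a b
  proof -
    have "continuous_on {a..b} P" using continuous_on_subset[OF P sub] ab by blast
    from matrix_ode_solution[OF order_trans[OF ab(3,4)] this]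
    obtain Y Z :: "real \<Rightarrow> real ^ 'n ^ 'n" where
      Y: "\<And>s. s \<in> {a..b} \<Longrightarrow> (Y has_vector_derivative P s ** Y s) (at s within {a..b})"
      and ZY: "\<And>s. s \<in> {a..b} \<Longrightarrow> Z s ** Y s = mat 1"
      by blast
    have YZ: "Y s ** Z s = mat 1" if "s \<in> {a..b}" for s
      using ZY[OF that] matrix_left_right_inverse by blast
    have "((\<lambda>s. Y s ** Z \<sigma>) has_vector_derivative P s ** (Y s ** Z \<sigma>)) (at s within {a..b})"
      if "s \<in> {a..b}" for s
      using bounded_linear.has_vector_derivative[OF mm.bounded_linear_left Y[OF that]]
      by (simp add: matrix_mul_assoc)
    moreover have "invertible (Y s ** Z \<sigma>)" if "s \<in> {a..b}" for s
      using ZY YZ that ab by (intro invertible_mult) (auto simp: invertible_def)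
    ultimately have "sol a b (\<lambda>s. Y s ** Z \<sigma>)"
      using YZ[of \<sigma>] ab unfolding sol_def by auto
    then show ?thesis by blast
  qed
  have uniq: "Y s = Y' s" if "sol a b Y" "sol a' b' Y'" "s \<in> {a..b}" "s \<in> {a'..b'}" for a b a' b' Y Y' s
  proof -
    let ?I = "{max a a'..min b b'}"
    have I: "s \<in> ?I" "\<sigma> \<in> ?I" "?I \<subseteq> {a..b}" "?I \<subseteq> {a'..b'}" using that by (auto simp: sol_def)
    have Y: "\<And>s. s \<in> ?I \<Longrightarrow> (Y has_vector_derivative P s ** Y s) (at s within ?I)"
      and Y': "\<And>s. s \<in> ?I \<Longrightarrow> (Y' has_vector_derivative P s ** Y' s) (at s within ?I)"
      using that(1,2) I(3,4) unfolding sol_def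
      by (meson has_vector_derivative_within_subset subsetD)+
    have "{a..b} \<subseteq> J" using that(1) sub unfolding sol_def by blast
    then have contP: "continuous_on ?I P"
      using continuous_on_subset[OF P] I(3) by blast
    have le: "max a a' \<le> min b b'" using I(1) by simp
    obtain W Z :: "real \<Rightarrow> real ^ 'n ^ 'n" where
      Z: "\<And>s. s \<in> ?I \<Longrightarrow> (Z has_vector_derivative - (Z s ** P s)) (at s within ?I)"
      and ZW: "\<And>s. s \<in> ?I \<Longrightarrow> Z s ** W s = mat 1"
      using matrix_ode_solution[OF le contP] by blast
    have "Z s ** Y s = Z s ** Y' s"
      using adjoint_product_constant[OF Y Z I(1,2)] adjoint_product_constant[OF Y' Z I(1,2)] that(1,2)
      by (simp add: sol_def)
    then have "(W s ** Z s) ** Y s = (W s ** Z s) ** Y' s"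
      by (simp add: matrix_mul_assoc[symmetric])
    moreover have "W s ** Z s = mat 1"
      using ZW[OF I(1)] matrix_left_right_inverse by blast
    ultimately show ?thesis by (simp add: matrix_mul_lid)
  qed
  define Y where "Y s = (SOME y. \<exists>a b W. sol a b W \<and> s \<in> {a..b} \<and> y = W s)" for s
  have Y: "Y s = W s" if "sol a b W" "s \<in> {a..b}" for s a b W
  proof -
    have "\<exists>a b W. sol a b W \<and> s \<in> {a..b} \<and> Y s = W s"
      unfolding Y_def by (rule someI_ex) (use that in blast)
    then obtain a' b' W' where "sol a' b' W'" "s \<in> {a'..b'}" "Y s = W' s" by blast
    then show ?thesis using uniq[OF _ that(1) _ that(2)] by metis
  qed
  have "(Y has_vector_derivative P s ** Y s) (at s within J) \<and> invertible (Y s)" if s: "s \<in> J" for s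
  proof -
    obtain a b U where ab: "s \<in> {a..b}" "{a..b} \<subseteq> J" and U: "open U" "s \<in> U" "J \<inter> U \<subseteq> {a..b}"
      by (rule interval_compact_nbhd[OF J s zero_less_one]) blast
    let ?I = "{min a \<sigma>..max b \<sigma>}"
    have I: "min a \<sigma> \<in> J" "max b \<sigma> \<in> J" "s \<in> ?I"
      using ab s0 by (auto simp: min_def max_def)
    obtain W where W: "sol (min a \<sigma>) (max b \<sigma>) W" using ex I by fastforce
    have "at s within J = at s within ?I"
    proof (rule at_within_nhd[OF \<open>s \<in> U\<close> \<open>open U\<close>])
      have "{a..b} \<subseteq> ?I" by auto
      then show "J \<inter> U - {s} = ?I \<inter> U - {s}" using U(3) sub[OF I(1,2)] by blast
    qed
    moreover have "(Y has_vector_derivative P s ** Y s) (at s within ?I)"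
    proof (rule has_vector_derivative_transform[OF I(3)])
      show "Y r = W r" if "r \<in> ?I" for r using Y[OF W that] .
      show "(W has_vector_derivative P s ** Y s) (at s within ?I)"
        unfolding Y[OF W I(3)] using W I(3) unfolding sol_def by blast
    qed
    moreover have "invertible (Y s)" unfolding Y[OF W I(3)] using W I(3) unfolding sol_def by blast
    ultimately show ?thesis by simp
  qed
  then show ?thesis by blast
qed

section \<open>Maps with a prescribed 1-jet along a curve\<close>

lemma antiderivative_on_line:
  fixes g :: "real \<Rightarrow> 'b::banach"
  assumes g: "continuous_on UNIV g"
  obtains G where "\<And>x. (G has_vector_derivative g x) (at x)"
proof -
  define G where "G y = (if 0 \<le> y then integral {0..y} g else - integral {y..0} g)" for y :: real
  have int: "g integrable_on {u..v}" for u v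
    by (intro integrable_continuous_interval continuous_on_subset[OF g]) auto
  have "(G has_vector_derivative g x) (at x)" for x
  proof -
    \<comment> \<open>An interval with both 0 and \<open>x\<close> in its interior.\<close>
    let ?c = "- \<bar>x\<bar> - 1" and ?d = "\<bar>x\<bar> + 1"
    have G: "integral {?c..y} g - integral {?c..0} g = G y" if "y \<in> {?c<..<?d}" for y
    proof (cases "0 \<le> y")
      case True
      then show ?thesis
        using Henstock_Kurzweil_Integration.integral_combine[of ?c 0 y g, OF _ _ int]
        by (auto simp: G_def algebra_simps)
    next
      case False
      then show ?thesis
        using Henstock_Kurzweil_Integration.integral_combine[of ?c y 0 g, OF _ _ int] that
        by (auto simp: G_def algebra_simps)
    qed
    have "((\<lambda>y. integral {?c..y} g) has_vector_derivative g x) (at x within {?c..?d})"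
      by (intro integral_has_vector_derivative continuous_on_subset[OF g]) auto
    then have "((\<lambda>y. integral {?c..y} g - integral {?c..0} g) has_vector_derivative g x - 0)
        (at x within {?c<..<?d})"
      by (intro has_vector_derivative_diff has_vector_derivative_const)
        (auto elim: has_vector_derivative_within_subset)
    then have "((\<lambda>y. integral {?c..y} g - integral {?c..0} g) has_vector_derivative g x) (at x)"
      by (subst (asm) at_within_open) auto
    then show ?thesis
    proof (rule has_vector_derivative_transform_within_open)
      show "integral {?c..y} g - integral {?c..0} g = G y" if "y \<in> {?c<..<?d}" for y
        using G[OF that] .
    qed auto
  qed
  then show thesis by (rule that)
qed

abbreviation clamp_to :: "real \<Rightarrow> real \<Rightarrow> real \<Rightarrow> real" where
  "clamp_to a b x \<equiv> max a (min b x)"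

text \<open>Freezing the derivative at its end values and integrating extends a \<open>C\<^sup>1\<close> function from a
  compact interval to the line. It removes one-sided derivatives from the construction below.\<close>

lemma C1_extension_to_line:
  fixes F g :: "real \<Rightarrow> 'b::banach"
  assumes "a \<le> b" and g: "continuous_on {a..b} g"
    and F: "\<And>s. s \<in> {a..b} \<Longrightarrow> (F has_vector_derivative g s) (at s within {a..b})"
  shows "\<exists>H. (\<forall>x. (H has_vector_derivative g (clamp_to a b x)) (at x)) \<and>
    (\<forall>s\<in>{a..b}. H s = F s)"
proof -
  have "continuous_on UNIV (\<lambda>x. g (clamp_to a b x))"
    using \<open>a \<le> b\<close> by (intro continuous_on_compose2[OF g] continuous_intros) auto
  then obtain G where G: "\<And>x. (G has_vector_derivative g (clamp_to a b x)) (at x)"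
    using antiderivative_on_line by blast
  have "((\<lambda>s. F s - G s) has_derivative (\<lambda>h. 0)) (at s within {a..b})" if "s \<in> {a..b}" for s
    using has_vector_derivative_diff[OF F[OF that] has_vector_derivative_at_within[OF G]] that
    by (simp add: has_vector_derivative_def)
  then have "\<exists>k. \<forall>s\<in>{a..b}. F s - G s = k"
    by (intro has_derivative_zero_constant) auto
  then obtain k where k: "\<And>s. s \<in> {a..b} \<Longrightarrow> F s - G s = k" by blast
  show ?thesis
  proof (intro exI conjI allI ballI)
    show "((\<lambda>x. G x + k) has_vector_derivative g (clamp_to a b x)) (at x)" for x
      using has_vector_derivative_add[OF G has_vector_derivative_const] by simp
    show "G s + k = F s" if "s \<in> {a..b}" for s
      using k[OF that] by (simp add: algebra_simps)
  qed
qed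

text \<open>The lower bound on the derivative makes \<open>h\<close> onto and its inverse Lipschitz, so that the
  inverse is defined and differentiable on the whole line.\<close>

lemma C1_inverse_of_increasing:
  fixes h g :: "real \<Rightarrow> real"
  assumes h: "\<And>x. (h has_vector_derivative g x) (at x)" and g: "continuous_on UNIV g"
    and m: "\<And>x. m \<le> g x" and "0 < m"
  obtains \<tau> where "C1_on \<tau> UNIV" and "\<And>s. \<tau> (h s) = s"
proof -
  have h': "(h has_real_derivative g x) (at x)" for x
    using h by (simp add: has_real_derivative_iff_has_vector_derivative)
  have growth: "m * (y - x) \<le> h y - h x" if "x \<le> y" for x y
  proof -
    have "h x - m * x \<le> h y - m * y"
    proof (rule DERIV_nonneg_imp_nondecreasing[OF that])
      fix z
      have "((\<lambda>x. h x - m * x) has_real_derivative g z - m) (at z)"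
        by (auto intro!: derivative_eq_intros h')
      then show "\<exists>y. ((\<lambda>x. h x - m * x) has_real_derivative y) (at z) \<and> 0 \<le> y"
        using m[of z] by (intro exI[of _ "g z - m"]) simp
    qed
    then show ?thesis by (simp add: algebra_simps)
  qed
  have bound: "m * \<bar>y - x\<bar> \<le> \<bar>h y - h x\<bar>" for x y
    using growth[of x y] growth[of y x] by (cases "x \<le> y") (auto simp: abs_if)
  have inj: "inj h"
  proof (rule injI)
    fix x y assume "h x = h y"
    then show "x = y" using bound[of y x] \<open>0 < m\<close> by (simp add: mult_le_0_iff)
  qed
  have conth: "continuous_on UNIV h"
    using h' by (meson DERIV_isCont continuous_at_imp_continuous_on)
  have "\<exists>x. h x = y" for y
  proof -
    define N where "N = \<bar>y - h 0\<bar> / m"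
    have N: "m * N = \<bar>y - h 0\<bar>" "0 \<le> N" using \<open>0 < m\<close> by (auto simp: N_def)
    have "h (- N) \<le> y" "y \<le> h N"
      using growth[of "- N" 0] growth[of 0 N] N by (auto simp: abs_if split: if_splits)
    then show ?thesis
      using IVT'[of h "- N" y N] continuous_on_subset[OF conth] N by auto
  qed
  then have surj: "h (inv h y) = y" for y
    by (metis surjI surj_f_inv_f)
  have cont: "isCont (inv h) x" for x
  proof -
    have "dist (inv h y) (inv h z) \<le> (1 / m) * dist y z" for y z
      using bound[of "inv h y" "inv h z"] \<open>0 < m\<close>
      by (simp add: surj dist_real_def abs_minus_commute field_simps)
    then have "(1 / m)-lipschitz_on UNIV (inv h)"
      using \<open>0 < m\<close> by (intro lipschitz_onI) (auto)
    then have "continuous_on UNIV (inv h)" by (rule lipschitz_on_continuous_on)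
    then show ?thesis by (simp add: continuous_on_eq_continuous_at)
  qed
  show thesis
  proof (rule that)
    show "C1_on (inv h) UNIV"
    proof (rule C1_on_real_line)
      fix x
      show "(inv h has_vector_derivative inverse (g (inv h x))) (at x)"
        using DERIV_inverse_function[where f = h and g = "inv h" and x = x and a = "x - 1" and b = "x + 1",
            OF h' _ _ _ surj cont]
          m[of "inv h x"] \<open>0 < m\<close>
        by (simp add: has_real_derivative_iff_has_vector_derivative)
    next
      have "continuous_on UNIV (\<lambda>x. g (inv h x))"
        using cont by (intro continuous_on_compose2[OF g] continuous_at_imp_continuous_on) auto
      then show "continuous_on UNIV (\<lambda>x. inverse (g (inv h x)))"
        using m \<open>0 < m\<close> by (intro continuous_intros) (auto, smt (verit))
    qed
    show "inv h (h s) = s" for s using inj by simp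
  qed
qed

text \<open>A \<open>C\<^sup>1\<close> function \<open>t\<close> on the whole space that recovers the parameter along a short piece of
  the curve. The component of the curve in the direction of its tangent at \<open>\<sigma>\<close> has positive
  derivative near \<open>\<sigma>\<close>; it is extended to an increasing function on the line, and \<open>t\<close> is the
  inverse of that extension, composed with the inner product with the tangent. In particular the piece is injective.\<close>

lemma curve_time_function:
  fixes c d :: "real \<Rightarrow> 'a::euclidean_space"
  assumes K: "is_interval K" "\<exists>p\<in>K. \<exists>q\<in>K. p < q" and s0: "\<sigma> \<in> K"
    and d: "continuous_on K d"
    and c: "\<And>s. s \<in> K \<Longrightarrow> (c has_vector_derivative d s) (at s within K)"
    and "d \<sigma> \<noteq> 0"
  obtains a b U t where "a < b" "\<sigma> \<in> {a..b}" "{a..b} \<subseteq> K" "open U" "\<sigma> \<in> U" "K \<inter> U \<subseteq> {a..b}"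
    and "C1_on t UNIV" and "\<And>s. s \<in> {a..b} \<Longrightarrow> t (c s) = s"
proof -
  \<comment> \<open>Half the value at \<open>\<sigma>\<close>: a positive lower bound for the derivative nearby.\<close>
  define m where "m = d \<sigma> \<bullet> d \<sigma> / 2"
  have "0 < m" using \<open>d \<sigma> \<noteq> 0\<close> by (simp add: m_def)
  have "continuous_on K (\<lambda>s. d s \<bullet> d \<sigma>)" by (intro continuous_intros d)
  then obtain e where "0 < e" and e: "\<And>s. s \<in> K \<Longrightarrow> dist s \<sigma> < e \<Longrightarrow> dist (d s \<bullet> d \<sigma>) (d \<sigma> \<bullet> d \<sigma>) < m"
    using s0 \<open>0 < m\<close> unfolding continuous_on_iff by metis
  obtain a b U where ab: "\<sigma> \<in> {a..b}" "{a..b} \<subseteq> K" "{a..b} \<subseteq> cball \<sigma> (e / 2)" "a < b"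
    and U: "open U" "\<sigma> \<in> U" "K \<inter> U \<subseteq> {a..b}"
    by (rule interval_compact_nbhd[OF K(1) s0, of "e / 2"]) (use K(2) \<open>0 < e\<close> in auto)
  have pos: "m \<le> d s \<bullet> d \<sigma>" if "s \<in> {a..b}" for s
  proof -
    have "dist s \<sigma> < e" using that ab(3) \<open>0 < e\<close> by (auto simp: dist_commute)
    then have "\<bar>d s \<bullet> d \<sigma> - d \<sigma> \<bullet> d \<sigma>\<bar> < m"
      using e[of s] that ab(2) by (auto simp: dist_real_def)
    moreover have "d \<sigma> \<bullet> d \<sigma> = m + m" by (simp add: m_def)
    ultimately show ?thesis by linarith
  qed
  have "a \<le> b" using \<open>a < b\<close> by simp
  have cd: "continuous_on {a..b} (\<lambda>s. d s \<bullet> d \<sigma>)"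
    by (intro continuous_intros continuous_on_subset[OF d] ab)
  have cd': "((\<lambda>s. c s \<bullet> d \<sigma>) has_vector_derivative d s \<bullet> d \<sigma>) (at s within {a..b})"
    if "s \<in> {a..b}" for s
    using that ab(2)
    by (intro bounded_linear.has_vector_derivative[OF bounded_linear_inner_left]
        has_vector_derivative_within_subset[OF c]) auto
  from C1_extension_to_line[OF \<open>a \<le> b\<close> cd cd'] obtain h where
    h: "\<And>x. (h has_vector_derivative d (clamp_to a b x) \<bullet> d \<sigma>) (at x)"
    and hc: "\<And>s. s \<in> {a..b} \<Longrightarrow> h s = c s \<bullet> d \<sigma>"
    by blast
  have clamp: "clamp_to a b x \<in> {a..b}" for x using \<open>a < b\<close> by auto
  have "continuous_on UNIV (\<lambda>x. d (clamp_to a b x) \<bullet> d \<sigma>)"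
    using clamp ab(2) by (intro continuous_intros continuous_on_compose2[OF d]) blast
  then obtain \<tau> where \<tau>: "C1_on \<tau> UNIV" "\<And>s. \<tau> (h s) = s"
    by (rule C1_inverse_of_increasing[OF h _ pos[OF clamp] \<open>0 < m\<close>]) blast
  show thesis
  proof (rule that[OF \<open>a < b\<close> ab(1,2) U])
    show "C1_on (\<lambda>x. \<tau> (x \<bullet> d \<sigma>)) UNIV"
      by (intro C1_on_compose[OF \<tau>(1)] C1_on_linear bounded_linear_inner_left) auto
    show "\<tau> (c s \<bullet> d \<sigma>) = s" if "s \<in> {a..b}" for s
      using \<tau>(2)[of s] hc[OF that] by simp
  qed
qed

lemma has_derivative_vector_chain:
  assumes "(H has_vector_derivative w) (at (u x))" and "(u has_derivative u') (at x)"
  shows "((\<lambda>x. H (u x)) has_derivative (\<lambda>v. u' v *\<^sub>R w)) (at x)"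
  using diff_chain_at[OF assms(2) assms(1)[unfolded has_vector_derivative_def]]
  by (simp add: o_def)

text \<open>Let \<open>C\<close> and \<open>\<Phi>\<close> extend \<open>c\<close> and \<open>\<phi>\<close> to the line, and let \<open>G e\<close> be an antiderivative of
  \<open>L e\<close>. The map
  \<open>f x = \<Phi> (t x) + (\<Sum>e. G e (t x + (x - C (t x)) \<bullet> e) - G e (t x))\<close>
  involves \<open>L\<close> only through its antiderivatives, hence is \<open>C\<^sup>1\<close> although \<open>L\<close> is merely
  continuous. On the arc \<open>x = C (t x)\<close>, so the sum vanishes, and its derivative in the direction
  \<open>v\<close> is \<open>L\<close> applied to \<open>v - t' v c'\<close>, the part of \<open>v\<close> that \<open>\<Phi> \<circ> t\<close>, with derivative
  \<open>L (t' v c')\<close>, leaves over.\<close>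

lemma arc_jet_extension:
  fixes c d :: "real \<Rightarrow> 'a::euclidean_space" and L :: "real \<Rightarrow> 'a \<Rightarrow>\<^sub>L 'b::banach"
  assumes "a \<le> b" and t: "C1_on t UNIV" "\<And>s. s \<in> {a..b} \<Longrightarrow> t (c s) = s"
    and d: "continuous_on {a..b} d"
    and c: "\<And>s. s \<in> {a..b} \<Longrightarrow> (c has_vector_derivative d s) (at s within {a..b})"
    and L: "continuous_on {a..b} L"
    and \<phi>: "\<And>s. s \<in> {a..b} \<Longrightarrow> (\<phi> has_vector_derivative L s (d s)) (at s within {a..b})"
  shows "\<exists>f. C1_on f UNIV \<and>
    (\<forall>s\<in>{a..b}. f (c s) = \<phi> s \<and> (f has_derivative blinfun_apply (L s)) (at (c s)))"
proof -
  let ?k = "clamp_to a b"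
  have clamp: "?k x \<in> {a..b}" for x using \<open>a \<le> b\<close> by auto
  have contk: "continuous_on UNIV (\<lambda>x. g (?k x))" if "continuous_on {a..b} g" for g :: "real \<Rightarrow> 'z::topological_space"
    using clamp by (intro continuous_on_compose2[OF that] continuous_intros) auto
  have cont: "continuous_on {a..b} (\<lambda>s. L s (d s))" by (intro continuous_intros L d)
  obtain C where C: "\<And>x. (C has_vector_derivative d (?k x)) (at x)"
    and Cc: "\<And>s. s \<in> {a..b} \<Longrightarrow> C s = c s"
    using C1_extension_to_line[OF \<open>a \<le> b\<close> d c] by blast
  obtain \<Phi> where \<Phi>: "\<And>x. (\<Phi> has_vector_derivative L (?k x) (d (?k x))) (at x)"
    and \<Phi>\<phi>: "\<And>s. s \<in> {a..b} \<Longrightarrow> \<Phi> s = \<phi> s"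
    using C1_extension_to_line[OF \<open>a \<le> b\<close> cont \<phi>] by blast
  have contL: "continuous_on UNIV (\<lambda>x. L (?k x) e)" for e
    by (rule contk) (intro continuous_intros L)
  have "\<exists>G. \<forall>x. (G has_vector_derivative L (?k x) e) (at x)" for e
    by (rule antiderivative_on_line[OF contL]) blast
  then obtain G where G: "\<And>e x. (G e has_vector_derivative L (?k x) e) (at x)" by metis
  define f where "f x = \<Phi> (t x) +
    (\<Sum>e\<in>Basis. G e (t x + (x - C (t x)) \<bullet> e) - G e (t x))" for x
  show ?thesis
  proof (intro exI conjI ballI)
    have CC: "C1_on C UNIV" and C\<Phi>: "C1_on \<Phi> UNIV" and CG: "C1_on (G e) UNIV" for e
      by (rule C1_on_real_line[OF C contk[OF d]] C1_on_real_line[OF \<Phi> contk[OF cont]]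
          C1_on_real_line[OF G contL])+
    have Ct: "C1_on (\<lambda>x. C (t x)) UNIV"
      by (rule C1_on_compose[OF CC t(1)]) simp
    have Cu: "C1_on (\<lambda>x. t x + (x - C (t x)) \<bullet> e) UNIV" for e
      by (intro C1_on_add t C1_on_bounded_linear[OF bounded_linear_inner_left] C1_on_diff
          C1_on_ident Ct)
    show "C1_on f UNIV" unfolding f_def
      by (intro C1_on_add C1_on_sum C1_on_diff C1_on_compose[OF C\<Phi> t(1)]
          C1_on_compose[OF CG t(1)] C1_on_compose[OF CG Cu]) auto
  next
    fix s assume s: "s \<in> {a..b}"
    obtain t' where t': "(t has_derivative blinfun_apply t') (at (c s))"
      using t(1) by (rule C1_onE) blast
    have ts: "t (c s) = s" and ks: "?k s = s" and Cs: "C s = c s" using t(2) Cc s by auto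
    have C': "((\<lambda>x. C (t x)) has_derivative (\<lambda>v. t' v *\<^sub>R d s)) (at (c s))"
      using has_derivative_vector_chain[OF C t'] by (simp only: ts ks)
    have \<Phi>': "((\<lambda>x. \<Phi> (t x)) has_derivative (\<lambda>v. t' v *\<^sub>R L s (d s))) (at (c s))"
      using has_derivative_vector_chain[OF \<Phi> t'] by (simp only: ts ks)
    have G': "((\<lambda>x. G e (t x)) has_derivative (\<lambda>v. t' v *\<^sub>R L s e)) (at (c s))" for e
      using has_derivative_vector_chain[OF G t'] by (simp only: ts ks)
    have "((\<lambda>x. t x + (x - C (t x)) \<bullet> e) has_derivative (\<lambda>v. t' v + (v - t' v *\<^sub>R d s) \<bullet> e)) (at (c s))"
      for e by (auto intro!: derivative_eq_intros t' C')
    from has_derivative_vector_chain[OF G this]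
    have G'': "((\<lambda>x. G e (t x + (x - C (t x)) \<bullet> e)) has_derivative
        (\<lambda>v. (t' v + (v - t' v *\<^sub>R d s) \<bullet> e) *\<^sub>R L s e)) (at (c s))" for e
      by (simp add: ts ks Cs del: max_def min_def)
    have "(f has_derivative (\<lambda>v. t' v *\<^sub>R L s (d s) +
        (\<Sum>e\<in>Basis. (t' v + (v - t' v *\<^sub>R d s) \<bullet> e) *\<^sub>R L s e - t' v *\<^sub>R L s e))) (at (c s))"
      unfolding f_def by (intro has_derivative_add has_derivative_sum has_derivative_diff \<Phi>' G' G'')
    moreover have "t' v *\<^sub>R L s (d s) +
        (\<Sum>e\<in>Basis. (t' v + (v - t' v *\<^sub>R d s) \<bullet> e) *\<^sub>R L s e - t' v *\<^sub>R L s e) = L s v" for v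
    proof -
      have "(\<Sum>e\<in>Basis. (t' v + (v - t' v *\<^sub>R d s) \<bullet> e) *\<^sub>R L s e - t' v *\<^sub>R L s e) =
          L s (\<Sum>e\<in>Basis. ((v - t' v *\<^sub>R d s) \<bullet> e) *\<^sub>R e)"
        by (simp add: blinfun.sum_right blinfun.scaleR_right blinfun.diff_right algebra_simps)
      also have "\<dots> = L s (v - t' v *\<^sub>R d s)"
        by (simp only: euclidean_representation)
      finally show ?thesis by (simp add: blinfun.bilinear_simps)
    qed
    ultimately show "(f has_derivative blinfun_apply (L s)) (at (c s))" by simp
    show "f (c s) = \<phi> s"
      using s by (simp add: f_def ts Cs \<Phi>\<phi>)
  qed
qed

lemma C1_series:
  fixes \<psi> :: "nat \<Rightarrow> 'a::real_normed_vector \<Rightarrow> 'b::banach" and \<psi>' :: "nat \<Rightarrow> 'a \<Rightarrow> 'a \<Rightarrow>\<^sub>L 'b"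
  assumes der: "\<And>k x. (\<psi> k has_derivative blinfun_apply (\<psi>' k x)) (at x)"
    and cont: "\<And>k. continuous_on UNIV (\<psi>' k)"
    and M: "\<And>k x. norm (\<psi> k x) \<le> M k" "\<And>k x. norm (\<psi>' k x) \<le> M k" and "summable M"
  shows "(\<lambda>k. \<psi> k x) sums (\<Sum>k. \<psi> k x)" and "(\<lambda>k. \<psi>' k x) sums (\<Sum>k. \<psi>' k x)"
    and "((\<lambda>x. \<Sum>k. \<psi> k x) has_derivative blinfun_apply (\<Sum>k. \<psi>' k x)) (at x)"
    and "C1_on (\<lambda>x. \<Sum>k. \<psi> k x) UNIV"
proof -
  have sums: "(\<lambda>k. \<psi> k x) sums (\<Sum>k. \<psi> k x)" for x
    using M(1) by (auto intro!: summable_sums summable_comparison_test'[OF \<open>summable M\<close>, of 0])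
  show "(\<lambda>k. \<psi> k x) sums (\<Sum>k. \<psi> k x)" by (rule sums)
  show "(\<lambda>k. \<psi>' k x) sums (\<Sum>k. \<psi>' k x)"
    using M(2) by (auto intro!: summable_sums summable_comparison_test'[OF \<open>summable M\<close>, of 0])
  have lim: "uniform_limit UNIV (\<lambda>n x. \<Sum>k<n. \<psi>' k x) (\<lambda>x. \<Sum>k. \<psi>' k x) sequentially"
    using M(2) \<open>summable M\<close> by (intro Weierstrass_m_test) auto
  have "\<exists>g. \<forall>x\<in>UNIV. (\<lambda>k. \<psi> k x) sums g x \<and>
      (g has_derivative blinfun_apply (\<Sum>k. \<psi>' k x)) (at x within UNIV)"
  proof (rule has_derivative_series)
    fix e :: real assume "e > 0"
    show "\<forall>\<^sub>F n in sequentially. \<forall>x\<in>UNIV. \<forall>h.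
        norm ((\<Sum>k<n. \<psi>' k x h) - (\<Sum>k. \<psi>' k x) h) \<le> e * norm h"
      using uniform_limitD[OF lim \<open>e > 0\<close>]
    proof eventually_elim
      case (elim n)
      show ?case
      proof (intro ballI allI)
        fix x h
        have "norm ((\<Sum>k<n. \<psi>' k x h) - (\<Sum>k. \<psi>' k x) h) =
            norm (((\<Sum>k<n. \<psi>' k x) - (\<Sum>k. \<psi>' k x)) h)"
          by (simp add: blinfun.diff_left blinfun.sum_left)
        also have "\<dots> \<le> norm ((\<Sum>k<n. \<psi>' k x) - (\<Sum>k. \<psi>' k x)) * norm h"
          by (rule norm_blinfun)
        also have "\<dots> \<le> e * norm h"
          using elim by (intro mult_right_mono) (auto simp: dist_norm intro: less_imp_le)
        finally show "norm ((\<Sum>k<n. \<psi>' k x h) - (\<Sum>k. \<psi>' k x) h) \<le> e * norm h" .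
      qed
    qed
  qed (use der sums in auto)
  then obtain g where g: "\<And>x. (\<lambda>k. \<psi> k x) sums g x"
    and g': "\<And>x. (g has_derivative blinfun_apply (\<Sum>k. \<psi>' k x)) (at x)" by auto
  have "g = (\<lambda>x. \<Sum>k. \<psi> k x)" using g by (simp add: fun_eq_iff sums_iff)
  then have der': "((\<lambda>x. \<Sum>k. \<psi> k x) has_derivative blinfun_apply (\<Sum>k. \<psi>' k x)) (at x)" for x
    using g' by simp
  show "((\<lambda>x. \<Sum>k. \<psi> k x) has_derivative blinfun_apply (\<Sum>k. \<psi>' k x)) (at x)" by (rule der')
  show "C1_on (\<lambda>x. \<Sum>k. \<psi> k x) UNIV"
  proof (rule C1_onI[OF der'])
    have "\<forall>\<^sub>F n in sequentially. continuous_on UNIV (\<lambda>x. \<Sum>k<n. \<psi>' k x)"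
      by (intro always_eventually allI continuous_on_sum cont)
    then show "continuous_on UNIV (\<lambda>x. \<Sum>k. \<psi>' k x)"
      by (rule uniform_limit_theorem[OF _ lim]) simp
  qed
qed

lemma C1_on_positive_part_squared: "C1_on (\<lambda>u::real. (max 0 u)\<^sup>2) UNIV"
proof (rule C1_on_real_line)
  fix u :: real
  consider "u < 0" | "u = 0" | "u > 0" by linarith
  then show "((\<lambda>u. (max 0 u)\<^sup>2) has_vector_derivative 2 * max 0 u) (at u)"
  proof cases
    case 1
    have "((\<lambda>u::real. 0) has_vector_derivative 2 * max 0 u) (at u)"
      using 1 by (auto simp: max_def)
    then show ?thesis
      by (rule has_vector_derivative_transform_within_open[where S = "{..<0}"]) (use 1 in auto)
  next
    case 2
    have "((\<lambda>u::real. (max 0 u)\<^sup>2) has_derivative (\<lambda>h. 0)) (at 0)"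
    proof (rule has_derivativeI_sandwich[of 1 _ _ _ _ "\<lambda>y. \<bar>y\<bar>"])
      fix y :: real
      have "(max 0 y)\<^sup>2 \<le> \<bar>y\<bar> * \<bar>y\<bar>" by (auto simp: max_def power2_eq_square)
      then show "norm ((max 0 y)\<^sup>2 - (max 0 0)\<^sup>2 - 0) / norm (y - 0) \<le> \<bar>y\<bar>"
        by (auto simp: divide_simps)
    next
      have "((\<lambda>y. \<bar>y\<bar>) \<longlongrightarrow> \<bar>0::real\<bar>) (at 0)" by (intro tendsto_intros)
      then show "((\<lambda>y::real. \<bar>y\<bar>) \<longlongrightarrow> 0) (at 0)" by simp
    qed auto
    then show ?thesis using 2 by (simp add: has_vector_derivative_def)
  next
    case 3
    have "((\<lambda>u. u\<^sup>2) has_real_derivative 2 * max 0 u) (at u)"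
      using 3 by (auto intro!: derivative_eq_intros)
    then have "((\<lambda>u. u\<^sup>2) has_vector_derivative 2 * max 0 u) (at u)"
      by (simp add: has_real_derivative_iff_has_vector_derivative)
    then show ?thesis
      by (rule has_vector_derivative_transform_within_open[where S = "{0<..}"]) (use 3 in auto)
  qed
qed (intro continuous_intros)

text \<open>Squaring the positive part makes the function differentiable across the sphere.\<close>

definition bump :: "'a::euclidean_space \<Rightarrow> real \<Rightarrow> 'a \<Rightarrow> real" where
  "bump p r x = (max 0 (r\<^sup>2 - (x - p) \<bullet> (x - p)))\<^sup>2"

lemma bump_nonneg: "0 \<le> bump p r x"
  by (simp add: bump_def)

lemma bump_pos_iff:
  assumes "0 < r"
  shows "0 < bump p r x \<longleftrightarrow> x \<in> ball p r"
proof -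
  have "0 < bump p r x \<longleftrightarrow> (norm (x - p))\<^sup>2 < r\<^sup>2"
  proof -
    have "0 < (max 0 u)\<^sup>2 \<longleftrightarrow> 0 < u" for u :: real by (auto simp: max_def)
    then show ?thesis unfolding bump_def by (simp add: dot_square_norm)
  qed
  also have "\<dots> \<longleftrightarrow> norm (x - p) < r"
    using power_mono_iff[of r "norm (x - p)" 2] \<open>0 < r\<close> by (simp add: not_le[symmetric])
  finally show ?thesis by (simp add: dist_norm norm_minus_commute)
qed

lemma C1_on_bump: "C1_on (bump p r) UNIV"
proof -
  have "C1_on (\<lambda>x. r\<^sup>2 - (x - p) \<bullet> (x - p)) UNIV"
    by (intro C1_on_diff C1_on_const C1_on_bilinear[OF bounded_bilinear_inner] C1_on_ident)
  then show ?thesis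
    unfolding bump_def[abs_def] by (intro C1_on_compose[OF C1_on_positive_part_squared]) auto
qed

text \<open>The bounds from which the constants of the gluing are chosen. Outside \<open>S\<close> the derivative
  vanishes with the function because the complement of \<open>S\<close> is open.\<close>

lemma compactly_supported_C1_bounds:
  fixes \<psi> :: "'a::real_normed_vector \<Rightarrow> 'b::real_normed_vector"
  assumes "C1_on \<psi> UNIV" and "compact S" and "\<forall>x. x \<notin> S \<longrightarrow> \<psi> x = 0"
  shows "\<exists>\<psi>' M. (\<forall>x. (\<psi> has_derivative blinfun_apply (\<psi>' x)) (at x)) \<and> continuous_on UNIV \<psi>' \<and>
     (\<forall>x. norm (\<psi> x) \<le> M) \<and> (\<forall>x. norm (\<psi>' x) \<le> M) \<and> 0 \<le> M"
proof -
  have zero: "\<And>x. x \<notin> S \<Longrightarrow> \<psi> x = 0" using assms(3) by blast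
  obtain \<psi>' where der: "\<And>x. (\<psi> has_derivative blinfun_apply (\<psi>' x)) (at x)"
    and cont: "continuous_on UNIV \<psi>'"
    using assms(1) unfolding C1_on_def by blast
  have zero': "\<psi>' x = 0" if "x \<notin> S" for x
  proof -
    have "((\<lambda>x. 0) has_derivative blinfun_apply (\<psi>' x)) (at x)"
      by (rule has_derivative_transform_within_open[OF der, of "- S"])
        (use that zero compact_imp_closed[OF \<open>compact S\<close>] in auto)
    then have "blinfun_apply (\<psi>' x) = (\<lambda>h. 0)"
      by (rule has_derivative_unique) (rule has_derivative_const)
    then show ?thesis by (intro blinfun_eqI) simp
  qed
  obtain M1 where M1: "\<And>x. x \<in> S \<Longrightarrow> norm (\<psi> x) \<le> M1"
    using compact_imp_bounded[OF compact_continuous_image[OF _ \<open>compact S\<close>, of \<psi>]]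
      continuous_on_subset[OF C1_on_imp_continuous_on[OF assms(1)]]
    by (force simp: bounded_iff)
  obtain M2 where M2: "\<And>x. x \<in> S \<Longrightarrow> norm (\<psi>' x) \<le> M2"
    using compact_imp_bounded[OF compact_continuous_image[OF _ \<open>compact S\<close>, of \<psi>']]
      continuous_on_subset[OF cont]
    by (force simp: bounded_iff)
  have "norm (\<psi> x) \<le> \<bar>M1\<bar> + \<bar>M2\<bar> \<and> norm (\<psi>' x) \<le> \<bar>M1\<bar> + \<bar>M2\<bar>" for x
    using M1[of x] M2[of x] zero[of x] zero'[of x] by (cases "x \<in> S") auto
  then show ?thesis
    using der cont by (intro exI[of _ \<psi>'] exI[of _ "\<bar>M1\<bar> + \<bar>M2\<bar>"]) auto
qed

text \<open>If \<open>f\<^sub>k\<close> has the prescribed 1-jet at the points of \<open>C\<close> where the weight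
  \<open>\<beta>\<^sub>k\<close> does not vanish, then at all points of \<open>C\<close> so has
  \<open>(\<Sum>k. \<alpha>\<^sub>k \<beta>\<^sub>k f\<^sub>k) / (\<Sum>k. \<alpha>\<^sub>k \<beta>\<^sub>k)\<close>: the derivatives of the weights all multiply the same
  value and cancel in the quotient. Constants \<open>\<alpha>\<^sub>k\<close> that decrease fast enough make both series
  converge together with their derivatives, so the cover by balls only has to be countable, not locally
  finite.\<close>

lemma C1_jet_gluing:
  fixes C V :: "'a::euclidean_space set" and \<phi> :: "'a \<Rightarrow> 'b::banach" and L :: "'a \<Rightarrow> 'a \<Rightarrow>\<^sub>L 'b"
  assumes "open V" and "C \<subseteq> V"
    and loc: "\<And>x. x \<in> C \<Longrightarrow> \<exists>N f. open N \<and> x \<in> N \<and> C1_on f UNIV \<and>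
      (\<forall>y\<in>C \<inter> N. f y = \<phi> y \<and> (f has_derivative blinfun_apply (L y)) (at y))"
  obtains W f where "open W" "C \<subseteq> W" "W \<subseteq> V" "C1_on f W"
    and "\<And>y. y \<in> C \<Longrightarrow> f y = \<phi> y \<and> (f has_derivative blinfun_apply (L y)) (at y)"
proof (cases "C = {}")
  case True
  then show ?thesis using that[of "{}" "\<lambda>x. 0"] by (simp add: C1_on_const)
next
  case False
  have "\<exists>r f. 0 < r \<and> ball x r \<subseteq> V \<and> C1_on f UNIV \<and>
      (\<forall>y\<in>C \<inter> ball x r. f y = \<phi> y \<and> (f has_derivative blinfun_apply (L y)) (at y))"
    if x: "x \<in> C" for x
  proof -
    obtain N f where N: "open N" "x \<in> N" and f: "C1_on f UNIV"
      "\<And>y. y \<in> C \<inter> N \<Longrightarrow> f y = \<phi> y \<and> (f has_derivative blinfun_apply (L y)) (at y)"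
      using loc[OF x] by blast
    have "open (N \<inter> V)" "x \<in> N \<inter> V" using N x assms by auto
    then obtain r where "0 < r" "ball x r \<subseteq> N \<inter> V" unfolding open_contains_ball by blast
    with f show ?thesis by (intro exI[of _ r] exI[of _ f]) auto
  qed
  then obtain r F where r: "\<And>x. x \<in> C \<Longrightarrow> 0 < r x" "\<And>x. x \<in> C \<Longrightarrow> ball x (r x) \<subseteq> V"
    and F: "\<And>x. x \<in> C \<Longrightarrow> C1_on (F x) UNIV"
      "\<And>x y. x \<in> C \<Longrightarrow> y \<in> C \<inter> ball x (r x) \<Longrightarrow>
        F x y = \<phi> y \<and> (F x has_derivative blinfun_apply (L y)) (at y)"
    by metis
  obtain D where D: "D \<subseteq> C" "countable D" "(\<Union>x\<in>D. ball x (r x)) = (\<Union>x\<in>C. ball x (r x))"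
  proof -
    obtain \<F> where \<F>: "\<F> \<subseteq> (\<lambda>x. ball x (r x)) ` C" "countable \<F>" "\<Union>\<F> = (\<Union>x\<in>C. ball x (r x))"
      using Lindelof[of "(\<lambda>x. ball x (r x)) ` C"] by blast
    then obtain D where "D \<subseteq> C" "countable D" "\<F> = (\<lambda>x. ball x (r x)) ` D"
      by (meson countable_subset_image)
    then show thesis using that[of D] \<F>(3) by simp
  qed
  have "D \<noteq> {}" using D(3) False r(1) by force
  define p where "p = from_nat_into D"
  have p: "range p = D" using \<open>D \<noteq> {}\<close> \<open>countable D\<close> by (simp add: p_def)
  have pC: "p k \<in> C" for k using p D(1) by blast
  define \<beta> where "\<beta> k = bump (p k) (r (p k))" for k
  define \<psi> where "\<psi> k x = \<beta> k x *\<^sub>R F (p k) x" for k x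
  have \<beta>pos: "0 < \<beta> k x \<longleftrightarrow> x \<in> ball (p k) (r (p k))" and \<beta>nonneg: "0 \<le> \<beta> k x" for k x
    unfolding \<beta>_def by (auto simp: bump_pos_iff[OF r(1)[OF pC]] bump_nonneg)
  have \<beta>zero: "\<beta> k x = 0" if "x \<notin> ball (p k) (r (p k))" for k x
    using that \<beta>pos[of k x] \<beta>nonneg[of k x] by linarith
  have C\<beta>: "C1_on (\<beta> k) UNIV" for k unfolding \<beta>_def by (rule C1_on_bump)
  have C\<psi>: "C1_on (\<psi> k) UNIV" for k
    unfolding \<psi>_def[abs_def] by (intro C1_on_scaleR C\<beta> F pC)
  have out: "\<forall>x. x \<notin> cball (p k) (r (p k)) \<longrightarrow> \<beta> k x = 0"
    "\<forall>x. x \<notin> cball (p k) (r (p k)) \<longrightarrow> \<psi> k x = 0" for k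
    using \<beta>zero[of _ k] by (auto simp: \<psi>_def)
  obtain \<beta>' M1 where \<beta>': "\<And>k x. (\<beta> k has_derivative blinfun_apply (\<beta>' k x)) (at x)"
    "\<And>k. continuous_on UNIV (\<beta>' k)"
    and M1: "\<And>k x. norm (\<beta> k x) \<le> M1 k" "\<And>k x. norm (\<beta>' k x) \<le> M1 k" "\<And>k. 0 \<le> M1 k"
    using compactly_supported_C1_bounds[OF C\<beta> compact_cball out(1)] by metis
  obtain \<psi>' M2 where \<psi>': "\<And>k x. (\<psi> k has_derivative blinfun_apply (\<psi>' k x)) (at x)"
    "\<And>k. continuous_on UNIV (\<psi>' k)"
    and M2: "\<And>k x. norm (\<psi> k x) \<le> M2 k" "\<And>k x. norm (\<psi>' k x) \<le> M2 k" "\<And>k. 0 \<le> M2 k"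
    using compactly_supported_C1_bounds[OF C\<psi> compact_cball out(2)] by metis
  \<comment> \<open>The summand 1 keeps the denominator positive where both bounds are 0.\<close>
  define \<alpha> where "\<alpha> k = (1 / 2) ^ k / (1 + M1 k + M2 k)" for k
  have \<alpha>pos: "0 < \<alpha> k" for k
    using M1(3)[of k] M2(3)[of k] by (simp add: \<alpha>_def)
  have \<alpha>le: "\<alpha> k * x \<le> (1 / 2) ^ k" if "x \<le> M1 k \<or> x \<le> M2 k" for k x
  proof -
    have "\<alpha> k * x \<le> \<alpha> k * (1 + M1 k + M2 k)"
      using \<alpha>pos[of k] M1(3)[of k] M2(3)[of k] that by (intro mult_left_mono) auto
    also have "\<dots> = (1 / 2) ^ k"
      using M1(3)[of k] M2(3)[of k] by (simp add: \<alpha>_def)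
    finally show ?thesis .
  qed
  have half: "summable (\<lambda>k. (1 / 2 :: real) ^ k)" by (rule summable_geometric) simp
  define H where "H x = (\<Sum>k. \<alpha> k *\<^sub>R \<beta> k x)" for x
  define G where "G x = (\<Sum>k. \<alpha> k *\<^sub>R \<psi> k x)" for x
  define H' where "H' x = (\<Sum>k. \<alpha> k *\<^sub>R \<beta>' k x)" for x
  define G' where "G' x = (\<Sum>k. \<alpha> k *\<^sub>R \<psi>' k x)" for x
  have d\<beta>: "((\<lambda>x. \<alpha> k *\<^sub>R \<beta> k x) has_derivative blinfun_apply (\<alpha> k *\<^sub>R \<beta>' k x)) (at x)"
    and d\<psi>: "((\<lambda>x. \<alpha> k *\<^sub>R \<psi> k x) has_derivative blinfun_apply (\<alpha> k *\<^sub>R \<psi>' k x)) (at x)" for k x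
    using has_derivative_scaleR_right[OF \<beta>'(1)] has_derivative_scaleR_right[OF \<psi>'(1)]
    by (simp_all add: scaleR_blinfun.rep_eq)
  note H = C1_series[of "\<lambda>k x. \<alpha> k *\<^sub>R \<beta> k x" "\<lambda>k x. \<alpha> k *\<^sub>R \<beta>' k x" "\<lambda>k. (1 / 2) ^ k", folded H_def H'_def,
      OF d\<beta> continuous_on_scaleR[OF continuous_on_const \<beta>'(2)] _ _ half]
  note G = C1_series[of "\<lambda>k x. \<alpha> k *\<^sub>R \<psi> k x" "\<lambda>k x. \<alpha> k *\<^sub>R \<psi>' k x" "\<lambda>k. (1 / 2) ^ k", folded G_def G'_def,
      OF d\<psi> continuous_on_scaleR[OF continuous_on_const \<psi>'(2)] _ _ half]
  have bH: "norm (\<alpha> k *\<^sub>R \<beta> k x) \<le> (1 / 2) ^ k" "norm (\<alpha> k *\<^sub>R \<beta>' k x) \<le> (1 / 2) ^ k" for k x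
    using \<alpha>pos[of k] M1(1,2)[of k x] by (auto simp: abs_mult intro!: \<alpha>le)
  have bG: "norm (\<alpha> k *\<^sub>R \<psi> k x) \<le> (1 / 2) ^ k" "norm (\<alpha> k *\<^sub>R \<psi>' k x) \<le> (1 / 2) ^ k" for k x
    using \<alpha>pos[of k] M2(1,2)[of k x] by (auto simp: abs_mult intro!: \<alpha>le)
  define W where "W = (\<Union>k. ball (p k) (r (p k)))"
  have CW: "C \<subseteq> W"
  proof -
    have "W = (\<Union>x\<in>C. ball x (r x))" unfolding W_def D(3)[symmetric] p[symmetric] by simp
    then show ?thesis using r(1) by force
  qed
  have Hpos: "0 < H x" if x: "x \<in> W" for x
  proof -
    obtain k where "x \<in> ball (p k) (r (p k))" using x unfolding W_def by blast
    then have "0 < \<alpha> k *\<^sub>R \<beta> k x" using \<alpha>pos[of k] \<beta>pos[of k x] by simp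
    moreover have "summable (\<lambda>k. \<alpha> k *\<^sub>R \<beta> k x)" using H(1)[OF bH] by (simp add: sums_iff)
    ultimately show ?thesis
      unfolding H_def using \<alpha>pos \<beta>nonneg by (intro suminf_pos2[of _ k]) (auto simp: less_imp_le)
  qed
  let ?f = "\<lambda>x. inverse (H x) *\<^sub>R G x"
  show ?thesis
  proof (rule that)
    show "open W" unfolding W_def by auto
    show "C \<subseteq> W" by (rule CW)
    show "W \<subseteq> V" unfolding W_def using r(2) pC by blast
    show "C1_on ?f W"
      using Hpos C1_on_subset[OF H(4)[OF bH]] C1_on_subset[OF G(4)[OF bG]]
      by (intro C1_on_scaleR C1_on_inverse) force+
    fix y assume y: "y \<in> C"
    have H0: "H y \<noteq> 0" using Hpos[of y] CW y by auto
    have \<psi>y: "\<psi> k y = \<beta> k y *\<^sub>R \<phi> y" for k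
      using F(2)[OF pC, of y k] \<beta>zero[of y k] y unfolding \<psi>_def by (cases "y \<in> ball (p k) (r (p k))") auto
    define T where "T \<omega> = blinfun_scaleR_left (\<phi> y) o\<^sub>L \<omega>" for \<omega> :: "'a \<Rightarrow>\<^sub>L real"
    have T: "bounded_linear T" unfolding T_def[abs_def] 
      by (rule bounded_bilinear.bounded_linear_right[OF bounded_bilinear_blinfun_compose])
    have \<psi>'y: "\<psi>' k y = T (\<beta>' k y) + \<beta> k y *\<^sub>R L y" for k
    proof (cases "y \<in> ball (p k) (r (p k))")
      case True
      then have Fy: "F (p k) y = \<phi> y" and F': "(F (p k) has_derivative blinfun_apply (L y)) (at y)"
        using F(2)[OF pC, of y k] y by auto
      have "(\<psi> k has_derivative (\<lambda>v. \<beta> k y *\<^sub>R L y v + \<beta>' k y v *\<^sub>R F (p k) y)) (at y)"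
        unfolding \<psi>_def[abs_def] by (rule has_derivative_scaleR[OF \<beta>'(1) F'])
      from has_derivative_unique[OF \<psi>'(1) this]
      show ?thesis
        by (intro blinfun_eqI) (simp add: T_def Fy blinfun.add_left blinfun.scaleR_left)
    next
      case False
      \<comment> \<open>The weight is nonnegative, so it has a minimum where it vanishes.\<close>
      have "blinfun_apply (\<beta>' k y) = (\<lambda>h. 0)"
        by (rule has_derivative_local_min[OF \<beta>'(1)]) (simp add: \<beta>zero[OF False] \<beta>nonneg)
      then have \<beta>0: "\<beta>' k y = 0" by (intro blinfun_eqI) simp
      obtain B where "(F (p k) has_derivative blinfun_apply B) (at y)"
        using F(1)[OF pC] by (rule C1_onE) blast
      then have "(\<psi> k has_derivative (\<lambda>v. \<beta> k y *\<^sub>R B v + \<beta>' k y v *\<^sub>R F (p k) y)) (at y)"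
        unfolding \<psi>_def[abs_def] by (rule has_derivative_scaleR[OF \<beta>'(1)])
      from has_derivative_unique[OF \<psi>'(1) this]
      show ?thesis
        by (intro blinfun_eqI) (simp add: T_def \<beta>zero[OF False] \<beta>0)
    qed
    have "(\<lambda>k. \<alpha> k *\<^sub>R \<psi> k y) sums (H y *\<^sub>R \<phi> y)"
      using bounded_linear.sums[OF bounded_linear_scaleR_left[of "\<phi> y"] H(1)[OF bH], of y]
      by (simp add: \<psi>y mult.commute)
    then have Gy: "G y = H y *\<^sub>R \<phi> y" by (simp add: G_def sums_iff)
    have "(\<lambda>k. T (\<alpha> k *\<^sub>R \<beta>' k y) + (\<alpha> k *\<^sub>R \<beta> k y) *\<^sub>R L y) sums (T (H' y) + H y *\<^sub>R L y)"
      by (intro sums_add bounded_linear.sums[OF T] H(2)[OF bH]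
          bounded_linear.sums[OF bounded_linear_scaleR_left] H(1)[OF bH])
    then have "(\<lambda>k. \<alpha> k *\<^sub>R \<psi>' k y) sums (T (H' y) + H y *\<^sub>R L y)"
      by (simp add: \<psi>'y scaleR_add_right linear_simps(5)[OF T])
    then have G'y: "G' y = T (H' y) + H y *\<^sub>R L y" by (simp add: G'_def sums_iff)
    have dH: "((\<lambda>x. inverse (H x)) has_derivative (\<lambda>v. - (inverse (H y) * H' y v * inverse (H y)))) (at y)"
      by (rule Deriv.has_derivative_inverse[OF H0 H(3)[OF bH]])
    have "(?f has_derivative (\<lambda>v. inverse (H y) *\<^sub>R G' y v +
        (- (inverse (H y) * H' y v * inverse (H y))) *\<^sub>R G y)) (at y)"
      by (rule has_derivative_scaleR[OF dH G(3)[OF bG]])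
    moreover have "inverse (H y) *\<^sub>R G' y v + (- (inverse (H y) * H' y v * inverse (H y))) *\<^sub>R G y = L y v" for v
      using H0 by (simp add: G'y Gy T_def blinfun.add_left blinfun.scaleR_left scaleR_add_right)
    ultimately show "?f y = \<phi> y \<and> (?f has_derivative blinfun_apply (L y)) (at y)"
      using H0 by (simp add: Gy)
  qed
qed

text \<open>Injectivity and continuity of the inverse are used to pass from parameters to points: the part
  of the image near \<open>c \<sigma>\<close> comes from parameters near \<open>\<sigma>\<close> only, where the local solution has
  the right jet.\<close>

lemma embedded_curve_jet_extension:
  fixes c d :: "real \<Rightarrow> 'a::euclidean_space" and L :: "real \<Rightarrow> 'a \<Rightarrow>\<^sub>L 'b::banach"
  assumes K: "is_interval K" "\<exists>p\<in>K. \<exists>q\<in>K. p < q"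
    and hom: "homeomorphism K (c ` K) c g"
    and d: "continuous_on K d" "\<And>s. s \<in> K \<Longrightarrow> d s \<noteq> 0"
    and c: "\<And>s. s \<in> K \<Longrightarrow> (c has_vector_derivative d s) (at s within K)"
    and L: "continuous_on K L"
    and \<phi>: "\<And>s. s \<in> K \<Longrightarrow> (\<phi> has_vector_derivative L s (d s)) (at s within K)"
    and V: "open V" "c ` K \<subseteq> V"
  obtains W f where "open W" "c ` K \<subseteq> W" "W \<subseteq> V" "C1_on f W"
    and "\<And>s. s \<in> K \<Longrightarrow> f (c s) = \<phi> s \<and> (f has_derivative blinfun_apply (L s)) (at (c s))"
proof -
  have gc: "g (c s) = s" if "s \<in> K" for s
    using homeomorphism_apply1[OF hom that] .
  have "\<exists>N f. open N \<and> x \<in> N \<and> C1_on f UNIV \<and>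
      (\<forall>y\<in>c ` K \<inter> N. f y = \<phi> (g y) \<and> (f has_derivative blinfun_apply (L (g y))) (at y))"
    if x: "x \<in> c ` K" for x
  proof -
    obtain \<sigma> where \<sigma>: "\<sigma> \<in> K" "x = c \<sigma>" using x by blast
    obtain a b U t where ab: "a < b" "\<sigma> \<in> {a..b}" "{a..b} \<subseteq> K"
      and U: "open U" "\<sigma> \<in> U" "K \<inter> U \<subseteq> {a..b}"
      and t: "C1_on t UNIV" "\<And>s. s \<in> {a..b} \<Longrightarrow> t (c s) = s"
      by (rule curve_time_function[OF K \<sigma>(1) d(1) c d(2)[OF \<sigma>(1)]]) blast+
    have sub: "s \<in> K" if "s \<in> {a..b}" for s using ab(3) that by blast
    have "\<exists>f. C1_on f UNIV \<and>
        (\<forall>s\<in>{a..b}. f (c s) = \<phi> s \<and> (f has_derivative blinfun_apply (L s)) (at (c s)))"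
    proof (rule arc_jet_extension[OF less_imp_le[OF ab(1)] t])
      show "continuous_on {a..b} d" "continuous_on {a..b} L"
        using continuous_on_subset[OF d(1) ab(3)] continuous_on_subset[OF L ab(3)] .
      show "(c has_vector_derivative d s) (at s within {a..b})"
        "(\<phi> has_vector_derivative L s (d s)) (at s within {a..b})" if "s \<in> {a..b}" for s
        using has_vector_derivative_within_subset[OF c[OF sub[OF that]] ab(3)]
          has_vector_derivative_within_subset[OF \<phi>[OF sub[OF that]] ab(3)] .
    qed
    then obtain f where f: "C1_on f UNIV"
      "\<And>s. s \<in> {a..b} \<Longrightarrow> f (c s) = \<phi> s \<and> (f has_derivative blinfun_apply (L s)) (at (c s))"
      by blast
    have "openin (top_of_set (c ` K)) (c ` (K \<inter> U))"
      using homeomorphism_imp_open_map[OF hom] U(1) by (simp add: openin_open_Int)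
    then obtain N where N: "open N" "c ` (K \<inter> U) = c ` K \<inter> N"
      by (auto simp: openin_open)
    have "f y = \<phi> (g y) \<and> (f has_derivative blinfun_apply (L (g y))) (at y)" if y: "y \<in> c ` K \<inter> N" for y
    proof -
      obtain s where "s \<in> K \<inter> U" "y = c s" using y unfolding N(2)[symmetric] by blast
      then show ?thesis using f(2)[of s] U(3) gc[of s] by auto
    qed
    moreover have "x \<in> N" using N(2) \<sigma> U(2) by blast
    ultimately show ?thesis using N(1) f(1) by blast
  qed
  from C1_jet_gluing[OF V this] obtain W f where
    W: "open W" "c ` K \<subseteq> W" "W \<subseteq> V" "C1_on f W"
    and f: "\<And>y. y \<in> c ` K \<Longrightarrow> f y = \<phi> (g y) \<and> (f has_derivative blinfun_apply (L (g y))) (at y)"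
    by metis
  show thesis
  proof (rule that[OF W])
    show "f (c s) = \<phi> s \<and> (f has_derivative blinfun_apply (L s)) (at (c s))" if "s \<in> K" for s
      using f[of "c s"] gc[OF that] that by simp
  qed
qed

text \<open>The columns of \<open>Y\<close> are parallel along the curve, and \<open>- \<Gamma>\<^sub>k Y\<close> are the partial
  derivatives that make the covariant derivatives vanish in every direction. Compatibility of value and
  derivative is the differential equation for \<open>Y\<close>.\<close>

lemma parallel_frame_extension:
  fixes c d :: "real \<Rightarrow> real ^ 'n" and \<Gamma> :: "'n \<Rightarrow> real ^ 'n \<Rightarrow> real ^ 'n ^ 'n"
  assumes K: "is_interval K" "\<exists>p\<in>K. \<exists>q\<in>K. p < q"
    and hom: "homeomorphism K (c ` K) c g"
    and contd: "continuous_on K d"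
    and dc: "\<forall>s\<in>K. (c has_vector_derivative d s) (at s within K) \<and> d s \<noteq> 0"
    and V: "open V" "c ` K \<subseteq> V"
    and \<Gamma>: "\<And>k. continuous_on V (\<Gamma> k)"
  shows "\<exists>W A. open W \<and> c ` K \<subseteq> W \<and> W \<subseteq> V \<and> C1_on A W \<and> (\<forall>x\<in>W. det (A x) \<noteq> 0) \<and>
    (\<forall>s\<in>K. (A has_derivative (\<lambda>v. - (\<Sum>k\<in>UNIV. v $ k *\<^sub>R (\<Gamma> k (c s) ** A (c s))))) (at (c s)))"
proof -
  have d: "continuous_on K d" "\<And>s. s \<in> K \<Longrightarrow> d s \<noteq> 0"
    and c: "\<And>s. s \<in> K \<Longrightarrow> (c has_vector_derivative d s) (at s within K)"
    using contd dc by blast+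
  interpret mm: bounded_bilinear "(**) :: real ^ 'n ^ 'n \<Rightarrow> real ^ 'n ^ 'n \<Rightarrow> real ^ 'n ^ 'n"
    by (rule bounded_bilinear_matrix_mult)
  have contc: "continuous_on K c" using hom by (simp add: homeomorphism_def)
  have \<Gamma>c: "continuous_on K (\<lambda>s. \<Gamma> k (c s))" for k
    using V by (intro continuous_on_compose2[OF \<Gamma> contc]) auto
  define P where "P s = - (\<Sum>k\<in>UNIV. d s $ k *\<^sub>R \<Gamma> k (c s))" for s
  have contP: "continuous_on K P"
    unfolding P_def[abs_def] by (intro continuous_intros d \<Gamma>c)
  obtain \<sigma> where \<sigma>: "\<sigma> \<in> K" using K(2) by blast
  from matrix_ode_on_interval[OF K(1) contP \<sigma>] obtain Y :: "real \<Rightarrow> real ^ 'n ^ 'n"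
    where Y: "\<And>s. s \<in> K \<Longrightarrow> (Y has_vector_derivative P s ** Y s) (at s within K)"
    and inv: "\<And>s. s \<in> K \<Longrightarrow> invertible (Y s)"
    by blast
  have contY: "continuous_on K Y"
    using Y by (meson continuous_on_eq_continuous_within has_vector_derivative_continuous)
  define L where "L s = Blinfun (\<lambda>v. - (\<Sum>k\<in>UNIV. v $ k *\<^sub>R (\<Gamma> k (c s) ** Y s)))" for s
  have L: "blinfun_apply (L s) = (\<lambda>v. - (\<Sum>k\<in>UNIV. v $ k *\<^sub>R (\<Gamma> k (c s) ** Y s)))" for s
    unfolding L_def
    by (intro bounded_linear_Blinfun_apply bounded_linear_minus bounded_linear_sum
        bounded_linear_scaleR_const bounded_linear_vec_nth)
  have contL: "continuous_on K L"
    by (rule continuous_on_blinfun_componentwise)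
      (unfold L, intro continuous_intros mm.continuous_on \<Gamma>c contY)
  have "(Y has_vector_derivative L s (d s)) (at s within K)" if "s \<in> K" for s
    using Y[OF that] by (simp add: L P_def mm.minus_left mm.sum_left mm.scaleR_left)
  from embedded_curve_jet_extension[OF K hom d c contL this V]
  obtain W A where W: "open W" "c ` K \<subseteq> W" "W \<subseteq> V" and A: "C1_on A W"
    and jet: "\<And>s. s \<in> K \<Longrightarrow> A (c s) = Y s \<and> (A has_derivative blinfun_apply (L s)) (at (c s))"
    by blast
  have "C1_on (\<lambda>x. det (A x)) W"
    by (intro C1_on_det C1_on_bounded_linear[OF bounded_linear_compose[OF bounded_linear_vec_nth bounded_linear_vec_nth]] A)
  then have op: "open (W \<inter> (\<lambda>x. det (A x)) -` (- {0}))"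
    by (intro continuous_open_preimage C1_on_imp_continuous_on W) auto
  show ?thesis
  proof (intro exI conjI ballI)
    show "open (W \<inter> (\<lambda>x. det (A x)) -` (- {0}))" by (rule op)
    show "c ` K \<subseteq> W \<inter> (\<lambda>x. det (A x)) -` (- {0})"
      using W(2) jet inv by (auto simp: invertible_det_nz)
    show "C1_on A (W \<inter> (\<lambda>x. det (A x)) -` (- {0}))"
      by (rule C1_on_subset[OF A]) auto
    show "(A has_derivative (\<lambda>v. - (\<Sum>k\<in>UNIV. v $ k *\<^sub>R (\<Gamma> k (c s) ** A (c s))))) (at (c s))"
      if "s \<in> K" for s
      using jet[OF that] by (simp add: L)
  qed (use W in auto)
qed

section \<open>Tangent vectors, functions and fields in charts\<close>

lemma frame_coefficients_zero:
  fixes e :: "'n::finite \<Rightarrow> 'v::real_vector"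
  assumes "inj e" and "independent (range e)" and "(\<Sum>i\<in>UNIV. a i *\<^sub>R e i) = 0"
  shows "a i = 0"
proof -
  have "(\<Sum>v\<in>range e. a (inv e v) *\<^sub>R v) = 0"
    using assms by (simp add: sum.reindex)
  then have "a (inv e (e i)) = 0"
    using independentD[OF assms(2), of "range e" "\<lambda>v. a (inv e v)" "e i"] by simp
  then show ?thesis using assms(1) by simp
qed

lemma independent_frameI:
  fixes e :: "'n::finite \<Rightarrow> 'v::real_vector"
  assumes *: "\<And>a i. (\<Sum>i\<in>UNIV. a i *\<^sub>R e i) = 0 \<Longrightarrow> a i = 0"
  shows "inj e" and "independent (range e)"
proof -
  show inj: "inj e"
  proof (rule injI, rule ccontr)
    fix i j assume ij: "e i = e j" "i \<noteq> j"
    let ?a = "\<lambda>k. if k = i then 1 else if k = j then - 1 else 0"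
    have "(\<Sum>k\<in>UNIV. ?a k *\<^sub>R e k) = (\<Sum>k\<in>{i,j}. ?a k *\<^sub>R e k)"
      by (rule sum.mono_neutral_right) auto
    also have "\<dots> = 0" using ij by simp
    finally show False using *[of ?a i] by simp
  qed
  show "independent (range e)"
  proof (rule independent_if_scalars_zero)
    fix f v assume "(\<Sum>x\<in>range e. f x *\<^sub>R x) = 0" "v \<in> range e"
    then show "f v = 0"
      using *[of "\<lambda>i. f (e i)"] inj by (auto simp: sum.reindex)
  qed simp
qed

lemma span_range_frame:
  fixes e :: "'n::finite \<Rightarrow> 'v::real_vector"
  assumes "inj e"
  shows "span (range e) = {(\<Sum>i\<in>UNIV. a i *\<^sub>R e i) | a. True}"
proof -
  have "\<exists>a. (\<Sum>v\<in>range e. u v *\<^sub>R v) = (\<Sum>i\<in>UNIV. a i *\<^sub>R e i)" for u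
    using assms by (intro exI[of _ "\<lambda>i. u (e i)"]) (simp add: sum.reindex)
  moreover have "(\<Sum>i\<in>UNIV. a i *\<^sub>R e i) \<in> span (range e)" for a
    by (intro span_sum span_scale span_base) auto
  ultimately show ?thesis by (auto simp: span_finite)
qed

lemma comp_add: "comp (v + w) c = comp v c + comp w c"
  and comp_scaleR: "comp (r *\<^sub>R v) c = r *\<^sub>R comp v c"
  and comp_zero: "comp 0 c = 0"
  by (simp_all add: plus_tvec.rep_eq scaleR_tvec.rep_eq zero_tvec.rep_eq)

lemma comp_sum: "comp (\<Sum>i\<in>I. f i) c = (\<Sum>i\<in>I. comp (f i) c)"
  by (induction I rule: infinite_finite_induct) (auto simp: comp_add comp_zero)

text \<open>The inverse of taking components in the chart \<open>c\<close>: the components in all other charts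
  are forced by the transformation law.\<close>

definition chart_vector ::
    "('m, 'n::finite) chart set \<Rightarrow> ('m, 'n) chart \<Rightarrow> 'm \<Rightarrow> real ^ 'n \<Rightarrow> ('m, 'n) tvec" where
  "chart_vector \<A> c p w = Tvec (\<lambda>c'. if c' \<in> \<A> \<and> p \<in> fst c'
     then frechet_derivative (snd c' \<circ> inv_into (fst c) (snd c)) (at (snd c p)) w else 0)"

lemma comp_chart_vector:
  "comp (chart_vector \<A> (U, \<phi>) p w) (V, \<psi>) = (if (V, \<psi>) \<in> \<A> \<and> p \<in> V
     then frechet_derivative (\<psi> \<circ> inv_into U \<phi>) (at (\<phi> p)) w else 0)"
  by (simp add: chart_vector_def Tvec_inverse)

locale c2_manifold =
  fixes M :: "'m::t2_space set" and \<A> :: "('m, 'n::finite) chart set"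
  assumes manifold: "manifold M \<A>"
begin

lemma
  assumes "(U, \<phi>) \<in> \<A>"
  shows chart_open: "open U" and chart_image_open: "open (\<phi> ` U)"
    and chart_homeomorphism: "homeomorphism U (\<phi> ` U) \<phi> (inv_into U \<phi>)"
    and chart_subset: "U \<subseteq> M"
  using assms manifold unfolding manifold_def by auto

lemma chart_inv [simp]: "(U, \<phi>) \<in> \<A> \<Longrightarrow> p \<in> U \<Longrightarrow> inv_into U \<phi> (\<phi> p) = p"
  using chart_homeomorphism homeomorphism_apply1 by blast

lemma chart_at:
  assumes "p \<in> M" obtains U \<phi> where "(U, \<phi>) \<in> \<A>" "p \<in> U"
  using assms manifold unfolding manifold_def by blast

lemma chart_image_open': "(U, \<phi>) \<in> \<A> \<Longrightarrow> open N \<Longrightarrow> open (\<phi> ` (U \<inter> N))"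
  using homeomorphism_imp_open_map[OF chart_homeomorphism, of U \<phi> "U \<inter> N"] chart_image_open
  by (simp add: openin_open_eq openin_open_Int)

lemma transition_C2:
  assumes "(U, \<phi>) \<in> \<A>" "(V, \<psi>) \<in> \<A>"
  shows "C2_on (\<psi> \<circ> inv_into U \<phi>) (\<phi> ` (U \<inter> V))"
proof -
  have "\<forall>(U, \<phi>)\<in>\<A>. \<forall>(V, \<psi>)\<in>\<A>. C2_on (\<psi> \<circ> inv_into U \<phi>) (\<phi> ` (U \<inter> V))"
    using manifold unfolding manifold_def by blast
  from bspec[OF bspec[OF this assms(1), unfolded case_prod_conv] assms(2)] show ?thesis by simp
qed

lemma transition_C1:
  "(U, \<phi>) \<in> \<A> \<Longrightarrow> (V, \<psi>) \<in> \<A> \<Longrightarrow> C1_on (\<psi> \<circ> inv_into U \<phi>) (\<phi> ` (U \<inter> V))"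
  by (intro C2_on_imp_C1_on transition_C2)

lemma transition_derivative:
  assumes "(U, \<phi>) \<in> \<A>" "(V, \<psi>) \<in> \<A>" "p \<in> U" "p \<in> V"
  shows "((\<psi> \<circ> inv_into U \<phi>) has_derivative frechet_derivative (\<psi> \<circ> inv_into U \<phi>) (at (\<phi> p))) (at (\<phi> p))"
  using C1_on_differentiable[OF transition_C1[OF assms(1,2)]] assms(3,4)
  by (auto simp: frechet_derivative_works[symmetric])

lemma transition_derivative_linear:
  assumes "(U, \<phi>) \<in> \<A>" "(V, \<psi>) \<in> \<A>" "p \<in> U" "p \<in> V"
  shows "linear (frechet_derivative (\<psi> \<circ> inv_into U \<phi>) (at (\<phi> p)))"
  using transition_derivative[OF assms] by (rule has_derivative_linear)

lemma transition_derivative_self: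
  assumes "(U, \<phi>) \<in> \<A>" "p \<in> U"
  shows "frechet_derivative (\<phi> \<circ> inv_into U \<phi>) (at (\<phi> p)) w = w"
proof -
  have "((\<phi> \<circ> inv_into U \<phi>) has_derivative (\<lambda>h. h)) (at (\<phi> p))"
    by (rule has_derivative_transform_within_open[OF has_derivative_ident chart_image_open[OF assms(1)]])
      (use assms in \<open>auto simp: f_inv_into_f\<close>)
  from frechet_derivative_at[OF this] show ?thesis by metis
qed

text \<open>The chain rule, as it is used for the transformation law and for the independence of
  \<open>act\<close> from the chart.\<close>

lemma has_derivative_change_chart:
  assumes "(U, \<phi>) \<in> \<A>" "(V, \<psi>) \<in> \<A>" "p \<in> U" "p \<in> V"
    and "((f \<circ> inv_into V \<psi>) has_derivative F) (at (\<psi> p))"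
  shows "((f \<circ> inv_into U \<phi>) has_derivative
    (\<lambda>w. F (frechet_derivative (\<psi> \<circ> inv_into U \<phi>) (at (\<phi> p)) w))) (at (\<phi> p))"
proof -
  have "((f \<circ> inv_into V \<psi>) has_derivative F) (at ((\<psi> \<circ> inv_into U \<phi>) (\<phi> p)))"
    using assms by simp
  from diff_chain_at[OF transition_derivative[OF assms(1-4)] this]
  have "(((f \<circ> inv_into V \<psi>) \<circ> (\<psi> \<circ> inv_into U \<phi>)) has_derivative
      (\<lambda>w. F (frechet_derivative (\<psi> \<circ> inv_into U \<phi>) (at (\<phi> p)) w))) (at (\<phi> p))"
    by (simp add: o_def)
  then show ?thesis
    by (rule has_derivative_transform_within_open[OF _ chart_image_open'[OF assms(1) chart_open[OF assms(2)]]])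
      (use assms in auto)
qed

lemma transition_derivative_chain:
  assumes "(U, \<phi>) \<in> \<A>" "(V, \<psi>) \<in> \<A>" "(V', \<psi>') \<in> \<A>" "p \<in> U" "p \<in> V" "p \<in> V'"
  shows "frechet_derivative (\<psi>' \<circ> inv_into V \<psi>) (at (\<psi> p))
      (frechet_derivative (\<psi> \<circ> inv_into U \<phi>) (at (\<phi> p)) w) =
    frechet_derivative (\<psi>' \<circ> inv_into U \<phi>) (at (\<phi> p)) w"
  using frechet_derivative_at[OF has_derivative_change_chart[OF assms(1,2,4,5)
      transition_derivative[OF assms(2,3,5,6)]]] by (metis)

lemma tangent_space_iff:
  "v \<in> tangent_space \<A> p \<longleftrightarrow>
    (\<forall>U \<phi> V \<psi>. (U, \<phi>) \<in> \<A> \<longrightarrow> (V, \<psi>) \<in> \<A> \<longrightarrow> p \<in> U \<inter> V \<longrightarrow>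
      comp v (V, \<psi>) = frechet_derivative (\<psi> \<circ> inv_into U \<phi>) (at (\<phi> p)) (comp v (U, \<phi>))) \<and>
    (\<forall>U \<phi>. \<not> ((U, \<phi>) \<in> \<A> \<and> p \<in> U) \<longrightarrow> comp v (U, \<phi>) = 0)"
proof -
  have "(\<forall>(U, \<phi>)\<in>\<A>. \<forall>(V, \<psi>)\<in>\<A>. Q U \<phi> V \<psi>) \<longleftrightarrow>
      (\<forall>U \<phi> V \<psi>. (U, \<phi>) \<in> \<A> \<longrightarrow> (V, \<psi>) \<in> \<A> \<longrightarrow> Q U \<phi> V \<psi>)" for Q by auto
  then show ?thesis by (simp only: tangent_space_def mem_Collect_eq)
qed

lemma tangentI:
  assumes "\<And>U \<phi> V \<psi>. (U, \<phi>) \<in> \<A> \<Longrightarrow> (V, \<psi>) \<in> \<A> \<Longrightarrow> p \<in> U \<Longrightarrow> p \<in> V \<Longrightarrow>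
      comp v (V, \<psi>) = frechet_derivative (\<psi> \<circ> inv_into U \<phi>) (at (\<phi> p)) (comp v (U, \<phi>))"
    and "\<And>U \<phi>. \<not> ((U, \<phi>) \<in> \<A> \<and> p \<in> U) \<Longrightarrow> comp v (U, \<phi>) = 0"
  shows "v \<in> tangent_space \<A> p"
  unfolding tangent_space_iff
proof (intro conjI allI impI)
  fix U \<phi> V \<psi> assume "(U, \<phi>) \<in> \<A>" "(V, \<psi>) \<in> \<A>" "p \<in> U \<inter> V"
  then show "comp v (V, \<psi>) = frechet_derivative (\<psi> \<circ> inv_into U \<phi>) (at (\<phi> p)) (comp v (U, \<phi>))"
    by (intro assms(1)) auto
qed (rule assms(2))

lemma tangent_comp:
  assumes "v \<in> tangent_space \<A> p" "(U, \<phi>) \<in> \<A>" "(V, \<psi>) \<in> \<A>" "p \<in> U" "p \<in> V"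
  shows "comp v (V, \<psi>) = frechet_derivative (\<psi> \<circ> inv_into U \<phi>) (at (\<phi> p)) (comp v (U, \<phi>))"
  using assms(1)[unfolded tangent_space_iff, THEN conjunct1, rule_format, OF assms(2,3)] assms(4,5)
  by blast

lemma tangent_outside:
  "v \<in> tangent_space \<A> p \<Longrightarrow> \<not> ((U, \<phi>) \<in> \<A> \<and> p \<in> U) \<Longrightarrow> comp v (U, \<phi>) = 0"
  unfolding tangent_space_iff by blast

lemma chart_vector_tangent:
  assumes "(U, \<phi>) \<in> \<A>" "p \<in> U"
  shows "chart_vector \<A> (U, \<phi>) p w \<in> tangent_space \<A> p"
proof (rule tangentI)
  fix V \<psi> V' \<psi>' assume "(V, \<psi>) \<in> \<A>" "(V', \<psi>') \<in> \<A>" "p \<in> V" "p \<in> V'"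
  with transition_derivative_chain[OF assms(1) this(1,2) assms(2) this(3,4), of w]
  show "comp (chart_vector \<A> (U, \<phi>) p w) (V', \<psi>') = frechet_derivative (\<psi>' \<circ> inv_into V \<psi>)
      (at (\<psi> p)) (comp (chart_vector \<A> (U, \<phi>) p w) (V, \<psi>))"
    by (simp add: comp_chart_vector)
qed (auto simp: comp_chart_vector)

lemma comp_chart_vector_self:
  "(U, \<phi>) \<in> \<A> \<Longrightarrow> p \<in> U \<Longrightarrow> comp (chart_vector \<A> (U, \<phi>) p w) (U, \<phi>) = w"
  by (simp add: comp_chart_vector transition_derivative_self)

lemma chart_vector_comp:
  assumes "(U, \<phi>) \<in> \<A>" "p \<in> U" "v \<in> tangent_space \<A> p"
  shows "chart_vector \<A> (U, \<phi>) p (comp v (U, \<phi>)) = v"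
proof -
  have "comp (chart_vector \<A> (U, \<phi>) p (comp v (U, \<phi>))) (V, \<psi>) = comp v (V, \<psi>)" for V \<psi>
  proof (cases "(V, \<psi>) \<in> \<A> \<and> p \<in> V")
    case True
    then show ?thesis using tangent_comp[OF assms(3,1) _ assms(2), of V \<psi>] by (simp add: comp_chart_vector)
  next
    case False
    then show ?thesis using tangent_outside[OF assms(3) False] by (auto simp: comp_chart_vector)
  qed
  then show ?thesis by (simp add: comp_inject[symmetric] fun_eq_iff)
qed

lemma chart_vector_linear:
  assumes "(U, \<phi>) \<in> \<A>" "p \<in> U"
  shows "linear (chart_vector \<A> (U, \<phi>) p)"
proof -
  have "comp (chart_vector \<A> (U, \<phi>) p (v + w)) (V, \<psi>) =
      comp (chart_vector \<A> (U, \<phi>) p v + chart_vector \<A> (U, \<phi>) p w) (V, \<psi>)"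
    and "comp (chart_vector \<A> (U, \<phi>) p (r *\<^sub>R v)) (V, \<psi>) =
      comp (r *\<^sub>R chart_vector \<A> (U, \<phi>) p v) (V, \<psi>)" for v w r V \<psi>
    using transition_derivative_linear[OF assms(1) _ assms(2)]
    by (cases "(V, \<psi>) \<in> \<A> \<and> p \<in> V";
        force simp: comp_add comp_scaleR comp_chart_vector linear_add linear_scale)+
  then show ?thesis by (intro linearI) (simp_all add: comp_inject[symmetric] fun_eq_iff)
qed

lemma chart_vector_sum:
  assumes "(U, \<phi>) \<in> \<A>" "p \<in> U"
  shows "(\<Sum>i\<in>I. a i *\<^sub>R chart_vector \<A> (U, \<phi>) p (w i)) = chart_vector \<A> (U, \<phi>) p (\<Sum>i\<in>I. a i *\<^sub>R w i)"
  using chart_vector_linear[OF assms] by (simp add: linear_sum linear_scale)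

lemma tangent_zero: "0 \<in> tangent_space \<A> p"
  by (rule tangentI) (simp_all add: comp_zero linear_0[OF transition_derivative_linear])

lemma tangent_add:
  assumes "v \<in> tangent_space \<A> p" "w \<in> tangent_space \<A> p"
  shows "v + w \<in> tangent_space \<A> p"
proof (rule tangentI)
  fix U \<phi> V \<psi> assume *: "(U, \<phi>) \<in> \<A>" "(V, \<psi>) \<in> \<A>" "p \<in> U" "p \<in> V"
  show "comp (v + w) (V, \<psi>) =
      frechet_derivative (\<psi> \<circ> inv_into U \<phi>) (at (\<phi> p)) (comp (v + w) (U, \<phi>))"
    unfolding comp_add linear_add[OF transition_derivative_linear[OF *]]
      tangent_comp[OF assms(1) *] tangent_comp[OF assms(2) *] ..
qed (simp add: comp_add tangent_outside[OF assms(1)] tangent_outside[OF assms(2)])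

lemma tangent_scaleR:
  assumes "v \<in> tangent_space \<A> p"
  shows "r *\<^sub>R v \<in> tangent_space \<A> p"
proof (rule tangentI)
  fix U \<phi> V \<psi> assume *: "(U, \<phi>) \<in> \<A>" "(V, \<psi>) \<in> \<A>" "p \<in> U" "p \<in> V"
  show "comp (r *\<^sub>R v) (V, \<psi>) =
      frechet_derivative (\<psi> \<circ> inv_into U \<phi>) (at (\<phi> p)) (comp (r *\<^sub>R v) (U, \<phi>))"
    unfolding comp_scaleR linear_scale[OF transition_derivative_linear[OF *]]
      tangent_comp[OF assms(1) *] ..
qed (simp add: comp_scaleR tangent_outside[OF assms(1)])

lemma tangent_eqI:
  assumes "(U, \<phi>) \<in> \<A>" "p \<in> U" "v \<in> tangent_space \<A> p" "w \<in> tangent_space \<A> p"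
    and "comp v (U, \<phi>) = comp w (U, \<phi>)"
  shows "v = w"
  using chart_vector_comp[OF assms(1,2,3), symmetric, unfolded assms(5)]
    chart_vector_comp[OF assms(1,2,4)] by (rule trans)

lemma tangent_sum:
  "(\<And>i. i \<in> I \<Longrightarrow> v i \<in> tangent_space \<A> p) \<Longrightarrow> (\<Sum>i\<in>I. a i *\<^sub>R v i) \<in> tangent_space \<A> p"
  by (induction I rule: infinite_finite_induct) (auto intro: tangent_zero tangent_add tangent_scaleR)

end

lemma C1_field_subset: "C1_field \<A> N X \<Longrightarrow> N' \<subseteq> N \<Longrightarrow> C1_field \<A> N' X"
  unfolding C1_field_def by (fast intro: C1_on_subset)

lemma C1_basis_subset: "C1_basis \<A> N E \<Longrightarrow> N' \<subseteq> N \<Longrightarrow> C1_basis \<A> N' E"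
  unfolding C1_basis_def using C1_field_subset by blast

lemma C1_functionD: "C1_function \<A> N f \<Longrightarrow> (U, \<phi>) \<in> \<A> \<Longrightarrow> C1_on (f \<circ> inv_into U \<phi>) (\<phi> ` (U \<inter> N))"
  unfolding C1_function_def by blast

lemma C1_fieldD:
  assumes "C1_field \<A> N X"
  shows "p \<in> N \<Longrightarrow> X p \<in> tangent_space \<A> p"
    and "(U, \<phi>) \<in> \<A> \<Longrightarrow> C1_on (\<lambda>x. comp (X (inv_into U \<phi> x)) (U, \<phi>)) (\<phi> ` (U \<inter> N))"
  using assms unfolding C1_field_def by blast+

lemma continuous_fieldD:
  assumes "continuous_field \<A> N X"
  shows "p \<in> N \<Longrightarrow> X p \<in> tangent_space \<A> p"
    and "(U, \<phi>) \<in> \<A> \<Longrightarrow> continuous_on (U \<inter> N) (\<lambda>p. comp (X p) (U, \<phi>))"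
  using assms unfolding continuous_field_def by blast+

lemma
  assumes "C1_basis \<A> N E"
  shows C1_basis_field: "C1_field \<A> N (E i)"
    and C1_basis_inj: "p \<in> N \<Longrightarrow> inj (\<lambda>i. E i p)"
    and C1_basis_independent: "p \<in> N \<Longrightarrow> independent (range (\<lambda>i. E i p))"
    and C1_basis_span: "p \<in> N \<Longrightarrow> span (range (\<lambda>i. E i p)) = tangent_space \<A> p"
  using assms unfolding C1_basis_def by blast+

lemma C1_basis_coefficients:
  assumes "C1_basis \<A> N E" "p \<in> N" "v \<in> tangent_space \<A> p"
  shows "\<exists>a. v = (\<Sum>i\<in>UNIV. a i *\<^sub>R E i p)"
  using assms(3) span_range_frame[OF C1_basis_inj[OF assms(1,2)]]
  by (auto simp: C1_basis_span[OF assms(1,2), symmetric])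

lemma C1_basis_zero:
  assumes "C1_basis \<A> N E" "p \<in> N" "(\<Sum>i\<in>UNIV. a i *\<^sub>R E i p) = 0"
  shows "a i = 0"
  by (rule frame_coefficients_zero[OF C1_basis_inj[OF assms(1,2)] C1_basis_independent[OF assms(1,2)] assms(3)])

context c2_manifold
begin

lemma C1_function_imp_continuous:
  assumes "C1_function \<A> N f" "open N" "N \<subseteq> M"
  shows "continuous_on N f"
proof -
  have "isCont f p" if "p \<in> N" for p
  proof -
    obtain U \<phi> where c: "(U, \<phi>) \<in> \<A>" "p \<in> U" using chart_at \<open>p \<in> N\<close> assms(3) by blast
    have cont: "continuous_on (U \<inter> N) \<phi>"
      using chart_homeomorphism[OF c(1)] continuous_on_subset by (fastforce simp: homeomorphism_def)
    have "continuous_on (U \<inter> N) (\<lambda>p. (f \<circ> inv_into U \<phi>) (\<phi> p))"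
      by (rule continuous_on_compose2[OF C1_on_imp_continuous_on[OF C1_functionD[OF assms(1) c(1)]] cont]) auto
    then have "continuous_on (U \<inter> N) f"
      by (rule continuous_on_eq) (simp add: c)
    then show ?thesis
      using continuous_on_eq_continuous_at[of "U \<inter> N" f] chart_open[OF c(1)] assms(2) c that by blast
  qed
  then show ?thesis by (simp add: continuous_at_imp_continuous_on)
qed

lemma C1_field_imp_continuous_field:
  assumes "C1_field \<A> N X"
  shows "continuous_field \<A> N X"
  unfolding continuous_field_def
proof (intro conjI ballI, goal_cases)
  case (1 p)
  then show ?case using C1_fieldD(1)[OF assms] by blast
next
  case (2 c)
  obtain U \<phi> where c: "c = (U, \<phi>)" by (cases c)
  have "continuous_on (U \<inter> N) (\<lambda>p. comp (X p) (U, \<phi>))" if U: "(U, \<phi>) \<in> \<A>"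
  proof -
    have cont: "continuous_on (U \<inter> N) \<phi>"
      using chart_homeomorphism[OF U] continuous_on_subset by (fastforce simp: homeomorphism_def)
    have "continuous_on (U \<inter> N) (\<lambda>p. comp (X (inv_into U \<phi> (\<phi> p))) (U, \<phi>))"
      by (rule continuous_on_compose2[OF C1_on_imp_continuous_on[OF C1_fieldD(2)[OF assms U]] cont]) auto
    then show ?thesis
      by (rule continuous_on_eq) (simp add: U)
  qed
  then show ?case using 2 by (simp add: c)
qed

lemma C1_field_zero: "C1_field \<A> N (\<lambda>q. 0)"
  unfolding C1_field_def by (auto simp: comp_zero intro: tangent_zero C1_on_const)

lemma C1_field_add_scaled:
  assumes "C1_field \<A> N X" "C1_field \<A> N Y" "C1_function \<A> N f"
  shows "C1_field \<A> N (\<lambda>q. f q *\<^sub>R X q + Y q)"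
  unfolding C1_field_def
proof (intro conjI ballI)
  fix p assume p: "p \<in> N"
  show "f p *\<^sub>R X p + Y p \<in> tangent_space \<A> p"
    by (intro tangent_add tangent_scaleR C1_fieldD(1)[OF assms(1) p] C1_fieldD(1)[OF assms(2) p])
next
  fix c assume "c \<in> \<A>"
  moreover obtain U \<phi> where c: "c = (U, \<phi>)" by (cases c)
  ultimately have U: "(U, \<phi>) \<in> \<A>" by simp
  have "C1_on (\<lambda>x. (f \<circ> inv_into U \<phi>) x *\<^sub>R comp (X (inv_into U \<phi> x)) (U, \<phi>) +
      comp (Y (inv_into U \<phi> x)) (U, \<phi>)) (\<phi> ` (U \<inter> N))"
    by (intro C1_on_add C1_on_scaleR C1_functionD[OF assms(3) U] C1_fieldD(2)[OF assms(1) U]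
        C1_fieldD(2)[OF assms(2) U])
  then show "case c of (U, \<phi>) \<Rightarrow>
      C1_on (\<lambda>x. comp (f (inv_into U \<phi> x) *\<^sub>R X (inv_into U \<phi> x) + Y (inv_into U \<phi> x)) (U, \<phi>)) (\<phi> ` (U \<inter> N))"
    by (simp add: c comp_add comp_scaleR)
qed

lemma continuous_field_add_scaled:
  assumes "continuous_field \<A> N X" "continuous_field \<A> N Y" "continuous_on N f"
  shows "continuous_field \<A> N (\<lambda>q. f q *\<^sub>R X q + Y q)"
  unfolding continuous_field_def
proof (intro conjI ballI)
  fix p assume p: "p \<in> N"
  show "f p *\<^sub>R X p + Y p \<in> tangent_space \<A> p"
    by (intro tangent_add tangent_scaleR continuous_fieldD(1)[OF assms(1) p]
        continuous_fieldD(1)[OF assms(2) p])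
next
  fix c assume "c \<in> \<A>"
  moreover obtain U \<phi> where c: "c = (U, \<phi>)" by (cases c)
  ultimately have U: "(U, \<phi>) \<in> \<A>" by simp
  have "continuous_on (U \<inter> N) (\<lambda>p. f p *\<^sub>R comp (X p) (U, \<phi>) + comp (Y p) (U, \<phi>))"
    by (intro continuous_on_add continuous_on_scaleR continuous_fieldD(2)[OF assms(1) U]
        continuous_fieldD(2)[OF assms(2) U] continuous_on_subset[OF assms(3)]) auto
  then show "case c of (U, \<phi>) \<Rightarrow> continuous_on (U \<inter> N) (\<lambda>p. comp (f p *\<^sub>R X p + Y p) (U, \<phi>))"
    by (simp add: c comp_add comp_scaleR)
qed

lemma C1_field_sum:
  assumes "finite I" "\<And>i. i \<in> I \<Longrightarrow> C1_field \<A> N (X i)" "\<And>i. i \<in> I \<Longrightarrow> C1_function \<A> N (f i)"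
  shows "C1_field \<A> N (\<lambda>q. \<Sum>i\<in>I. f i q *\<^sub>R X i q)"
  using assms by (induction I rule: finite_induct) (simp_all add: C1_field_zero C1_field_add_scaled)

lemma continuous_field_sum:
  assumes "finite I" "\<And>i. i \<in> I \<Longrightarrow> continuous_field \<A> N (X i)" "\<And>i. i \<in> I \<Longrightarrow> continuous_on N (f i)"
  shows "continuous_field \<A> N (\<lambda>q. \<Sum>i\<in>I. f i q *\<^sub>R X i q)"
  using assms
  by (induction I rule: finite_induct)
    (simp_all add: C1_field_imp_continuous_field[OF C1_field_zero] continuous_field_add_scaled)

lemma C1_function_chart:
  assumes U: "(U, \<phi>) \<in> \<A>" and N: "open N" "N \<subseteq> U" and f: "C1_on f (\<phi> ` N)"
  shows "C1_function \<A> N (\<lambda>p. f (\<phi> p))"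
  unfolding C1_function_def
proof (intro ballI)
  fix c assume "c \<in> \<A>"
  moreover obtain V \<psi> where c: "c = (V, \<psi>)" by (cases c)
  ultimately have V: "(V, \<psi>) \<in> \<A>" by simp
  have "C1_on (\<lambda>x. f ((\<phi> \<circ> inv_into V \<psi>) x)) (\<psi> ` (V \<inter> N))"
    by (rule C1_on_compose[OF f C1_on_subset[OF transition_C1[OF V U]]]) (use N V in auto)
  then show "case c of (V, \<psi>) \<Rightarrow> C1_on ((\<lambda>p. f (\<phi> p)) \<circ> inv_into V \<psi>) (\<psi> ` (V \<inter> N))"
    by (simp add: c o_def)
qed

text \<open>In another chart the components are the derivative of the transition map applied to \<open>w\<close>.
  This is where the transition maps have to be of class \<open>C\<^sup>2\<close>.\<close>

lemma C1_field_chart: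
  assumes U: "(U, \<phi>) \<in> \<A>" and N: "open N" "N \<subseteq> U" and w: "C1_on w (\<phi> ` N)"
  shows "C1_field \<A> N (\<lambda>p. chart_vector \<A> (U, \<phi>) p (w (\<phi> p)))"
  unfolding C1_field_def
proof (intro conjI ballI)
  fix p assume "p \<in> N"
  then show "chart_vector \<A> (U, \<phi>) p (w (\<phi> p)) \<in> tangent_space \<A> p"
    using chart_vector_tangent[OF U] N by blast
next
  fix c assume "c \<in> \<A>"
  moreover obtain V \<psi> where c: "c = (V, \<psi>)" by (cases c)
  ultimately have V: "(V, \<psi>) \<in> \<A>" by simp
  let ?S = "\<psi> ` (V \<inter> N)"
  let ?t = "\<phi> \<circ> inv_into V \<psi>"
  obtain T where T: "\<And>x. x \<in> \<phi> ` (U \<inter> V) \<Longrightarrow>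
      ((\<psi> \<circ> inv_into U \<phi>) has_derivative blinfun_apply (T x)) (at x)" "C1_on T (\<phi> ` (U \<inter> V))"
    using transition_C2[OF U V] unfolding C2_on_def by blast
  have t: "C1_on ?t ?S"
    by (rule C1_on_subset[OF transition_C1[OF V U]]) (use N in auto)
  have "C1_on (\<lambda>x. T (?t x) (w (?t x))) ?S"
    by (rule C1_on_blinfun_apply[OF C1_on_compose[OF T(2) t] C1_on_compose[OF w t]])
      (use N V in auto)
  then have "C1_on (\<lambda>x. comp (chart_vector \<A> (U, \<phi>) (inv_into V \<psi> x) (w (\<phi> (inv_into V \<psi> x)))) (V, \<psi>)) ?S"
  proof (rule C1_on_cong[OF chart_image_open'[OF V N(1)], rotated])
    fix x assume "x \<in> ?S"
    then obtain p where p: "x = \<psi> p" "p \<in> V" "p \<in> N" by blast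
    have "blinfun_apply (T (\<phi> p)) = frechet_derivative (\<psi> \<circ> inv_into U \<phi>) (at (\<phi> p))"
      by (rule frechet_derivative_at[OF T(1)]) (use p N in auto)
    then show "T (?t x) (w (?t x)) =
        comp (chart_vector \<A> (U, \<phi>) (inv_into V \<psi> x) (w (\<phi> (inv_into V \<psi> x)))) (V, \<psi>)"
      using p V by (simp add: comp_chart_vector)
  qed
  then show "case c of (V, \<psi>) \<Rightarrow> C1_on (\<lambda>x. comp (chart_vector \<A> (U, \<phi>) (inv_into V \<psi> x)
      (w (\<phi> (inv_into V \<psi> x)))) (V, \<psi>)) (\<psi> ` (V \<inter> N))"
    by (simp add: c)
qed

lemma C1_basis_chart:
  assumes U: "(U, \<phi>) \<in> \<A>" and N: "open N" "N \<subseteq> U"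
    and A: "C1_on A (\<phi> ` N)" "\<And>x. x \<in> \<phi> ` N \<Longrightarrow> det (A x) \<noteq> 0"
  shows "C1_basis \<A> N (\<lambda>j p. chart_vector \<A> (U, \<phi>) p (column j (A (\<phi> p))))"
  unfolding C1_basis_def
proof (intro conjI allI ballI)
  fix j
  have "bounded_linear (\<lambda>B::real^'n^'n. column j B)"
    unfolding linear_conv_bounded_linear[symmetric]
    by (rule linearI) (simp_all add: column_def vec_eq_iff)
  then show "C1_field \<A> N (\<lambda>p. chart_vector \<A> (U, \<phi>) p (column j (A (\<phi> p))))"
    by (intro C1_field_chart[OF U N] C1_on_bounded_linear[where T = "column j"] A)
next
  fix p assume p: "p \<in> N"
  then have pU: "p \<in> U" using N by blast
  let ?e = "\<lambda>i. chart_vector \<A> (U, \<phi>) p (column i (A (\<phi> p)))"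
  have sum: "(\<Sum>i\<in>UNIV. a i *\<^sub>R ?e i) = chart_vector \<A> (U, \<phi>) p (A (\<phi> p) *v (\<chi> i. a i))" for a
    unfolding chart_vector_sum[OF U pU]
    by (simp add: matrix_mult_sum scalar_mult_eq_scaleR)
  have inv: "invertible (A (\<phi> p))" using A(2) p by (simp add: invertible_det_nz)
  have zero: "a i = 0" if "(\<Sum>i\<in>UNIV. a i *\<^sub>R ?e i) = 0" for a i
  proof -
    have "A (\<phi> p) *v (\<chi> i. a i) = 0"
      using arg_cong[OF that[unfolded sum], of "\<lambda>v. comp v (U, \<phi>)"]
      by (simp add: comp_chart_vector_self[OF U pU] comp_zero)
    then have "(\<chi> i. a i) = 0" using inv
      by (metis invertible_def matrix_left_invertible_ker)
    then show ?thesis by (simp add: vec_eq_iff)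
  qed
  show inj: "inj ?e" and "independent (range ?e)"
    using independent_frameI[of ?e] zero by blast+
  show "span (range ?e) = tangent_space \<A> p"
  proof
    show "span (range ?e) \<subseteq> tangent_space \<A> p"
      unfolding span_range_frame[OF inj] by (auto intro!: tangent_sum chart_vector_tangent[OF U pU])
    show "tangent_space \<A> p \<subseteq> span (range ?e)"
    proof
      fix v assume v: "v \<in> tangent_space \<A> p"
      obtain B where B: "A (\<phi> p) ** B = mat 1" using inv unfolding invertible_def by blast
      let ?a = "B *v comp v (U, \<phi>)"
      have "A (\<phi> p) *v ?a = comp v (U, \<phi>)"
        by (simp add: matrix_vector_mul_assoc B)
      then have "v = (\<Sum>i\<in>UNIV. (?a $ i) *\<^sub>R ?e i)"
        unfolding sum by (simp add: chart_vector_comp[OF U pU v])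
      then show "v \<in> span (range ?e)" unfolding span_range_frame[OF inj] by blast
    qed
  qed
qed

text \<open>Both the derivative of \<open>f\<close> and the components of \<open>v\<close> transform with the derivative of
  the transition map, so the chart selected in the definition of \<open>act\<close> may be replaced.\<close>

lemma act_chart:
  assumes "C1_function \<A> N f" "open N" "p \<in> N" "v \<in> tangent_space \<A> p" and U: "(U, \<phi>) \<in> \<A>" "p \<in> U"
  shows "act \<A> p v f = frechet_derivative (f \<circ> inv_into U \<phi>) (at (\<phi> p)) (comp v (U, \<phi>))"
proof -
  define c where "c = (SOME c. c \<in> \<A> \<and> p \<in> fst c)"
  have "c \<in> \<A> \<and> p \<in> fst c"
    unfolding c_def by (rule someI[of _ "(U, \<phi>)"]) (use U in auto)
  then obtain V \<psi> where V: "c = (V, \<psi>)" "(V, \<psi>) \<in> \<A>" "p \<in> V" by (cases c) auto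
  have "(f \<circ> inv_into V \<psi>) differentiable at (\<psi> p)"
    by (rule C1_on_differentiable[OF C1_functionD[OF assms(1) V(2)]]) (use V assms in auto)
  then have "((f \<circ> inv_into V \<psi>) has_derivative frechet_derivative (f \<circ> inv_into V \<psi>) (at (\<psi> p))) (at (\<psi> p))"
    by (simp add: frechet_derivative_works[symmetric])
  from frechet_derivative_at[OF has_derivative_change_chart[OF U(1) V(2) U(2) V(3) this]]
  have "frechet_derivative (f \<circ> inv_into U \<phi>) (at (\<phi> p)) (comp v (U, \<phi>)) =
      frechet_derivative (f \<circ> inv_into V \<psi>) (at (\<psi> p))
        (frechet_derivative (\<psi> \<circ> inv_into U \<phi>) (at (\<phi> p)) (comp v (U, \<phi>)))"
    by metis
  then show ?thesis
    unfolding act_def c_def[symmetric] Let_def V(1) fst_conv snd_conv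
    by (simp only: tangent_comp[OF assms(4) U(1) V(2) U(2) V(3), symmetric])
qed

lemma act_sum:
  assumes f: "C1_function \<A> N f" "open N" "p \<in> N" "N \<subseteq> M"
    and v: "\<And>k. k \<in> I \<Longrightarrow> v k \<in> tangent_space \<A> p"
  shows "act \<A> p (\<Sum>k\<in>I. a k *\<^sub>R v k) f = (\<Sum>k\<in>I. a k * act \<A> p (v k) f)"
proof -
  obtain U \<phi> where U: "(U, \<phi>) \<in> \<A>" "p \<in> U" using chart_at f(3,4) by blast
  have "(f \<circ> inv_into U \<phi>) differentiable at (\<phi> p)"
    by (rule C1_on_differentiable[OF C1_functionD[OF f(1) U(1)]]) (use U f in auto)
  then have lin: "linear (frechet_derivative (f \<circ> inv_into U \<phi>) (at (\<phi> p)))"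
    by (rule linear_frechet_derivative)
  have "act \<A> p (v k) f = frechet_derivative (f \<circ> inv_into U \<phi>) (at (\<phi> p)) (comp (v k) (U, \<phi>))"
    if "k \<in> I" for k by (rule act_chart[OF f(1-3) v[OF that] U])
  moreover have "(\<Sum>k\<in>I. a k *\<^sub>R v k) \<in> tangent_space \<A> p"
    by (rule tangent_sum) (rule v)
  ultimately show ?thesis
    by (simp add: act_chart[OF f(1-3) _ U] comp_sum comp_scaleR linear_sum[OF lin] linear_scale[OF lin])
qed

end

section \<open>Connections and changes of basis\<close>

locale c2_connection = c2_manifold M \<A>
  for M :: "'m::t2_space set" and \<A> :: "('m, 'n::finite) chart set" +
  fixes nabla :: "('m \<Rightarrow> ('m, 'n) tvec) \<Rightarrow> ('m \<Rightarrow> ('m, 'n) tvec) \<Rightarrow> 'm \<Rightarrow> ('m, 'n) tvec"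
  assumes connection: "linear_connection M \<A> nabla"
begin

lemma
  assumes "open N" "N \<subseteq> M" "continuous_field \<A> N X" "continuous_field \<A> N X'"
    "C1_field \<A> N Y" "C1_field \<A> N Y'"
  shows nabla_continuous: "continuous_field \<A> N (nabla X Y)"
    and nabla_left: "continuous_on N f \<Longrightarrow> p \<in> N \<Longrightarrow>
      nabla (\<lambda>q. f q *\<^sub>R X q + X' q) Y p = f p *\<^sub>R nabla X Y p + nabla X' Y p"
    and nabla_add: "p \<in> N \<Longrightarrow> nabla X (\<lambda>q. Y q + Y' q) p = nabla X Y p + nabla X Y' p"
    and nabla_leibniz: "C1_function \<A> N f \<Longrightarrow> p \<in> N \<Longrightarrow>
      nabla X (\<lambda>q. f q *\<^sub>R Y q) p = act \<A> p (X p) f *\<^sub>R Y p + f p *\<^sub>R nabla X Y p"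
    and nabla_cong: "(\<And>q. q \<in> N \<Longrightarrow> X q = X' q) \<Longrightarrow> (\<And>q. q \<in> N \<Longrightarrow> Y q = Y' q) \<Longrightarrow> p \<in> N \<Longrightarrow>
      nabla X Y p = nabla X' Y' p"
proof -
  have *: "continuous_field \<A> N (nabla X Y) \<and>
          (\<forall>f. continuous_on N f \<longrightarrow>
             (\<forall>p\<in>N. nabla (\<lambda>q. f q *\<^sub>R X q + X' q) Y p = f p *\<^sub>R nabla X Y p + nabla X' Y p)) \<and>
          (\<forall>p\<in>N. nabla X (\<lambda>q. Y q + Y' q) p = nabla X Y p + nabla X Y' p) \<and>
          (\<forall>f. C1_function \<A> N f \<longrightarrow>
             (\<forall>p\<in>N. nabla X (\<lambda>q. f q *\<^sub>R Y q) p = act \<A> p (X p) f *\<^sub>R Y p + f p *\<^sub>R nabla X Y p)) \<and>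
          ((\<forall>p\<in>N. X p = X' p \<and> Y p = Y' p) \<longrightarrow> (\<forall>p\<in>N. nabla X Y p = nabla X' Y' p))"
    using connection[unfolded linear_connection_def, rule_format, of N X X' Y Y'] assms by blast
  show "continuous_field \<A> N (nabla X Y)" using * by blast
  show "continuous_on N f \<Longrightarrow> p \<in> N \<Longrightarrow>
      nabla (\<lambda>q. f q *\<^sub>R X q + X' q) Y p = f p *\<^sub>R nabla X Y p + nabla X' Y p" using * by blast
  show "p \<in> N \<Longrightarrow> nabla X (\<lambda>q. Y q + Y' q) p = nabla X Y p + nabla X Y' p" using * by blast
  show "C1_function \<A> N f \<Longrightarrow> p \<in> N \<Longrightarrow>
      nabla X (\<lambda>q. f q *\<^sub>R Y q) p = act \<A> p (X p) f *\<^sub>R Y p + f p *\<^sub>R nabla X Y p" using * by blast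
  show "(\<And>q. q \<in> N \<Longrightarrow> X q = X' q) \<Longrightarrow> (\<And>q. q \<in> N \<Longrightarrow> Y q = Y' q) \<Longrightarrow> p \<in> N \<Longrightarrow>
      nabla X Y p = nabla X' Y' p" using * by blast
qed

text \<open>That \<open>nabla\<close> of the zero field vanishes is not among the axioms; it follows from additivity
  because the value is twice itself.\<close>

lemma nabla_sum_left:
  assumes N: "open N" "N \<subseteq> M" and Y: "C1_field \<A> N Y" and "finite I"
    and X: "\<And>k. k \<in> I \<Longrightarrow> continuous_field \<A> N (X k)"
    and f: "\<And>k. k \<in> I \<Longrightarrow> continuous_on N (f k)" and p: "p \<in> N"
  shows "nabla (\<lambda>q. \<Sum>k\<in>I. f k q *\<^sub>R X k q) Y p = (\<Sum>k\<in>I. f k p *\<^sub>R nabla (X k) Y p)"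
  using \<open>finite I\<close> X f
proof (induction I rule: finite_induct)
  case empty
  have z: "continuous_field \<A> N (\<lambda>q. 0)" by (rule C1_field_imp_continuous_field[OF C1_field_zero])
  have "nabla (\<lambda>q. 1 *\<^sub>R 0 + 0) Y p = 1 *\<^sub>R nabla (\<lambda>q. 0) Y p + nabla (\<lambda>q. 0) Y p"
    by (rule nabla_left[OF N z z Y Y continuous_on_const p])
  then show ?case by simp
next
  case (insert k I)
  have "continuous_field \<A> N (\<lambda>q. \<Sum>k\<in>I. f k q *\<^sub>R X k q)"
    using insert by (intro continuous_field_sum) auto
  from nabla_left[OF N _ this Y Y _ p, of "X k" "f k"] show ?case
    using insert by simp
qed

lemma nabla_sum_right:
  assumes N: "open N" "N \<subseteq> M" and X: "continuous_field \<A> N X" and "finite I"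
    and Y: "\<And>i. i \<in> I \<Longrightarrow> C1_field \<A> N (Y i)"
    and f: "\<And>i. i \<in> I \<Longrightarrow> C1_function \<A> N (f i)" and p: "p \<in> N"
  shows "nabla X (\<lambda>q. \<Sum>i\<in>I. f i q *\<^sub>R Y i q) p =
    (\<Sum>i\<in>I. act \<A> p (X p) (f i) *\<^sub>R Y i p + f i p *\<^sub>R nabla X (Y i) p)"
  using \<open>finite I\<close> Y f
proof (induction I rule: finite_induct)
  case empty
  have "nabla X (\<lambda>q. 0 + 0) p = nabla X (\<lambda>q. 0) p + nabla X (\<lambda>q. 0) p"
    by (rule nabla_add[OF N X X C1_field_zero C1_field_zero p])
  then show ?case by simp
next
  case (insert i I)
  have s: "C1_field \<A> N (\<lambda>q. \<Sum>i\<in>I. f i q *\<^sub>R Y i q)"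
    using insert by (intro C1_field_sum) auto
  have fi: "C1_field \<A> N (\<lambda>q. f i q *\<^sub>R Y i q)"
    using C1_field_add_scaled[OF _ C1_field_zero, of N "Y i" "f i"] insert by simp
  have "nabla X (\<lambda>q. f i q *\<^sub>R Y i q) p = act \<A> p (X p) (f i) *\<^sub>R Y i p + f i p *\<^sub>R nabla X (Y i) p"
    using insert by (intro nabla_leibniz[OF N X X _ _ _ p]) auto
  then show ?case
    using nabla_add[OF N X X fi s p] insert by simp
qed

lemma nabla_tangent:
  assumes "open N" "N \<subseteq> M" "C1_basis \<A> N E" "p \<in> N"
  shows "nabla (E k) (E j) p \<in> tangent_space \<A> p"
  using nabla_continuous[OF assms(1,2)] C1_field_imp_continuous_field C1_basis_field[OF assms(3)]
    continuous_fieldD(1) assms(4) by blast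

text \<open>The right-hand side does not mention the domain \<open>N\<close>, so two bases can be compared on the
  intersection of their domains. For its use in the direction from right to left the components have to
  exist; they are the coefficients of the covariant derivatives in the basis.\<close>

lemma components_vanish_at_iff:
  assumes N: "open N" "N \<subseteq> M" and E: "C1_basis \<A> N E" and p: "p \<in> N"
  shows "components_vanish_at nabla N E p \<longleftrightarrow> (\<forall>j k. nabla (E k) (E j) p = 0)"
proof -
  have E1: "C1_field \<A> N (E i)" and E0: "continuous_field \<A> N (E i)" for i
    using C1_basis_field[OF E] C1_field_imp_continuous_field by blast+
  have only_if: "nabla (E k) (E j) p = (\<Sum>i\<in>UNIV. \<Gamma> i j k p *\<^sub>R E i p)"
    if "components nabla N E \<Gamma>" for \<Gamma> j k
  proof -
    \<comment> \<open>Constant coefficients that single out the field \<open>E k\<close>.\<close>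
    let ?\<xi> = "\<lambda>l (q::'m). if l = k then 1 else 0 :: real"
    have "nabla (\<lambda>q. \<Sum>l\<in>UNIV. ?\<xi> l q *\<^sub>R E l q) (E j) p =
        (\<Sum>i\<in>UNIV. (\<Sum>l\<in>UNIV. \<Gamma> i j l p * ?\<xi> l p) *\<^sub>R E i p)"
      using that[unfolded components_def, THEN spec, of ?\<xi>] p continuous_on_const by blast
    then show ?thesis by (simp add: if_distrib[of "\<lambda>x. x *\<^sub>R _"] if_distrib[of "\<lambda>x. _ * x"] cong: if_cong)
  qed
  have "\<exists>\<Gamma>. components nabla N E \<Gamma>"
  proof -
    define a where "a j k q = (SOME b. nabla (E k) (E j) q = (\<Sum>i\<in>UNIV. b i *\<^sub>R E i q))" for j k q
    have a: "nabla (E k) (E j) q = (\<Sum>i\<in>UNIV. a j k q i *\<^sub>R E i q)" if "q \<in> N" for j k q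
      unfolding a_def
      by (rule someI_ex[OF C1_basis_coefficients[OF E that nabla_tangent[OF N E that]]])
    have "components nabla N E (\<lambda>i j k q. a j k q i)"
      unfolding components_def
    proof (intro allI impI ballI)
      fix \<xi> :: "'n \<Rightarrow> 'm \<Rightarrow> real" and j q assume \<xi>: "\<forall>k. continuous_on N (\<xi> k)" and q: "q \<in> N"
      have "nabla (\<lambda>q. \<Sum>k\<in>UNIV. \<xi> k q *\<^sub>R E k q) (E j) q = (\<Sum>k\<in>UNIV. \<xi> k q *\<^sub>R nabla (E k) (E j) q)"
        using \<xi> by (intro nabla_sum_left[OF N E1 _ E0 _ q]) auto
      also have "\<dots> = (\<Sum>k\<in>UNIV. \<Sum>i\<in>UNIV. (a j k q i * \<xi> k q) *\<^sub>R E i q)"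
        by (simp add: a[OF q] scaleR_sum_right mult.commute)
      also have "\<dots> = (\<Sum>i\<in>UNIV. (\<Sum>k\<in>UNIV. a j k q i * \<xi> k q) *\<^sub>R E i q)"
        by (subst sum.swap) (simp add: scaleR_sum_left)
      finally show "nabla (\<lambda>q. \<Sum>k\<in>UNIV. \<xi> k q *\<^sub>R E k q) (E j) q =
          (\<Sum>i\<in>UNIV. (\<Sum>k\<in>UNIV. a j k q i * \<xi> k q) *\<^sub>R E i q)" .
    qed
    then show ?thesis by blast
  qed
  then obtain \<Gamma> where \<Gamma>: "components nabla N E \<Gamma>" by blast
  show ?thesis
  proof
    assume "components_vanish_at nabla N E p"
    then show "\<forall>j k. nabla (E k) (E j) p = 0"
      unfolding components_vanish_at_def using only_if by fastforce
  next
    assume *: "\<forall>j k. nabla (E k) (E j) p = 0"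
    have "\<Gamma> i j k p = 0" for i j k
      by (rule C1_basis_zero[OF E p, of "\<lambda>i. \<Gamma> i j k p"]) (use only_if[OF \<Gamma>] * in metis)
    then show "components_vanish_at nabla N E p"
      unfolding components_vanish_at_def using \<Gamma> by blast
  qed
qed

text \<open>The Leibniz rule in the differentiated argument and linearity in the direction.\<close>

lemma nabla_transformation:
  assumes N: "open N" "N \<subseteq> M" and E: "C1_basis \<A> N E" and E': "C1_basis \<A> N E'"
    and A: "transformation \<A> N E E' A" and p: "p \<in> N"
  shows "nabla (E' k) (E' j) p = (\<Sum>i\<in>UNIV. act \<A> p (E' k p) (A i j) *\<^sub>R E i p +
    A i j p *\<^sub>R (\<Sum>l\<in>UNIV. A l k p *\<^sub>R nabla (E l) (E i) p))"
proof -
  have E1: "C1_field \<A> N (E i)" and E0: "continuous_field \<A> N (E i)" for i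
    using C1_basis_field[OF E] C1_field_imp_continuous_field by blast+
  have E1': "C1_field \<A> N (E' i)" and E0': "continuous_field \<A> N (E' i)" for i
    using C1_basis_field[OF E'] C1_field_imp_continuous_field by blast+
  have A1: "C1_function \<A> N (A i j)" and AE: "q \<in> N \<Longrightarrow> E' j q = (\<Sum>i\<in>UNIV. A i j q *\<^sub>R E i q)" for i j q
    using A unfolding transformation_def by blast+
  have A0: "continuous_on N (A i j)" for i j
    by (rule C1_function_imp_continuous[OF A1 N])
  let ?F = "\<lambda>j q. \<Sum>i\<in>UNIV. A i j q *\<^sub>R E i q"
  have F1: "C1_field \<A> N (?F j)" for j by (intro C1_field_sum E1 A1) auto
  note F0 = C1_field_imp_continuous_field[OF F1]
  have "nabla (E' k) (E' j) p = nabla (E' k) (?F j) p"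
    by (rule nabla_cong[OF N E0' E0' E1' F1 _ AE p]) auto
  also have "\<dots> = (\<Sum>i\<in>UNIV. act \<A> p (E' k p) (A i j) *\<^sub>R E i p + A i j p *\<^sub>R nabla (E' k) (E i) p)"
    by (rule nabla_sum_right[OF N E0' _ E1 A1 p]) auto
  finally have leibniz: "nabla (E' k) (E' j) p =
      (\<Sum>i\<in>UNIV. act \<A> p (E' k p) (A i j) *\<^sub>R E i p + A i j p *\<^sub>R nabla (E' k) (E i) p)" .
  have "nabla (E' k) (E i) p = (\<Sum>l\<in>UNIV. A l k p *\<^sub>R nabla (E l) (E i) p)" for i
  proof -
    have "nabla (E' k) (E i) p = nabla (?F k) (E i) p"
      by (rule nabla_cong[OF N E0' F0 E1 E1 AE _ p]) auto
    also have "\<dots> = (\<Sum>l\<in>UNIV. A l k p *\<^sub>R nabla (E l) (E i) p)"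
      by (rule nabla_sum_left[OF N E1 _ E0 A0 p]) auto
    finally show ?thesis .
  qed
  then show ?thesis by (simp add: leibniz)
qed

text \<open>What remains of the law of change is \<open>\<Sum>i. (E' k)(A i j) E i\<close>, and the \<open>E i\<close> are
  independent. The vectors of one basis are combinations of those of the other, so it does not matter
  which of them act on the coefficients.\<close>

lemma vanishing_transformation_iff:
  assumes N: "open N" "N \<subseteq> M" and E: "C1_basis \<A> N E" and E': "C1_basis \<A> N E'"
    and A: "transformation \<A> N E E' A" and p: "p \<in> N"
    and vanish: "\<And>j k. nabla (E k) (E j) p = 0"
  shows "(\<forall>j k. nabla (E' k) (E' j) p = 0) \<longleftrightarrow> (\<forall>i j k. act \<A> p (E k p) (A i j) = 0)"
proof -
  have A1: "C1_function \<A> N (A i j)" for i j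
    using A unfolding transformation_def by blast
  have *: "nabla (E' k) (E' j) p = (\<Sum>i\<in>UNIV. act \<A> p (E' k p) (A i j) *\<^sub>R E i p)" for j k
    by (simp add: nabla_transformation[OF N E E' A p] vanish)
  have "(\<forall>j k. nabla (E' k) (E' j) p = 0) \<longleftrightarrow> (\<forall>i j k. act \<A> p (E' k p) (A i j) = 0)"
  proof
    assume zero: "\<forall>j k. nabla (E' k) (E' j) p = 0"
    have "act \<A> p (E' k p) (A i j) = 0" for i j k
      by (rule C1_basis_zero[OF E p, of "\<lambda>i. act \<A> p (E' k p) (A i j)"]) (use zero * in metis)
    then show "\<forall>i j k. act \<A> p (E' k p) (A i j) = 0" by blast
  qed (simp add: *)
  also have "\<dots> \<longleftrightarrow> (\<forall>i j k. act \<A> p (E k p) (A i j) = 0)"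
  proof -
    have change: "act \<A> p (G k p) (A i j) = 0"
      if F: "C1_basis \<A> N F" and G: "C1_basis \<A> N G" and "\<forall>i j k. act \<A> p (F k p) (A i j) = 0"
      for F G i j k
    proof -
      obtain b where b: "G k p = (\<Sum>l\<in>UNIV. b l *\<^sub>R F l p)"
        using C1_basis_coefficients[OF F p C1_fieldD(1)[OF C1_basis_field[OF G] p]] by blast
      show ?thesis
        unfolding b act_sum[OF A1 N(1) p N(2) C1_fieldD(1)[OF C1_basis_field[OF F] p]]
        using that(3) by simp
    qed
    show ?thesis using change[OF E E'] change[OF E' E] by blast
  qed
  finally show ?thesis .
qed

end

context c2_manifold
begin

text \<open>The coefficients at a point are unique, hence independent of charts; in each chart Cramer's
  rule expresses them by determinants of components of the two bases.\<close>

lemma transformation_exists: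
  assumes N: "open N" "N \<subseteq> M" and E: "C1_basis \<A> N E" and E': "C1_basis \<A> N E'"
  shows "\<exists>A. transformation \<A> N E E' A"
proof -
  define a where "a j q = (SOME b. E' j q = (\<Sum>i\<in>UNIV. b i *\<^sub>R E i q))" for j q
  have a: "E' j q = (\<Sum>i\<in>UNIV. a j q i *\<^sub>R E i q)" if "q \<in> N" for j q
    unfolding a_def
    by (rule someI_ex[OF C1_basis_coefficients[OF E that C1_fieldD(1)[OF C1_basis_field[OF E'] that]]])
  have "C1_function \<A> N (\<lambda>q. a j q i)" for i j
    unfolding C1_function_def
  proof (intro ballI)
    fix c assume "c \<in> \<A>"
    moreover obtain U \<phi> where c: "c = (U, \<phi>)" by (cases c)
    ultimately have U: "(U, \<phi>) \<in> \<A>" by simp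
    let ?S = "\<phi> ` (U \<inter> N)"
    define e where "e x = (\<chi> r i. comp (E i (inv_into U \<phi> x)) (U, \<phi>) $ r)" for x
    define e' where "e' x = comp (E' j (inv_into U \<phi> x)) (U, \<phi>)" for x
    define e'' where "e'' x = (\<chi> r l. if l = i then e' x $ r else e x $ r $ l)" for x
    have comp1: "C1_on (\<lambda>x. comp (F (inv_into U \<phi> x)) (U, \<phi>) $ r) ?S" if "C1_field \<A> N F" for F r
      by (rule C1_on_bounded_linear[OF bounded_linear_vec_nth C1_fieldD(2)[OF that U]])
    have C1e: "C1_on (\<lambda>x. e x $ r $ l) ?S" for r l
      unfolding e_def by (simp add: comp1 C1_basis_field[OF E])
    have C1e'': "C1_on (\<lambda>x. e'' x $ r $ l) ?S" for r l
      unfolding e''_def using C1e comp1[OF C1_basis_field[OF E']] by (cases "l = i") (auto simp: e'_def)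
    have main: "det (e x) \<noteq> 0" "a j (inv_into U \<phi> x) i = det (e'' x) / det (e x)" if x: "x \<in> ?S" for x
    proof -
      obtain q where q: "x = \<phi> q" "q \<in> U" "q \<in> N" using x by blast
      have iq: "inv_into U \<phi> x = q" using q U by simp
      have mult: "e x *v (\<chi> i. b i) = comp (\<Sum>i\<in>UNIV. b i *\<^sub>R E i q) (U, \<phi>)" for b
        by (simp add: e_def iq vec_eq_iff matrix_vector_mult_def comp_sum comp_scaleR mult.commute)
      have "w = 0" if "e x *v w = 0" for w
      proof -
        have w: "w = (\<chi> i. w $ i)" by simp
        have "comp (\<Sum>i\<in>UNIV. (w $ i) *\<^sub>R E i q) (U, \<phi>) = comp 0 (U, \<phi>)"
          using that by (subst (asm) w) (simp only: mult comp_zero)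
        then have "(\<Sum>i\<in>UNIV. (w $ i) *\<^sub>R E i q) = 0"
          by (rule tangent_eqI[OF U q(2) tangent_sum tangent_zero, rotated])
            (rule C1_fieldD(1)[OF C1_basis_field[OF E] q(3)])
        then show "w = 0" using C1_basis_zero[OF E q(3), of "\<lambda>i. w $ i"] by (simp add: vec_eq_iff)
      qed
      then have "invertible (e x)"
        by (metis invertible_left_inverse matrix_left_invertible_ker)
      then show det: "det (e x) \<noteq> 0" by (simp add: invertible_det_nz)
      have "e x *v (\<chi> i. a j q i) = e' x"
        unfolding mult e'_def iq a[OF q(3)] ..
      then have "(\<chi> i. a j q i) = (\<chi> k. det (\<chi> i l. if l = k then e' x $ i else e x $ i $ l) / det (e x))"
        using cramer[OF det] by blast
      then show "a j (inv_into U \<phi> x) i = det (e'' x) / det (e x)"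
        unfolding iq e''_def by (simp add: vec_eq_iff)
    qed
    have "C1_on (\<lambda>x. det (e'' x) / det (e x)) ?S"
      by (intro C1_on_divide C1_on_det C1e C1e'' main(1))
    then have "C1_on (\<lambda>x. a j (inv_into U \<phi> x) i) ?S"
      by (rule C1_on_cong[OF chart_image_open'[OF U N(1)], rotated]) (simp add: main(2))
    then show "case c of (U, \<phi>) \<Rightarrow> C1_on ((\<lambda>q. a j q i) \<circ> inv_into U \<phi>) (\<phi> ` (U \<inter> N))"
      by (simp add: c o_def)
  qed
  then show ?thesis
    unfolding transformation_def using a by (intro exI[of _ "\<lambda>i j q. a j q i"]) blast
qed

end

section \<open>Bases along a path\<close>

lemma C1_path_derivative:
  assumes "C1_path M \<A> J \<gamma>" "(U, \<phi>) \<in> \<A>"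
  shows "\<exists>d. continuous_on (J \<inter> \<gamma> -` U) d \<and>
    (\<forall>s\<in>J \<inter> \<gamma> -` U. ((\<phi> \<circ> \<gamma>) has_vector_derivative d s) (at s within J) \<and> d s \<noteq> 0)"
  using bspec[OF conjunct2[OF conjunct2[OF conjunct2[OF conjunct2[OF assms(1)[unfolded C1_path_def]]]]] assms(2)]
  by (simp only: case_prod_conv)

lemma C1_path_chart_derivative:
  assumes "C1_path M \<A> J \<gamma>" "(U, \<phi>) \<in> \<A>" "\<gamma> ` J \<subseteq> U"
  shows "\<exists>d. continuous_on J d \<and>
    (\<forall>s\<in>J. ((\<phi> \<circ> \<gamma>) has_vector_derivative d s) (at s within J) \<and> d s \<noteq> 0)"
proof -
  have "J \<inter> \<gamma> -` U = J" using assms(3) by blast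
  then show ?thesis using C1_path_derivative[OF assms(1,2)] by simp
qed

lemma C1_path_subset:
  assumes "C1_path M \<A> J \<gamma>" "K \<subseteq> J" "is_interval K" "\<exists>a\<in>K. \<exists>b\<in>K. a < b"
  shows "C1_path M \<A> K \<gamma>"
  unfolding C1_path_def
proof (intro conjI ballI)
  show "\<gamma> ` K \<subseteq> M" "continuous_on K \<gamma>"
    using assms(1,2) unfolding C1_path_def by (auto intro: continuous_on_subset)
  fix c assume "c \<in> \<A>"
  moreover obtain U \<phi> where c: "c = (U, \<phi>)" by (cases c)
  ultimately have U: "(U, \<phi>) \<in> \<A>" by simp
  from C1_path_derivative[OF assms(1) this] obtain d where d: "continuous_on (J \<inter> \<gamma> -` U) d"
    "\<And>s. s \<in> J \<inter> \<gamma> -` U \<Longrightarrow> ((\<phi> \<circ> \<gamma>) has_vector_derivative d s) (at s within J) \<and> d s \<noteq> 0"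
    by blast
  have "continuous_on (K \<inter> \<gamma> -` U) d"
    by (rule continuous_on_subset[OF d(1)]) (use assms(2) in blast)
  moreover have "((\<phi> \<circ> \<gamma>) has_vector_derivative d s) (at s within K) \<and> d s \<noteq> 0"
    if "s \<in> K \<inter> \<gamma> -` U" for s
  proof -
    have "s \<in> J \<inter> \<gamma> -` U" using that assms(2) by blast
    from d(2)[OF this] show ?thesis using has_vector_derivative_within_subset assms(2) by blast
  qed
  ultimately show "case c of (U, \<phi>) \<Rightarrow> \<exists>d. continuous_on (K \<inter> \<gamma> -` U) d \<and>
        (\<forall>s\<in>K \<inter> \<gamma> -` U. ((\<phi> \<circ> \<gamma>) has_vector_derivative d s) (at s within K) \<and> d s \<noteq> 0)"
    unfolding c by auto
qed (use assms in auto)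

lemma sum_swap3: "(\<Sum>i\<in>I. \<Sum>l\<in>L. \<Sum>m\<in>H. f i l m) = (\<Sum>m\<in>H. \<Sum>l\<in>L. \<Sum>i\<in>I. f i l m)"
proof -
  have "(\<Sum>i\<in>I. \<Sum>l\<in>L. \<Sum>m\<in>H. f i l m) = (\<Sum>i\<in>I. \<Sum>m\<in>H. \<Sum>l\<in>L. f i l m)"
    by (intro sum.cong refl sum.swap)
  also have "\<dots> = (\<Sum>m\<in>H. \<Sum>i\<in>I. \<Sum>l\<in>L. f i l m)" by (rule sum.swap)
  also have "\<dots> = (\<Sum>m\<in>H. \<Sum>l\<in>L. \<Sum>i\<in>I. f i l m)" by (intro sum.cong refl sum.swap)
  finally show ?thesis .
qed

lemma nondegenerate_Icc: "a < b \<Longrightarrow> \<exists>p\<in>{a..b}. \<exists>q\<in>{a..b}. p < (q::real)"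
  by (rule bexI[of _ a], rule bexI[of _ b]) auto

context c2_manifold
begin

text \<open>A time function along a short compact piece makes it injective, and a continuous injection of a
  compact interval into a Hausdorff space is an embedding.\<close>

lemma C1_path_local_arc:
  assumes \<gamma>: "C1_path M \<A> J \<gamma>" and \<sigma>: "\<sigma> \<in> J"
  shows "\<exists>K U \<phi>. \<sigma> \<in> K \<and> K \<subseteq> J \<and> (U, \<phi>) \<in> \<A> \<and> \<gamma> ` K \<subseteq> U \<and> without_self_intersections M \<A> K \<gamma>"
proof -
  have J: "is_interval J" "\<exists>a\<in>J. \<exists>b\<in>J. a < b" and cont: "continuous_on J \<gamma>" and "\<gamma> ` J \<subseteq> M"
    using \<gamma> unfolding C1_path_def by blast+
  obtain U \<phi> where U: "(U, \<phi>) \<in> \<A>" "\<gamma> \<sigma> \<in> U" using chart_at \<open>\<gamma> ` J \<subseteq> M\<close> \<sigma> by blast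
  obtain T where T: "open T" "\<sigma> \<in> T" "\<And>s. s \<in> J \<Longrightarrow> s \<in> T \<Longrightarrow> \<gamma> s \<in> U"
    using cont[unfolded continuous_on_topological] \<sigma> U chart_open[OF U(1)] by metis
  obtain e where e: "0 < e" "cball \<sigma> e \<subseteq> T" using T(1,2) open_contains_cball by blast
  obtain a b where ab: "\<sigma> \<in> {a..b}" "{a..b} \<subseteq> J" "{a..b} \<subseteq> cball \<sigma> e" "a < b"
    by (rule interval_compact_nbhd[OF J(1) \<sigma> e(1)]) (use J(2) in auto)
  have \<gamma>ab: "C1_path M \<A> {a..b} \<gamma>"
    by (rule C1_path_subset[OF \<gamma> ab(2)]) (rule is_interval_cc nondegenerate_Icc[OF ab(4)])+
  have inU: "\<gamma> ` {a..b} \<subseteq> U" using T(3) ab(2,3) e(2) by blast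
  obtain d where d: "continuous_on {a..b} d"
    "\<And>s. s \<in> {a..b} \<Longrightarrow> ((\<phi> \<circ> \<gamma>) has_vector_derivative d s) (at s within {a..b})"
    "\<And>s. s \<in> {a..b} \<Longrightarrow> d s \<noteq> 0"
    using C1_path_chart_derivative[OF \<gamma>ab U(1) inU] by blast
  obtain a' b' t where K: "a' < b'" "\<sigma> \<in> {a'..b'}" "{a'..b'} \<subseteq> {a..b}"
    and t: "\<forall>s\<in>{a'..b'}. t ((\<phi> \<circ> \<gamma>) s) = s"
    by (rule curve_time_function[OF is_interval_cc nondegenerate_Icc[OF ab(4)] ab(1) d(1,2) d(3)[OF ab(1)]]) blast+
  let ?K = "{a'..b'}"
  have \<gamma>K: "C1_path M \<A> ?K \<gamma>"
    by (rule C1_path_subset[OF \<gamma>ab K(3)]) (rule is_interval_cc nondegenerate_Icc[OF K(1)])+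
  have "inj_on \<gamma> ?K"
  proof (rule inj_onI)
    fix r s assume "r \<in> ?K" "s \<in> ?K" "\<gamma> r = \<gamma> s"
    then show "r = s" using t by (metis comp_apply)
  qed
  moreover have "continuous_on ?K \<gamma>" using \<gamma>K unfolding C1_path_def by blast
  ultimately have "\<exists>g. homeomorphism ?K (\<gamma> ` ?K) \<gamma> g"
    by (intro homeomorphism_compact) auto
  then have "without_self_intersections M \<A> ?K \<gamma>"
    unfolding without_self_intersections_def using \<gamma>K by blast
  moreover have "\<gamma> ` ?K \<subseteq> U" "?K \<subseteq> J" using inU K(3) ab(2) by blast+
  ultimately show ?thesis using K(2) U(1) by blast
qed

end

context c2_connection
begin

text \<open>The columns of the matrix function from \<open>parallel_frame_extension\<close> are the components of the
  required basis with respect to the coordinate basis \<open>X\<close>. In the law of change the two terms cancel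
  on the arc by the choice of the derivative of that matrix function.\<close>

lemma vanishing_frame_along_arc:
  assumes U: "(U, \<phi>) \<in> \<A>" and arc: "without_self_intersections M \<A> K \<gamma>" and inU: "\<gamma> ` K \<subseteq> U"
  shows "\<exists>N E. open N \<and> N \<subseteq> U \<and> \<gamma> ` K \<subseteq> N \<and> C1_basis \<A> N E \<and>
    (\<forall>s\<in>K. components_vanish_at nabla N E (\<gamma> s))"
proof -
  have path: "C1_path M \<A> K \<gamma>" using arc unfolding without_self_intersections_def by blast
  obtain g where g: "homeomorphism K (\<gamma> ` K) \<gamma> g" using arc unfolding without_self_intersections_def by blast
  have K: "is_interval K" "\<exists>p\<in>K. \<exists>q\<in>K. p < q" using path unfolding C1_path_def by blast+
  let ?c = "\<phi> \<circ> \<gamma>"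
  let ?i = "inv_into U \<phi>"
  obtain d where d: "continuous_on K d"
    "\<forall>s\<in>K. (?c has_vector_derivative d s) (at s within K) \<and> d s \<noteq> 0"
    using C1_path_chart_derivative[OF path U inU] by blast
  have "homeomorphism (\<gamma> ` K) (?c ` K) \<phi> ?i"
    by (rule homeomorphism_of_subsets[OF chart_homeomorphism[OF U] inU]) (use inU in auto)
  from homeomorphism_compose[OF g this] have hom: "homeomorphism K (?c ` K) ?c (g \<circ> ?i)" .
  have opU: "open U" and subM: "U \<subseteq> M" using chart_open[OF U] chart_subset[OF U] by auto
  define X where "X i p = chart_vector \<A> (U, \<phi>) p (column i (mat 1))" for i p
  have X: "C1_basis \<A> U X"
    unfolding X_def[abs_def] by (rule C1_basis_chart[OF U opU order_refl C1_on_const]) simp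
  note X0 = C1_field_imp_continuous_field[OF C1_basis_field[OF X]]
  have nabX: "nabla (X k) (X j) p \<in> tangent_space \<A> p" if "p \<in> U" for k j p
    by (rule nabla_tangent[OF opU subM X that])
  define \<Gamma> where "\<Gamma> k x = (\<chi> i j. comp (nabla (X k) (X j) (?i x)) (U, \<phi>) $ i)" for k x
  have cont\<Gamma>: "continuous_on (\<phi> ` U) (\<Gamma> k)" for k
  proof -
    have "continuous_field \<A> U (nabla (X k) (X j))" for j
      by (rule nabla_continuous[OF opU subM X0 X0 C1_basis_field[OF X] C1_basis_field[OF X]])
    from continuous_fieldD(2)[OF this U]
    have "continuous_on U (\<lambda>p. comp (nabla (X k) (X j) p) (U, \<phi>))" for j by simp
    moreover have "continuous_on (\<phi> ` U) ?i" "?i ` \<phi> ` U \<subseteq> U"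
      using chart_homeomorphism[OF U] by (auto simp: homeomorphism_def)
    ultimately have "continuous_on (\<phi> ` U) (\<lambda>x. comp (nabla (X k) (X j) (?i x)) (U, \<phi>))" for j
      using continuous_on_compose2 by blast
    then show ?thesis unfolding \<Gamma>_def[abs_def] by (intro continuous_intros)
  qed
  have frame: "(\<Sum>i\<in>UNIV. w $ i *\<^sub>R X i p) = chart_vector \<A> (U, \<phi>) p w" if "p \<in> U" for w p
  proof -
    have "(\<Sum>i\<in>UNIV. w $ i *\<^sub>R column i (mat 1)) = w"
      using matrix_mult_sum[of "mat 1" w] by (simp add: scalar_mult_eq_scaleR)
    then show ?thesis by (simp add: X_def chart_vector_sum[OF U that])
  qed
  have nabX_eq: "nabla (X k) (X j) p = (\<Sum>m\<in>UNIV. \<Gamma> k (\<phi> p) $ m $ j *\<^sub>R X m p)" if "p \<in> U" for k j p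
  proof -
    have "nabla (X k) (X j) p = chart_vector \<A> (U, \<phi>) p (comp (nabla (X k) (X j) p) (U, \<phi>))"
      by (rule chart_vector_comp[OF U that nabX[OF that], symmetric])
    also have "\<dots> = (\<Sum>m\<in>UNIV. comp (nabla (X k) (X j) p) (U, \<phi>) $ m *\<^sub>R X m p)"
      by (rule frame[OF that, symmetric])
    finally show ?thesis using that by (simp add: \<Gamma>_def U)
  qed
  have cU: "?c ` K \<subseteq> \<phi> ` U" using inU by auto
  obtain W A where W: "open W" "?c ` K \<subseteq> W" "W \<subseteq> \<phi> ` U" and A: "C1_on A W"
    and det: "\<forall>x\<in>W. det (A x) \<noteq> 0"
    and dA: "\<forall>s\<in>K. (A has_derivative (\<lambda>v. - (\<Sum>k\<in>UNIV. v $ k *\<^sub>R (\<Gamma> k (?c s) ** A (?c s))))) (at (?c s))"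
    using parallel_frame_extension[where \<Gamma> = \<Gamma>, OF K hom d chart_image_open[OF U] cU cont\<Gamma>]
    by (elim exE conjE) (rule that)
  define N where "N = U \<inter> \<phi> -` W"
  have "continuous_on U \<phi>" using chart_homeomorphism[OF U] by (simp add: homeomorphism_def)
  then have opN: "open N" unfolding N_def using opU W(1) by (rule continuous_open_preimage)
  have NU: "N \<subseteq> U" by (auto simp: N_def)
  have \<phi>N: "\<phi> ` N = W" using W(3) by (auto simp: N_def)
  have \<gamma>N: "\<gamma> ` K \<subseteq> N" using W(2) inU by (auto simp: N_def)
  have NM: "N \<subseteq> M" using NU subM by blast
  define E where "E j p = chart_vector \<A> (U, \<phi>) p (column j (A (\<phi> p)))" for j p
  have E: "C1_basis \<A> N E"
    unfolding E_def[abs_def] using A det by (intro C1_basis_chart[OF U opN NU]) (simp_all add: \<phi>N)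
  define B where "B i j p = A (\<phi> p) $ i $ j" for i j p
  have CA: "C1_on (\<lambda>x. A x $ i $ j) W" for i j
    by (intro C1_on_bounded_linear[OF bounded_linear_compose[OF bounded_linear_vec_nth bounded_linear_vec_nth]] A)
  have C1B: "C1_function \<A> N (B i j)" for i j
    unfolding B_def[abs_def] by (rule C1_function_chart[OF U opN NU]) (simp add: \<phi>N CA)
  have EB: "E j p = (\<Sum>i\<in>UNIV. B i j p *\<^sub>R X i p)" if "p \<in> N" for j p
    using frame[of p "column j (A (\<phi> p))"] that NU by (auto simp: E_def B_def column_def)
  have trans: "transformation \<A> N X E B"
    unfolding transformation_def using C1B EB by blast
  have "components_vanish_at nabla N E (\<gamma> s)" if s: "s \<in> K" for s
    unfolding components_vanish_at_iff[OF opN NM E subsetD[OF \<gamma>N imageI[OF s]]]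
  proof (intro allI)
    fix j k
    let ?p = "\<gamma> s"
    have p: "?p \<in> N" "?p \<in> U" using \<gamma>N NU s by blast+
    have act: "act \<A> ?p (E k ?p) (B i j) =
        - (\<Sum>l\<in>UNIV. B l k ?p * (\<Sum>m\<in>UNIV. \<Gamma> l (\<phi> ?p) $ i $ m * B m j ?p))" for i
    proof -
      have Ek: "E k ?p \<in> tangent_space \<A> ?p" by (simp add: E_def chart_vector_tangent[OF U p(2)])
      have "((\<lambda>x. A x $ i $ j) has_derivative (\<lambda>v. (- (\<Sum>k\<in>UNIV. v $ k *\<^sub>R (\<Gamma> k (?c s) ** A (?c s)))) $ i $ j))
          (at (?c s))"
        by (intro bounded_linear.has_derivative[OF bounded_linear_compose[OF bounded_linear_vec_nth bounded_linear_vec_nth]] bspec[OF dA s])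
      then have "((B i j \<circ> ?i) has_derivative (\<lambda>v. (- (\<Sum>k\<in>UNIV. v $ k *\<^sub>R (\<Gamma> k (?c s) ** A (?c s)))) $ i $ j))
          (at (?c s))"
        by (rule has_derivative_transform_within_open[OF _ W(1)])
          (use W s U in \<open>auto simp: B_def f_inv_into_f\<close>)
      from frechet_derivative_at[OF this]
      have "act \<A> ?p (E k ?p) (B i j) = (- (\<Sum>l\<in>UNIV. column k (A (\<phi> ?p)) $ l *\<^sub>R (\<Gamma> l (\<phi> ?p) ** A (\<phi> ?p)))) $ i $ j"
        unfolding act_chart[OF C1B opN p(1) Ek U p(2)] by (simp add: E_def comp_chart_vector_self[OF U p(2)] fun_eq_iff)
      then show ?thesis by (simp add: B_def column_def matrix_matrix_mult_def)
    qed
    have "nabla (E k) (E j) ?p = (\<Sum>i\<in>UNIV. act \<A> ?p (E k ?p) (B i j) *\<^sub>R X i ?p) +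
        (\<Sum>i\<in>UNIV. B i j ?p *\<^sub>R (\<Sum>l\<in>UNIV. B l k ?p *\<^sub>R nabla (X l) (X i) ?p))"
      by (simp add: nabla_transformation[OF opN NM C1_basis_subset[OF X NU] E trans p(1)] sum.distrib)
    also have "(\<Sum>i\<in>UNIV. B i j ?p *\<^sub>R (\<Sum>l\<in>UNIV. B l k ?p *\<^sub>R nabla (X l) (X i) ?p)) =
        (\<Sum>i\<in>UNIV. \<Sum>l\<in>UNIV. \<Sum>m\<in>UNIV. (B i j ?p * (B l k ?p * \<Gamma> l (\<phi> ?p) $ m $ i)) *\<^sub>R X m ?p)"
      by (simp add: nabX_eq[OF p(2)] scaleR_sum_right)
    also have "\<dots> = (\<Sum>m\<in>UNIV. \<Sum>l\<in>UNIV. \<Sum>i\<in>UNIV. (B i j ?p * (B l k ?p * \<Gamma> l (\<phi> ?p) $ m $ i)) *\<^sub>R X m ?p)"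
      by (rule sum_swap3)
    also have "\<dots> = (\<Sum>m\<in>UNIV. (\<Sum>l\<in>UNIV. B l k ?p * (\<Sum>i\<in>UNIV. \<Gamma> l (\<phi> ?p) $ m $ i * B i j ?p)) *\<^sub>R X m ?p)"
      by (simp add: scaleR_sum_left sum_distrib_left mult_ac)
    finally show "nabla (E k) (E j) ?p = 0" by (simp add: act sum.distrib[symmetric])
  qed
  then show ?thesis using opN NU \<gamma>N E by blast
qed

end


theorem corollary11:
  fixes M :: "'m::t2_space set"
    and \<A> :: "('m, 'n::finite) chart set"
    and nabla :: "('m \<Rightarrow> ('m, 'n) tvec) \<Rightarrow> ('m \<Rightarrow> ('m, 'n) tvec) \<Rightarrow> 'm \<Rightarrow> ('m, 'n) tvec"
    and J :: "real set" and \<gamma> :: "real \<Rightarrow> 'm"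
  assumes "manifold M \<A>"
    and "linear_connection M \<A> nabla"
    and "C1_path M \<A> J \<gamma>"
  shows "(\<exists>P \<sigma>. basis_along M \<A> J \<gamma> P \<sigma> \<and> components_vanish_along nabla J \<gamma> \<sigma> \<and>
            (\<forall>(K, N, E)\<in>P. \<forall>s\<in>K. components_vanish_at nabla N E (\<gamma> s))) \<and>
         (\<forall>P \<sigma> P' \<sigma>'.
            basis_along M \<A> J \<gamma> P \<sigma> \<and> components_vanish_along nabla J \<gamma> \<sigma> \<and>
            basis_along M \<A> J \<gamma> P' \<sigma>' \<longrightarrow>
              (components_vanish_along nabla J \<gamma> \<sigma>' \<longleftrightarrow>
               (\<forall>s\<in>J. case (\<sigma> (\<gamma> s), \<sigma>' (\<gamma> s)) of ((K, N, E), (K', N', E')) \<Rightarrow>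
                  \<exists>A. transformation \<A> (N \<inter> N') E E' A \<and>
                      (\<forall>i i' k. act \<A> (\<gamma> s) (E k (\<gamma> s)) (A i i') = 0))))"
proof -
  interpret c2_connection M \<A> nabla by unfold_locales (fact assms)+
  note path = assms(3)
  define simple where "simple \<longleftrightarrow>
    without_self_intersections M \<A> J \<gamma> \<and> (\<exists>U. coordinate_nbhd \<A> U \<and> \<gamma> ` J \<subseteq> U)"
  note basis = basis_along_def[of M \<A> J \<gamma>, folded simple_def]
  have existence: "\<exists>P \<sigma>. basis_along M \<A> J \<gamma> P \<sigma> \<and> components_vanish_along nabla J \<gamma> \<sigma> \<and>
            (\<forall>(K, N, E)\<in>P. \<forall>s\<in>K. components_vanish_at nabla N E (\<gamma> s))"
  proof (cases simple)
    case True
    then obtain U \<phi> where "(U, \<phi>) \<in> \<A>" "\<gamma> ` J \<subseteq> U" "without_self_intersections M \<A> J \<gamma>"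
      unfolding simple_def coordinate_nbhd_def by fast
    with vanishing_frame_along_arc obtain N E where N: "open N" "N \<subseteq> U" "\<gamma> ` J \<subseteq> N"
      "C1_basis \<A> N E" and vanish: "\<forall>s\<in>J. components_vanish_at nabla N E (\<gamma> s)" by metis
    have "N \<subseteq> M" using N(2) chart_subset[OF \<open>(U, \<phi>) \<in> \<A>\<close>] by blast
    then have "basis_along M \<A> J \<gamma> {(J, N, E)} (\<lambda>x. (J, N, E))"
      unfolding basis using True N by auto
    moreover have "components_vanish_along nabla J \<gamma> (\<lambda>x. (J, N, E))"
      unfolding components_vanish_along_def using vanish by auto
    ultimately show ?thesis using vanish by blast
  next
    case False
    have "\<exists>K N E. \<sigma> \<in> K \<and> K \<subseteq> J \<and> without_self_intersections M \<A> K \<gamma> \<and> coordinate_nbhd \<A> N \<and>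
        \<gamma> ` K \<subseteq> N \<and> C1_basis \<A> N E \<and> (\<forall>s\<in>K. components_vanish_at nabla N E (\<gamma> s))"
      if \<sigma>: "\<sigma> \<in> J" for \<sigma>
    proof -
      obtain K U \<phi> where K: "\<sigma> \<in> K" "K \<subseteq> J" "(U, \<phi>) \<in> \<A>" "\<gamma> ` K \<subseteq> U"
        "without_self_intersections M \<A> K \<gamma>"
        using C1_path_local_arc[OF path \<sigma>] by blast
      obtain N E where "open N" "N \<subseteq> U" "\<gamma> ` K \<subseteq> N"
        "C1_basis \<A> N E" "\<forall>s\<in>K. components_vanish_at nabla N E (\<gamma> s)"
        using vanishing_frame_along_arc[OF K(3,5,4)] by blast
      moreover have "coordinate_nbhd \<A> N"
        unfolding coordinate_nbhd_def using \<open>open N\<close> \<open>N \<subseteq> U\<close> K(3) by blast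
      ultimately show ?thesis using K by blast
    qed
    then obtain K N E where KNE: "\<And>\<sigma>. \<sigma> \<in> J \<Longrightarrow> \<sigma> \<in> K \<sigma> \<and> K \<sigma> \<subseteq> J \<and>
        without_self_intersections M \<A> (K \<sigma>) \<gamma> \<and> coordinate_nbhd \<A> (N \<sigma>) \<and>
        \<gamma> ` K \<sigma> \<subseteq> N \<sigma> \<and> C1_basis \<A> (N \<sigma>) (E \<sigma>) \<and>
        (\<forall>s\<in>K \<sigma>. components_vanish_at nabla (N \<sigma>) (E \<sigma>) (\<gamma> s))"
      by metis
    define P where "P = (\<lambda>\<sigma>. (K \<sigma>, N \<sigma>, E \<sigma>)) ` J"
    \<comment> \<open>At a self-intersection one of the parameters of the point is selected.\<close>
    define h where "h x = (SOME \<sigma>. \<sigma> \<in> J \<and> \<gamma> \<sigma> = x)" for x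
    have h: "h x \<in> J \<and> \<gamma> (h x) = x" if "x \<in> \<gamma> ` J" for x
      unfolding h_def by (rule someI_ex) (use that in blast)
    have "basis_along M \<A> J \<gamma> P (\<lambda>x. (K (h x), N (h x), E (h x)))"
      unfolding basis if_not_P[OF False]
    proof (intro conjI ballI)
      show "(\<Union>(K, N, E)\<in>P. K) = J" using KNE by (fastforce simp: P_def)
      show "case q of (K, N, E) \<Rightarrow> without_self_intersections M \<A> K \<gamma> \<and>
              coordinate_nbhd \<A> N \<and> \<gamma> ` K \<subseteq> N \<and> C1_basis \<A> N E" if "q \<in> P" for q
        using that KNE by (auto simp: P_def)
      fix x assume x: "x \<in> \<gamma> ` J"
      show "(K (h x), N (h x), E (h x)) \<in> P" using h[OF x] by (auto simp: P_def)
      show "x \<in> \<gamma> ` fst (K (h x), N (h x), E (h x))" using h[OF x] KNE[of "h x"] by (auto intro: rev_image_eqI)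
    qed
    moreover have "components_vanish_along nabla J \<gamma> (\<lambda>x. (K (h x), N (h x), E (h x)))"
      unfolding components_vanish_along_def
    proof
      fix x assume "x \<in> \<gamma> ` J"
      from h[OF this] show "case (K (h x), N (h x), E (h x)) of (K, N, E) \<Rightarrow> components_vanish_at nabla N E x"
        using KNE[of "h x"] by auto
    qed
    moreover have "\<forall>(K, N, E)\<in>P. \<forall>s\<in>K. components_vanish_at nabla N E (\<gamma> s)"
      using KNE by (auto simp: P_def)
    ultimately show ?thesis by blast
  qed
  have change: "components_vanish_along nabla J \<gamma> \<sigma>' \<longleftrightarrow>
               (\<forall>s\<in>J. case (\<sigma> (\<gamma> s), \<sigma>' (\<gamma> s)) of ((K, N, E), (K', N', E')) \<Rightarrow>
                  \<exists>A. transformation \<A> (N \<inter> N') E E' A \<and>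
                      (\<forall>i i' k. act \<A> (\<gamma> s) (E k (\<gamma> s)) (A i i') = 0))"
    if \<sigma>: "basis_along M \<A> J \<gamma> P \<sigma>" and vanish: "components_vanish_along nabla J \<gamma> \<sigma>"
      and \<sigma>': "basis_along M \<A> J \<gamma> P' \<sigma>'" for P \<sigma> P' \<sigma>'
  proof -
    have patch: "open N \<and> N \<subseteq> M \<and> x \<in> N \<and> C1_basis \<A> N E"
      if \<tau>: "basis_along M \<A> J \<gamma> Q \<tau>" and x: "x \<in> \<gamma> ` J" "\<tau> x = (K, N, E)" for Q \<tau> x K N E
    proof -
      have Q: "(K, N, E) \<in> Q" "x \<in> \<gamma> ` K"
        using \<tau> x unfolding basis_along_def by (metis fst_conv)+
      have coord: "open N \<and> N \<subseteq> M" if "coordinate_nbhd \<A> N"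
        using that chart_subset unfolding coordinate_nbhd_def by fast
      show ?thesis
      proof (cases simple)
        case True
        then show ?thesis using \<tau> Q unfolding basis by auto
      next
        case False
        then have "\<forall>(K, N, E)\<in>Q. without_self_intersections M \<A> K \<gamma> \<and>
              coordinate_nbhd \<A> N \<and> \<gamma> ` K \<subseteq> N \<and> C1_basis \<A> N E"
          using \<tau> unfolding basis by auto
        then show ?thesis using Q coord by blast
      qed
    qed
    have point: "(case \<sigma>' (\<gamma> s) of (K, N, E) \<Rightarrow> components_vanish_at nabla N E (\<gamma> s)) \<longleftrightarrow>
        (case (\<sigma> (\<gamma> s), \<sigma>' (\<gamma> s)) of ((K, N, E), (K', N', E')) \<Rightarrow>
                  \<exists>A. transformation \<A> (N \<inter> N') E E' A \<and>
                      (\<forall>i i' k. act \<A> (\<gamma> s) (E k (\<gamma> s)) (A i i') = 0))"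
      if s: "s \<in> J" for s
    proof -
      obtain K N E K' N' E' where eq: "\<sigma> (\<gamma> s) = (K, N, E)" "\<sigma>' (\<gamma> s) = (K', N', E')"
        by (metis prod_cases3)
      let ?N = "N \<inter> N'"
      have N: "open N" "N \<subseteq> M" "\<gamma> s \<in> N" "C1_basis \<A> N E"
        using patch[OF \<sigma> imageI[OF s] eq(1)] by blast+
      have N': "open N'" "N' \<subseteq> M" "\<gamma> s \<in> N'" "C1_basis \<A> N' E'"
        using patch[OF \<sigma>' imageI[OF s] eq(2)] by blast+
      have NN: "open ?N" "?N \<subseteq> M" "\<gamma> s \<in> ?N" "C1_basis \<A> ?N E" "C1_basis \<A> ?N E'"
        using N N' C1_basis_subset[OF N(4) Int_lower1] C1_basis_subset[OF N'(4) Int_lower2] by auto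
      have "components_vanish_at nabla N E (\<gamma> s)"
        using vanish s eq(1) unfolding components_vanish_along_def by fastforce
      then have zero: "nabla (E k) (E j) (\<gamma> s) = 0" for j k
        unfolding components_vanish_at_iff[OF N(1,2,4,3)] by blast
      have *: "(\<forall>i j k. act \<A> (\<gamma> s) (E k (\<gamma> s)) (A i j) = 0) \<longleftrightarrow> components_vanish_at nabla N' E' (\<gamma> s)"
        if "transformation \<A> ?N E E' A" for A
        unfolding components_vanish_at_iff[OF N'(1,2,4,3)]
        using vanishing_transformation_iff[OF NN(1,2,4,5) that NN(3) zero] by blast
      obtain A where "transformation \<A> ?N E E' A"
        using transformation_exists[OF NN(1,2,4,5)] by blast
      with * have "components_vanish_at nabla N' E' (\<gamma> s) \<longleftrightarrow>
          (\<exists>A. transformation \<A> ?N E E' A \<and> (\<forall>i j k. act \<A> (\<gamma> s) (E k (\<gamma> s)) (A i j) = 0))"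
        by blast
      then show ?thesis by (simp add: eq)
    qed
    have "components_vanish_along nabla J \<gamma> \<sigma>' \<longleftrightarrow>
        (\<forall>s\<in>J. case \<sigma>' (\<gamma> s) of (K, N, E) \<Rightarrow> components_vanish_at nabla N E (\<gamma> s))"
    proof -
      have "(\<forall>x\<in>\<gamma> ` J. Q x) \<longleftrightarrow> (\<forall>s\<in>J. Q (\<gamma> s))" for Q by blast
      then show ?thesis unfolding components_vanish_along_def .
    qed
    also have "\<dots> \<longleftrightarrow> (\<forall>s\<in>J. case (\<sigma> (\<gamma> s), \<sigma>' (\<gamma> s)) of ((K, N, E), (K', N', E')) \<Rightarrow>
                  \<exists>A. transformation \<A> (N \<inter> N') E E' A \<and>
                      (\<forall>i i' k. act \<A> (\<gamma> s) (E k (\<gamma> s)) (A i i') = 0))"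
      by (rule ball_cong[OF refl point])
    finally show ?thesis .
  qed
  show ?thesis
  proof (rule conjI[OF existence], intro allI impI, elim conjE)
    fix P \<sigma> P' \<sigma>'
    assume "basis_along M \<A> J \<gamma> P \<sigma>" "components_vanish_along nabla J \<gamma> \<sigma>"
      "basis_along M \<A> J \<gamma> P' \<sigma>'"
    then show "components_vanish_along nabla J \<gamma> \<sigma>' \<longleftrightarrow>
               (\<forall>s\<in>J. case (\<sigma> (\<gamma> s), \<sigma>' (\<gamma> s)) of ((K, N, E), (K', N', E')) \<Rightarrow>
                  \<exists>A. transformation \<A> (N \<inter> N') E E' A \<and>
                      (\<forall>i i' k. act \<A> (\<gamma> s) (E k (\<gamma> s)) (A i i') = 0))"
      by (rule change)
  qed
qed

end
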